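(* Let $A\,|\,B$ be an irreducible extension of $K$-algebras with centralizer $R=A^B$, and let $S=\mathrm{End}({}_BA_B)$ with its left $R$-bialgebroid structure $(S,R,\lambda,\rho,\Delta,\varepsilon)$. Let $\tau:S\to S$ be the anti-automorphism of $S$ determined by $$\alpha(t^1)t^2=t^1\,\tau(\alpha)(t^2)\qquad\text{for all }\alpha\in S,\ t=t^1\otimes_B t^2\in T .$$ Then $\tau$ is an antipode and $S$ is a Hopf algebroid; that is, there is a right bialgebroid structure on $S$ over $R^{\mathrm{op}}=R$ which, together with the given left bialgebroid structure and with $\tau$ as antipode, makes $S$ a Hopf algebroid in the sense of B\"ohm--Szlach\'anyi.
   Context: $K$ is a commutative ring, $A$ an associative unital $K$-algebra, $B\subseteq A$ a unital subalgebra. For an $A$-$A$-bimodule $M$, $M^B=\{m\in M: bm=mb\ \forall b\in B\}$. Put $R=A^B$ (the centralizer of $B$ in $A$), $S=\mathrm{End}({}_BA_B)$ ($B$-$B$-bimodule endomorphisms of $A$, an algebra under composition), $T=(A\otimes_BA)^B$. Elements of $T$ are written $t=t^1\otimes_B t^2$ with summation suppressed. $A\,|\,B$ is \emph{depth two} if for some positive integer $N$, $A\otimes_BA$ is isomorphic to a direct summand of $A^N$, both as natural $B$-$A$-bimodules (left D2) and as natural $A$-$B$-bimodules (right D2). Left D2 is equivalent to the existence of a left D2 quasibasis: finitely many $\beta_i\in S$, $t_i\in T$ with $a\otimes_B a'=\sum_i t_i\beta_i(a)a'$ for all $a,a'\in A$. $A\,|\,B$ is \emph{irreducible} if it is depth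 two (on both sides) and $R\subseteq B$; then $R$ is commutative. For $r\in R$ let $\lambda_r,\rho_r\in S$ be $\lambda_r(a)=ra$, $\rho_r(a)=ar$. The left $R$-bialgebroid structure on $S$ has source $s_L=\lambda$, target $t_L=\rho$ (so $r\cdot\alpha\cdot s=r\alpha(-)s$), coproduct $\Delta(\alpha)=\sum_i\alpha(-\,t_i^1)t_i^2\otimes_R\beta_i$ and counit $\varepsilon(\alpha)=\alpha(1)$. Under the isomorphism $S\otimes_RS\cong\mathrm{Hom}({}_BA\otimes_BA_B,{}_BA_B)$, $\alpha\otimes\beta\mapsto(x\otimes y\mapsto\alpha(x)\beta(y))$, $\Delta(\alpha)$ corresponds to $x\otimes y\mapsto\alpha(xy)$. Existence and uniqueness of $\tau$: for an irreducible extension one has $\mathrm{Hom}(T_R,R_R)=\mathrm{Hom}({}_RT,{}_RR)$ (where $r\cdot t\cdot s=rt^1\otimes t^2s$), and both $\alpha\mapsto(t\mapsto\alpha(t^1)t^2)$ and $\alpha\mapsto(t\mapsto t^1\alpha(t^2))$ are bijections from $S$ onto this group. \textbf{Left bialgebroid} $(H,R,s_L,t_L,\Delta,\varepsilon)$: $H,R$ are $K$-algebras, $s_L:R\to H$ is an algebra homomorphism, $t_L:R\to H$ an algebra anti-homomorphism, $s_L(r)t_L(s)=t_L(s)s_L(r)$; with $R$-bimodule structure $r\cdot h\cdot s=s_L(r)t_L(s)h$, $(H,\Delta,\varepsilon)$ is an $R$-coring (coassociative and counital with $R$-bimodule maps $\Delta:H\to H\otimes_RH$, $\varepsilon:H\to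 R$); $a_{(1)}t_L(r)\otimes a_{(2)}=a_{(1)}\otimes a_{(2)}s_L(r)$; $\Delta(ab)=\Delta(a)\Delta(b)$, $\Delta(1)=1\otimes1$; $\varepsilon(ab)=\varepsilon(a\,s_L(\varepsilon(b)))=\varepsilon(a\,t_L(\varepsilon(b)))$, $\varepsilon(1)=1$. \textbf{Right bialgebroid} $(H,R,s_R,t_R,\Delta,\varepsilon)$: the opposite notion: $s_R:R\to H$ is a homomorphism, $t_R:R\to H$ an anti-homomorphism, with commuting images; with $r\cdot h\cdot s=h\,s_R(s)t_R(r)$, $(H,\Delta,\varepsilon)$ is an $R$-coring; $s_R(r)a_{(1)}\otimes a_{(2)}=a_{(1)}\otimes t_R(r)a_{(2)}$; $\Delta$ is multiplicative and unital; $\varepsilon(ab)=\varepsilon(s_R(\varepsilon(a))b)=\varepsilon(t_R(\varepsilon(a))b)$, $\varepsilon(1)=1$. \textbf{Hopf algebroid} (B\"ohm--Szlach\'anyi): an algebra $H$ with a left bialgebroid structure $(H,R,s_L,t_L,\Delta_L,\varepsilon_L)$ and a right bialgebroid structure $(H,R^{\mathrm{op}},s_R,t_R,\Delta_R,\varepsilon_R)$ such that (1) $\mathrm{Im}\,s_R=\mathrm{Im}\,t_L$ and $\mathrm{Im}\,t_R=\mathrm{Im}\,s_L$; (2) $(1\otimes\Delta_L)\Delta_R=(\Delta_R\otimes1)\Delta_L$ and $(1\otimes\Delta_R)\Delta_L=(\Delta_L\otimes1)\Delta_R$; together with an algebra anti-automorphism $\tau:H\to H$ (the \emph{antipode}) such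 that (i) $\tau(a\,t_R(r))=s_R(r)\tau(a)$ and $\tau(t_L(r)a)=\tau(a)s_L(r)$ for all $r\in R$, $a\in H$; (ii) $a^{(1)}\tau(a^{(2)})=s_L(\varepsilon_L(a))$ and $\tau(a_{(1)})a_{(2)}=s_R(\varepsilon_R(a))$ for all $a\in H$, where $\Delta_R(a)=a^{(1)}\otimes a^{(2)}$ and $\Delta_L(a)=a_{(1)}\otimes a_{(2)}$. *)

theory Defs
  imports "HOL-Algebra.Module" "HOL-Algebra.Subrings" "HOL-Algebra.Generated_Groups"
    "HOL-Algebra.Free_Abelian_Groups"
begin

section \<open>Algebras over a commutative ring\<close>

text \<open>The library locale \<^locale>\<open>algebra\<close> only covers commutative algebras.\<close>

locale assoc_algebra = module K A + ring A for K (structure) and A (structure) +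
  assumes smult_mult_left:
    "\<lbrakk> k \<in> carrier K; x \<in> carrier A; y \<in> carrier A \<rbrakk> \<Longrightarrow>
      (k \<odot>\<^bsub>A\<^esub> x) \<otimes>\<^bsub>A\<^esub> y = k \<odot>\<^bsub>A\<^esub> (x \<otimes>\<^bsub>A\<^esub> y)"
    and smult_mult_right:
    "\<lbrakk> k \<in> carrier K; x \<in> carrier A; y \<in> carrier A \<rbrakk> \<Longrightarrow>
      x \<otimes>\<^bsub>A\<^esub> (k \<odot>\<^bsub>A\<^esub> y) = k \<odot>\<^bsub>A\<^esub> (x \<otimes>\<^bsub>A\<^esub> y)"

definition alg_hom ::
  "('k, 'm) ring_scheme \<Rightarrow> ('k, 'a, 'n) module_scheme \<Rightarrow> ('k, 'b, 'p) module_scheme \<Rightarrow> ('a \<Rightarrow> 'b) set"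
  where "alg_hom K A A' =
    {f \<in> ring_hom A A'. \<forall>k\<in>carrier K. \<forall>x\<in>carrier A. f (k \<odot>\<^bsub>A\<^esub> x) = k \<odot>\<^bsub>A'\<^esub> f x}"

definition opp :: "('k, 'a, 'n) module_scheme \<Rightarrow> ('k, 'a, 'n) module_scheme"
  where "opp A = A\<lparr>mult := (\<lambda>x y. y \<otimes>\<^bsub>A\<^esub> x)\<rparr>"

definition unital_subalgebra ::
  "('k, 'm) ring_scheme \<Rightarrow> ('k, 'a, 'n) module_scheme \<Rightarrow> 'a set \<Rightarrow> bool"
  where "unital_subalgebra K A B \<longleftrightarrow>
    subring B A \<and> (\<forall>k\<in>carrier K. \<forall>b\<in>B. k \<odot>\<^bsub>A\<^esub> b \<in> B)"


section \<open>Bimodules\<close>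

text \<open>As in \<^theory>\<open>HOL-Algebra.Free_Abelian_Groups\<close>, the underlying abelian group of a bimodule is
  a commutative monoid record written multiplicatively, so \<open>x \<otimes>\<^bsub>M\<^esub> y\<close> is the module addition
  and \<open>\<one>\<^bsub>M\<^esub>\<close> the zero element.\<close>

record ('l, 'm, 'r) bimod = "'m monoid" +
  lact :: "'l \<Rightarrow> 'm \<Rightarrow> 'm"
  ract :: "'m \<Rightarrow> 'r \<Rightarrow> 'm"

definition mk_bimod ::
  "('m, 'z) monoid_scheme \<Rightarrow> ('l \<Rightarrow> 'm \<Rightarrow> 'm) \<Rightarrow> ('m \<Rightarrow> 'r \<Rightarrow> 'm) \<Rightarrow> ('l, 'm, 'r) bimod"
  where "mk_bimod G l r =
    \<lparr>carrier = carrier G, monoid.mult = monoid.mult G, one = one G, lact = l, ract = r\<rparr>"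

text \<open>The regular bimodule, used for every pair of subrings of \<open>A\<close>.\<close>

definition reg_bimod :: "('a, 'n) ring_scheme \<Rightarrow> ('a, 'a, 'a) bimod"
  where "reg_bimod A = mk_bimod (add_monoid A) (\<lambda>a x. a \<otimes>\<^bsub>A\<^esub> x) (\<lambda>x a. x \<otimes>\<^bsub>A\<^esub> a)"

locale bimodule = L: ring L + R: ring R + M: comm_group M
  for L :: "('l, 'p) ring_scheme" and R :: "('r, 'q) ring_scheme" and M :: "('l, 'm, 'r) bimod" +
  assumes lact_closed: "\<lbrakk> a \<in> carrier L; x \<in> carrier M \<rbrakk> \<Longrightarrow> lact M a x \<in> carrier M"
    and ract_closed: "\<lbrakk> x \<in> carrier M; b \<in> carrier R \<rbrakk> \<Longrightarrow> ract M x b \<in> carrier M"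
    and lact_add: "\<lbrakk> a \<in> carrier L; x \<in> carrier M; y \<in> carrier M \<rbrakk> \<Longrightarrow>
      lact M a (x \<otimes>\<^bsub>M\<^esub> y) = lact M a x \<otimes>\<^bsub>M\<^esub> lact M a y"
    and ract_add: "\<lbrakk> x \<in> carrier M; y \<in> carrier M; b \<in> carrier R \<rbrakk> \<Longrightarrow>
      ract M (x \<otimes>\<^bsub>M\<^esub> y) b = ract M x b \<otimes>\<^bsub>M\<^esub> ract M y b"
    and add_lact: "\<lbrakk> a \<in> carrier L; a' \<in> carrier L; x \<in> carrier M \<rbrakk> \<Longrightarrow>
      lact M (a \<oplus>\<^bsub>L\<^esub> a') x = lact M a x \<otimes>\<^bsub>M\<^esub> lact M a' x"
    and add_ract: "\<lbrakk> x \<in> carrier M; b \<in> carrier R; b' \<in> carrier R \<rbrakk> \<Longrightarrow>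
      ract M x (b \<oplus>\<^bsub>R\<^esub> b') = ract M x b \<otimes>\<^bsub>M\<^esub> ract M x b'"
    and lact_mult: "\<lbrakk> a \<in> carrier L; a' \<in> carrier L; x \<in> carrier M \<rbrakk> \<Longrightarrow>
      lact M (a \<otimes>\<^bsub>L\<^esub> a') x = lact M a (lact M a' x)"
    and ract_mult: "\<lbrakk> x \<in> carrier M; b \<in> carrier R; b' \<in> carrier R \<rbrakk> \<Longrightarrow>
      ract M x (b \<otimes>\<^bsub>R\<^esub> b') = ract M (ract M x b) b'"
    and lact_one: "x \<in> carrier M \<Longrightarrow> lact M \<one>\<^bsub>L\<^esub> x = x"
    and ract_one: "x \<in> carrier M \<Longrightarrow> ract M x \<one>\<^bsub>R\<^esub> = x"
    and lact_ract: "\<lbrakk> a \<in> carrier L; x \<in> carrier M; b \<in> carrier R \<rbrakk> \<Longrightarrow>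
      ract M (lact M a x) b = lact M a (ract M x b)"

text \<open>Here and below, acting rings are given by their carrier sets \<open>L\<close> and \<open>R\<close>.\<close>

definition bimod_hom ::
  "'l set \<Rightarrow> 'r set \<Rightarrow> ('l, 'm, 'r) bimod \<Rightarrow> ('l, 'n, 'r) bimod \<Rightarrow> ('m \<Rightarrow> 'n) set"
  where "bimod_hom L R M N = {f \<in> hom M N.
    (\<forall>a\<in>L. \<forall>x\<in>carrier M. f (lact M a x) = lact N a (f x)) \<and>
    (\<forall>x\<in>carrier M. \<forall>b\<in>R. f (ract M x b) = ract N (f x) b)}"

definition sub_bimod :: "'l set \<Rightarrow> 'r set \<Rightarrow> 'm set \<Rightarrow> ('l, 'm, 'r) bimod \<Rightarrow> bool"
  where "sub_bimod L R P M \<longleftrightarrow> subgroup P M \<and>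
    (\<forall>a\<in>L. \<forall>x\<in>P. lact M a x \<in> P) \<and> (\<forall>x\<in>P. \<forall>b\<in>R. ract M x b \<in> P)"

definition iso_to_direct_summand ::
  "'l set \<Rightarrow> 'r set \<Rightarrow> ('l, 'm, 'r) bimod \<Rightarrow> ('l, 'n, 'r) bimod \<Rightarrow> bool"
  where "iso_to_direct_summand L R M N \<longleftrightarrow>
    (\<exists>P Q. sub_bimod L R P N \<and> sub_bimod L R Q N \<and> P \<inter> Q = {\<one>\<^bsub>N\<^esub>} \<and> P <#>\<^bsub>N\<^esub> Q = carrier N \<and>
      (\<exists>f \<in> bimod_hom L R M N. bij_betw f (carrier M) P))"

definition bimod_power :: "('l, 'm, 'r) bimod \<Rightarrow> nat \<Rightarrow> ('l, nat \<Rightarrow> 'm, 'r) bimod"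
  where "bimod_power M n = mk_bimod (product_group {..<n} (\<lambda>_. M))
    (\<lambda>a v. \<lambda>i\<in>{..<n}. lact M a (v i)) (\<lambda>v b. \<lambda>i\<in>{..<n}. ract M (v i) b)"


section \<open>Tensor products\<close>

definition list_sum :: "('m, 'z) monoid_scheme \<Rightarrow> 'm list \<Rightarrow> 'm"
  where "list_sum G xs = foldr (\<lambda>x y. x \<otimes>\<^bsub>G\<^esub> y) xs \<one>\<^bsub>G\<^esub>"

definition tensor_rels ::
  "'r set \<Rightarrow> ('l, 'm, 'r) bimod \<Rightarrow> ('r, 'n, 's) bimod \<Rightarrow> (('m \<times> 'n) \<Rightarrow>\<^sub>0 int) set"
  where "tensor_rels R M N =
    {frag_of (x \<otimes>\<^bsub>M\<^esub> x', y) - frag_of (x, y) - frag_of (x', y) | x x' y.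
       x \<in> carrier M \<and> x' \<in> carrier M \<and> y \<in> carrier N} \<union>
    {frag_of (x, y \<otimes>\<^bsub>N\<^esub> y') - frag_of (x, y) - frag_of (x, y') | x y y'.
       x \<in> carrier M \<and> y \<in> carrier N \<and> y' \<in> carrier N} \<union>
    {frag_of (ract M x r, y) - frag_of (x, lact N r y) | x r y.
       x \<in> carrier M \<and> r \<in> R \<and> y \<in> carrier N}"

definition tensor_group ::
  "'r set \<Rightarrow> ('l, 'm, 'r) bimod \<Rightarrow> ('r, 'n, 's) bimod \<Rightarrow> (('m \<times> 'n) \<Rightarrow>\<^sub>0 int) set monoid"
  where "tensor_group R M N =
    (let F = free_Abelian_group (carrier M \<times> carrier N)
     in F Mod generate F (tensor_rels R M N))"

text \<open>The element \<open>x\<^sub>1 \<otimes> y\<^sub>1 + \<dots> + x\<^sub>n \<otimes> y\<^sub>n\<close> of \<open>M \<otimes>\<^sub>R N\<close> given by a list of pairs;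
  every element has this form, because \<open>- (x \<otimes> y) = (- x) \<otimes> y\<close>.\<close>

definition tensor_sum ::
  "'r set \<Rightarrow> ('l, 'm, 'r) bimod \<Rightarrow> ('r, 'n, 's) bimod \<Rightarrow> ('m \<times> 'n) list \<Rightarrow> (('m \<times> 'n) \<Rightarrow>\<^sub>0 int) set"
  where "tensor_sum R M N xs =
    (let F = free_Abelian_group (carrier M \<times> carrier N)
     in generate F (tensor_rels R M N) #>\<^bsub>F\<^esub> (\<Sum>p\<leftarrow>xs. frag_of p))"

definition represents ::
  "'r set \<Rightarrow> ('l, 'm, 'r) bimod \<Rightarrow> ('r, 'n, 's) bimod \<Rightarrow> ('m \<times> 'n) list \<Rightarrow>
    (('m \<times> 'n) \<Rightarrow>\<^sub>0 int) set \<Rightarrow> bool"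
  where "represents R M N xs t \<longleftrightarrow>
    set xs \<subseteq> carrier M \<times> carrier N \<and> tensor_sum R M N xs = t"

text \<open>The map \<open>M \<otimes>\<^sub>R N \<rightarrow> G\<close>, \<open>x \<otimes> y \<mapsto> \<phi> x y\<close>. For biadditive \<open>R\<close>-balanced \<open>\<phi>\<close> into an abelian
  group, which is the only case used, the value does not depend on the chosen representation.\<close>

definition tensor_lift ::
  "'r set \<Rightarrow> ('l, 'm, 'r) bimod \<Rightarrow> ('r, 'n, 's) bimod \<Rightarrow> ('g, 'z) monoid_scheme \<Rightarrow>
    ('m \<Rightarrow> 'n \<Rightarrow> 'g) \<Rightarrow> (('m \<times> 'n) \<Rightarrow>\<^sub>0 int) set \<Rightarrow> 'g"
  where "tensor_lift R M N G \<phi> t =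
    list_sum G [\<phi> x y. (x, y) \<leftarrow> (SOME xs. represents R M N xs t)]"

definition tensor ::
  "'r set \<Rightarrow> ('l, 'm, 'r) bimod \<Rightarrow> ('r, 'n, 's) bimod \<Rightarrow> ('l, (('m \<times> 'n) \<Rightarrow>\<^sub>0 int) set, 's) bimod"
  where "tensor R M N = (let G = tensor_group R M N in mk_bimod G
    (\<lambda>a. tensor_lift R M N G (\<lambda>x y. tensor_sum R M N [(lact M a x, y)]))
    (\<lambda>t b. tensor_lift R M N G (\<lambda>x y. tensor_sum R M N [(x, ract N y b)]) t))"

text \<open>Threefold tensor products \<open>M \<otimes>\<^sub>R N \<otimes>\<^sub>R' P\<close>, as the quotient of the free abelian group on
  triples by the relations balancing the first two factors over \<open>R\<close> and the last two over \<open>R'\<close>;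
  only equality of the elements \<open>\<Sum> x\<^sub>i \<otimes> y\<^sub>i \<otimes> z\<^sub>i\<close> is needed.\<close>

definition tensor3_rels ::
  "'r set \<Rightarrow> 's set \<Rightarrow> ('l, 'm, 'r) bimod \<Rightarrow> ('r, 'n, 's) bimod \<Rightarrow> ('s, 'p, 'q) bimod \<Rightarrow>
    (('m \<times> 'n \<times> 'p) \<Rightarrow>\<^sub>0 int) set"
  where "tensor3_rels R R' M N P =
    {frag_of (x \<otimes>\<^bsub>M\<^esub> x', y, z) - frag_of (x, y, z) - frag_of (x', y, z) | x x' y z.
       x \<in> carrier M \<and> x' \<in> carrier M \<and> y \<in> carrier N \<and> z \<in> carrier P} \<union>
    {frag_of (x, y \<otimes>\<^bsub>N\<^esub> y', z) - frag_of (x, y, z) - frag_of (x, y', z) | x y y' z.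
       x \<in> carrier M \<and> y \<in> carrier N \<and> y' \<in> carrier N \<and> z \<in> carrier P} \<union>
    {frag_of (x, y, z \<otimes>\<^bsub>P\<^esub> z') - frag_of (x, y, z) - frag_of (x, y, z') | x y z z'.
       x \<in> carrier M \<and> y \<in> carrier N \<and> z \<in> carrier P \<and> z' \<in> carrier P} \<union>
    {frag_of (ract M x r, y, z) - frag_of (x, lact N r y, z) | x r y z.
       x \<in> carrier M \<and> r \<in> R \<and> y \<in> carrier N \<and> z \<in> carrier P} \<union>
    {frag_of (x, ract N y s, z) - frag_of (x, y, lact P s z) | x y s z.
       x \<in> carrier M \<and> y \<in> carrier N \<and> s \<in> R' \<and> z \<in> carrier P}"

definition tensor3_sum ::
  "'r set \<Rightarrow> 's set \<Rightarrow> ('l, 'm, 'r) bimod \<Rightarrow> ('r, 'n, 's) bimod \<Rightarrow> ('s, 'p, 'q) bimod \<Rightarrow>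
    ('m \<times> 'n \<times> 'p) list \<Rightarrow> (('m \<times> 'n \<times> 'p) \<Rightarrow>\<^sub>0 int) set"
  where "tensor3_sum R R' M N P xs =
    (let F = free_Abelian_group (carrier M \<times> carrier N \<times> carrier P)
     in generate F (tensor3_rels R R' M N P) #>\<^bsub>F\<^esub> (\<Sum>p\<leftarrow>xs. frag_of p))"


section \<open>Corings and bialgebroids\<close>

text \<open>Sweedler notation: \<open>\<delta> a\<close> is a list of pairs \<open>(a\<^sub>1, a\<^sub>2)\<close> representing \<open>\<Delta> a\<close>. Every formula
  in Sweedler notation below is required for all choices \<open>\<delta>\<close> of representatives.\<close>

definition sweedler ::
  "'r set \<Rightarrow> ('r, 'c, 'r) bimod \<Rightarrow> ('c \<Rightarrow> (('c \<times> 'c) \<Rightarrow>\<^sub>0 int) set) \<Rightarrow>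
    ('c \<Rightarrow> ('c \<times> 'c) list) \<Rightarrow> bool"
  where "sweedler R C \<Delta> \<delta> \<longleftrightarrow> (\<forall>a\<in>carrier C. represents R C C (\<delta> a) (\<Delta> a))"

locale coring = bimodule R R C
  for R :: "('r, 'p) ring_scheme" and C :: "('r, 'c, 'r) bimod" +
  fixes \<Delta> :: "'c \<Rightarrow> (('c \<times> 'c) \<Rightarrow>\<^sub>0 int) set" and \<epsilon> :: "'c \<Rightarrow> 'r"
  assumes comult_hom:
      "\<Delta> \<in> bimod_hom (carrier R) (carrier R) C (tensor (carrier R) C C)"
    and counit_hom:
      "\<epsilon> \<in> bimod_hom (carrier R) (carrier R) C (reg_bimod R)"
    and coassoc: "\<lbrakk> sweedler (carrier R) C \<Delta> \<delta>; a \<in> carrier C \<rbrakk> \<Longrightarrow>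
      tensor3_sum (carrier R) (carrier R) C C C [(x, y, z). (u, z) \<leftarrow> \<delta> a, (x, y) \<leftarrow> \<delta> u] =
      tensor3_sum (carrier R) (carrier R) C C C [(x, y, z). (x, v) \<leftarrow> \<delta> a, (y, z) \<leftarrow> \<delta> v]"
    and counit_left: "\<lbrakk> sweedler (carrier R) C \<Delta> \<delta>; a \<in> carrier C \<rbrakk> \<Longrightarrow>
      list_sum C [lact C (\<epsilon> x) y. (x, y) \<leftarrow> \<delta> a] = a"
    and counit_right: "\<lbrakk> sweedler (carrier R) C \<Delta> \<delta>; a \<in> carrier C \<rbrakk> \<Longrightarrow>
      list_sum C [ract C x (\<epsilon> y). (x, y) \<leftarrow> \<delta> a] = a"

definition left_bimod ::
  "('k, 'h, 'n) module_scheme \<Rightarrow> ('r \<Rightarrow> 'h) \<Rightarrow> ('r \<Rightarrow> 'h) \<Rightarrow> ('r, 'h, 'r) bimod"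
  where "left_bimod H s t =
    mk_bimod (add_monoid H) (\<lambda>r h. s r \<otimes>\<^bsub>H\<^esub> h) (\<lambda>h r. t r \<otimes>\<^bsub>H\<^esub> h)"

definition right_bimod ::
  "('k, 'h, 'n) module_scheme \<Rightarrow> ('r \<Rightarrow> 'h) \<Rightarrow> ('r \<Rightarrow> 'h) \<Rightarrow> ('r, 'h, 'r) bimod"
  where "right_bimod H s t =
    mk_bimod (add_monoid H) (\<lambda>r h. h \<otimes>\<^bsub>H\<^esub> t r) (\<lambda>h r. h \<otimes>\<^bsub>H\<^esub> s r)"

locale left_bialgebroid =
  H: assoc_algebra K H + R: assoc_algebra K R + coring R "left_bimod H s t" \<Delta> \<epsilon>
  for K :: "('k, 'm) ring_scheme" and H :: "('k, 'h, 'n) module_scheme"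
    and R :: "('k, 'r, 'p) module_scheme" and s t \<Delta> \<epsilon> +
  assumes source: "s \<in> alg_hom K R H"
    and target: "t \<in> alg_hom K R (opp H)"
    and source_target_commute: "\<lbrakk> r \<in> carrier R; r' \<in> carrier R \<rbrakk> \<Longrightarrow>
      s r \<otimes>\<^bsub>H\<^esub> t r' = t r' \<otimes>\<^bsub>H\<^esub> s r"
    and takeuchi: "\<lbrakk> sweedler (carrier R) (left_bimod H s t) \<Delta> \<delta>; a \<in> carrier H; r \<in> carrier R \<rbrakk> \<Longrightarrow>
      tensor_sum (carrier R) (left_bimod H s t) (left_bimod H s t)
        [(x \<otimes>\<^bsub>H\<^esub> t r, y). (x, y) \<leftarrow> \<delta> a] =
      tensor_sum (carrier R) (left_bimod H s t) (left_bimod H s t)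
        [(x, y \<otimes>\<^bsub>H\<^esub> s r). (x, y) \<leftarrow> \<delta> a]"
    and comult_mult: "\<lbrakk> sweedler (carrier R) (left_bimod H s t) \<Delta> \<delta>; a \<in> carrier H; b \<in> carrier H \<rbrakk> \<Longrightarrow>
      \<Delta> (a \<otimes>\<^bsub>H\<^esub> b) = tensor_sum (carrier R) (left_bimod H s t) (left_bimod H s t)
        [(x \<otimes>\<^bsub>H\<^esub> x', y \<otimes>\<^bsub>H\<^esub> y'). (x, y) \<leftarrow> \<delta> a, (x', y') \<leftarrow> \<delta> b]"
    and comult_one: "\<Delta> \<one>\<^bsub>H\<^esub> =
      tensor_sum (carrier R) (left_bimod H s t) (left_bimod H s t) [(\<one>\<^bsub>H\<^esub>, \<one>\<^bsub>H\<^esub>)]"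
    and counit_source: "\<lbrakk> a \<in> carrier H; b \<in> carrier H \<rbrakk> \<Longrightarrow>
      \<epsilon> (a \<otimes>\<^bsub>H\<^esub> b) = \<epsilon> (a \<otimes>\<^bsub>H\<^esub> s (\<epsilon> b))"
    and counit_target: "\<lbrakk> a \<in> carrier H; b \<in> carrier H \<rbrakk> \<Longrightarrow>
      \<epsilon> (a \<otimes>\<^bsub>H\<^esub> b) = \<epsilon> (a \<otimes>\<^bsub>H\<^esub> t (\<epsilon> b))"
    and counit_one: "\<epsilon> \<one>\<^bsub>H\<^esub> = \<one>\<^bsub>R\<^esub>"

locale right_bialgebroid =
  H: assoc_algebra K H + R: assoc_algebra K R + coring R "right_bimod H s t" \<Delta> \<epsilon>
  for K :: "('k, 'm) ring_scheme" and H :: "('k, 'h, 'n) module_scheme"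
    and R :: "('k, 'r, 'p) module_scheme" and s t \<Delta> \<epsilon> +
  assumes source: "s \<in> alg_hom K R H"
    and target: "t \<in> alg_hom K R (opp H)"
    and source_target_commute: "\<lbrakk> r \<in> carrier R; r' \<in> carrier R \<rbrakk> \<Longrightarrow>
      s r \<otimes>\<^bsub>H\<^esub> t r' = t r' \<otimes>\<^bsub>H\<^esub> s r"
    and takeuchi: "\<lbrakk> sweedler (carrier R) (right_bimod H s t) \<Delta> \<delta>; a \<in> carrier H; r \<in> carrier R \<rbrakk> \<Longrightarrow>
      tensor_sum (carrier R) (right_bimod H s t) (right_bimod H s t)
        [(s r \<otimes>\<^bsub>H\<^esub> x, y). (x, y) \<leftarrow> \<delta> a] =
      tensor_sum (carrier R) (right_bimod H s t) (right_bimod H s t)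
        [(x, t r \<otimes>\<^bsub>H\<^esub> y). (x, y) \<leftarrow> \<delta> a]"
    and comult_mult: "\<lbrakk> sweedler (carrier R) (right_bimod H s t) \<Delta> \<delta>; a \<in> carrier H; b \<in> carrier H \<rbrakk> \<Longrightarrow>
      \<Delta> (a \<otimes>\<^bsub>H\<^esub> b) = tensor_sum (carrier R) (right_bimod H s t) (right_bimod H s t)
        [(x \<otimes>\<^bsub>H\<^esub> x', y \<otimes>\<^bsub>H\<^esub> y'). (x, y) \<leftarrow> \<delta> a, (x', y') \<leftarrow> \<delta> b]"
    and comult_one: "\<Delta> \<one>\<^bsub>H\<^esub> =
      tensor_sum (carrier R) (right_bimod H s t) (right_bimod H s t) [(\<one>\<^bsub>H\<^esub>, \<one>\<^bsub>H\<^esub>)]"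
    and counit_source: "\<lbrakk> a \<in> carrier H; b \<in> carrier H \<rbrakk> \<Longrightarrow>
      \<epsilon> (a \<otimes>\<^bsub>H\<^esub> b) = \<epsilon> (s (\<epsilon> a) \<otimes>\<^bsub>H\<^esub> b)"
    and counit_target: "\<lbrakk> a \<in> carrier H; b \<in> carrier H \<rbrakk> \<Longrightarrow>
      \<epsilon> (a \<otimes>\<^bsub>H\<^esub> b) = \<epsilon> (t (\<epsilon> a) \<otimes>\<^bsub>H\<^esub> b)"
    and counit_one: "\<epsilon> \<one>\<^bsub>H\<^esub> = \<one>\<^bsub>R\<^esub>"


section \<open>Hopf algebroids\<close>

text \<open>In the mixed threefold tensor products the middle factor carries the left action of the one
  and the right action of the other bimodule structure on \<open>H\<close>.\<close>

locale hopf_algebroid =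
  L: left_bialgebroid K H R sL tL \<Delta>L \<epsilon>L + Rt: right_bialgebroid K H "opp R" sR tR \<Delta>R \<epsilon>R
  for K :: "('k, 'm) ring_scheme" and H :: "('k, 'h, 'n) module_scheme"
    and R :: "('k, 'r, 'p) module_scheme" and sL tL \<Delta>L \<epsilon>L sR tR \<Delta>R \<epsilon>R +
  fixes \<tau> :: "'h \<Rightarrow> 'h"
  assumes image_sR: "sR ` carrier R = tL ` carrier R"
    and image_tR: "tR ` carrier R = sL ` carrier R"
    and mixed_coassoc_RL:
      "\<lbrakk> sweedler (carrier R) (left_bimod H sL tL) \<Delta>L \<delta>L;
         sweedler (carrier R) (right_bimod H sR tR) \<Delta>R \<delta>R; a \<in> carrier H \<rbrakk> \<Longrightarrow>
        (let MR = right_bimod H sR tR; ML = left_bimod H sL tL; N = MR\<lparr>ract := ract ML\<rparr> in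
          tensor3_sum (carrier R) (carrier R) MR N ML [(x, y, z). (x, v) \<leftarrow> \<delta>R a, (y, z) \<leftarrow> \<delta>L v] =
          tensor3_sum (carrier R) (carrier R) MR N ML [(x, y, z). (u, z) \<leftarrow> \<delta>L a, (x, y) \<leftarrow> \<delta>R u])"
    and mixed_coassoc_LR:
      "\<lbrakk> sweedler (carrier R) (left_bimod H sL tL) \<Delta>L \<delta>L;
         sweedler (carrier R) (right_bimod H sR tR) \<Delta>R \<delta>R; a \<in> carrier H \<rbrakk> \<Longrightarrow>
        (let MR = right_bimod H sR tR; ML = left_bimod H sL tL; N = ML\<lparr>ract := ract MR\<rparr> in
          tensor3_sum (carrier R) (carrier R) ML N MR [(x, y, z). (x, v) \<leftarrow> \<delta>L a, (y, z) \<leftarrow> \<delta>R v] =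
          tensor3_sum (carrier R) (carrier R) ML N MR [(x, y, z). (u, z) \<leftarrow> \<delta>R a, (x, y) \<leftarrow> \<delta>L u])"
    and antipode_anti_hom: "\<tau> \<in> alg_hom K H (opp H)"
    and antipode_bij: "bij_betw \<tau> (carrier H) (carrier H)"
    and antipode_tR: "\<lbrakk> a \<in> carrier H; r \<in> carrier R \<rbrakk> \<Longrightarrow>
      \<tau> (a \<otimes>\<^bsub>H\<^esub> tR r) = sR r \<otimes>\<^bsub>H\<^esub> \<tau> a"
    and antipode_tL: "\<lbrakk> a \<in> carrier H; r \<in> carrier R \<rbrakk> \<Longrightarrow>
      \<tau> (tL r \<otimes>\<^bsub>H\<^esub> a) = \<tau> a \<otimes>\<^bsub>H\<^esub> sL r"
    and antipode_right: "\<lbrakk> sweedler (carrier R) (right_bimod H sR tR) \<Delta>R \<delta>; a \<in> carrier H \<rbrakk> \<Longrightarrow>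
      list_sum (add_monoid H) [x \<otimes>\<^bsub>H\<^esub> \<tau> y. (x, y) \<leftarrow> \<delta> a] = sL (\<epsilon>L a)"
    and antipode_left: "\<lbrakk> sweedler (carrier R) (left_bimod H sL tL) \<Delta>L \<delta>; a \<in> carrier H \<rbrakk> \<Longrightarrow>
      list_sum (add_monoid H) [\<tau> x \<otimes>\<^bsub>H\<^esub> y. (x, y) \<leftarrow> \<delta> a] = sR (\<epsilon>R a)"


section \<open>Depth two and irreducible extensions\<close>

definition centralizer :: "('a, 'n) ring_scheme \<Rightarrow> 'a set \<Rightarrow> 'a set"
  where "centralizer A B = {a \<in> carrier A. \<forall>b\<in>B. b \<otimes>\<^bsub>A\<^esub> a = a \<otimes>\<^bsub>A\<^esub> b}"

definition centralizer_alg ::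
  "('k, 'a, 'n) module_scheme \<Rightarrow> 'a set \<Rightarrow> ('k, 'a, 'n) module_scheme"
  where "centralizer_alg A B = A\<lparr>carrier := centralizer A B\<rparr>"

definition tensor_square ::
  "('a, 'n) ring_scheme \<Rightarrow> 'a set \<Rightarrow> ('a, (('a \<times> 'a) \<Rightarrow>\<^sub>0 int) set, 'a) bimod"
  where "tensor_square A B = tensor B (reg_bimod A) (reg_bimod A)"

text \<open>Elements are extensional functions, so that equality is equality on \<open>A\<close>.
  \<open>K\<close>-linearity is automatic since \<open>k \<odot> 1 \<in> B\<close>.\<close>

definition End_alg :: "('k, 'a, 'n) module_scheme \<Rightarrow> 'a set \<Rightarrow> ('k, 'a \<Rightarrow> 'a) module"
  where "End_alg A B = \<lparr>
    carrier = bimod_hom B B (reg_bimod A) (reg_bimod A) \<inter> extensional (carrier A),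
    monoid.mult = (\<lambda>f g. compose (carrier A) f g),
    one = (\<lambda>x\<in>carrier A. x),
    ring.zero = (\<lambda>x\<in>carrier A. \<zero>\<^bsub>A\<^esub>),
    add = (\<lambda>f g. \<lambda>x\<in>carrier A. f x \<oplus>\<^bsub>A\<^esub> g x),
    smult = (\<lambda>k f. \<lambda>x\<in>carrier A. k \<odot>\<^bsub>A\<^esub> f x)\<rparr>"

definition T_set :: "('a, 'n) ring_scheme \<Rightarrow> 'a set \<Rightarrow> (('a \<times> 'a) \<Rightarrow>\<^sub>0 int) set set"
  where "T_set A B = {t \<in> carrier (tensor_square A B).
    \<forall>b\<in>B. lact (tensor_square A B) b t = ract (tensor_square A B) t b}"

definition depth_two :: "('a, 'n) ring_scheme \<Rightarrow> 'a set \<Rightarrow> bool"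
  where "depth_two A B \<longleftrightarrow> (\<exists>N>0.
    iso_to_direct_summand B (carrier A) (tensor_square A B) (bimod_power (reg_bimod A) N) \<and>
    iso_to_direct_summand (carrier A) B (tensor_square A B) (bimod_power (reg_bimod A) N))"

definition irreducible_extension ::
  "('k, 'm) ring_scheme \<Rightarrow> ('k, 'a, 'n) module_scheme \<Rightarrow> 'a set \<Rightarrow> bool"
  where "irreducible_extension K A B \<longleftrightarrow>
    assoc_algebra K A \<and> unital_subalgebra K A B \<and> depth_two A B \<and> centralizer A B \<subseteq> B"


section \<open>The left bialgebroid structure on the endomorphism algebra\<close>

definition lambda_map :: "('a, 'n) ring_scheme \<Rightarrow> 'a \<Rightarrow> 'a \<Rightarrow> 'a"
  where "lambda_map A r = (\<lambda>x\<in>carrier A. r \<otimes>\<^bsub>A\<^esub> x)"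

definition rho_map :: "('a, 'n) ring_scheme \<Rightarrow> 'a \<Rightarrow> 'a \<Rightarrow> 'a"
  where "rho_map A r = (\<lambda>x\<in>carrier A. x \<otimes>\<^bsub>A\<^esub> r)"

definition left_D2_quasibasis ::
  "('k, 'a, 'n) module_scheme \<Rightarrow> 'a set \<Rightarrow> (('a \<Rightarrow> 'a) \<times> (('a \<times> 'a) \<Rightarrow>\<^sub>0 int) set) list \<Rightarrow> bool"
  where "left_D2_quasibasis A B q \<longleftrightarrow>
    set q \<subseteq> carrier (End_alg A B) \<times> T_set A B \<and>
    (\<forall>a\<in>carrier A. \<forall>a'\<in>carrier A.
      tensor_sum B (reg_bimod A) (reg_bimod A) [(a, a')] =
      list_sum (tensor_square A B) [ract (tensor_square A B) t (\<beta> a \<otimes>\<^bsub>A\<^esub> a'). (\<beta>, t) \<leftarrow> q])"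

text \<open>\<open>\<Delta>(\<alpha>) = \<Sum>\<^sub>i \<alpha>(- t\<^sub>i\<^sup>1) t\<^sub>i\<^sup>2 \<otimes>\<^sub>R \<beta>\<^sub>i\<close>, which does not depend on the left D2 quasibasis.\<close>

definition End_comult ::
  "('k, 'a, 'n) module_scheme \<Rightarrow> 'a set \<Rightarrow> ('a \<Rightarrow> 'a) \<Rightarrow> ((('a \<Rightarrow> 'a) \<times> ('a \<Rightarrow> 'a)) \<Rightarrow>\<^sub>0 int) set"
  where "End_comult A B \<alpha> =
    (let SS = left_bimod (End_alg A B) (lambda_map A) (rho_map A) in
      tensor_sum (centralizer A B) SS SS
        [(\<lambda>x\<in>carrier A. tensor_lift B (reg_bimod A) (reg_bimod A) (add_monoid A)
             (\<lambda>y z. \<alpha> (x \<otimes>\<^bsub>A\<^esub> y) \<otimes>\<^bsub>A\<^esub> z) t, \<beta>).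
         (\<beta>, t) \<leftarrow> (SOME q. left_D2_quasibasis A B q)])"

definition End_counit :: "('a, 'n) ring_scheme \<Rightarrow> ('a \<Rightarrow> 'a) \<Rightarrow> 'a"
  where "End_counit A \<alpha> = \<alpha> \<one>\<^bsub>A\<^esub>"

text \<open>The condition \<open>\<alpha>(t\<^sup>1) t\<^sup>2 = t\<^sup>1 \<tau>(\<alpha>)(t\<^sup>2)\<close> determining \<open>\<tau>\<close>.\<close>

definition antipode_condition ::
  "('k, 'a, 'n) module_scheme \<Rightarrow> 'a set \<Rightarrow> (('a \<Rightarrow> 'a) \<Rightarrow> ('a \<Rightarrow> 'a)) \<Rightarrow> bool"
  where "antipode_condition A B \<tau> \<longleftrightarrow>
    (\<forall>\<alpha>\<in>carrier (End_alg A B). \<forall>t\<in>T_set A B. \<forall>xs.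
      represents B (reg_bimod A) (reg_bimod A) xs t \<longrightarrow>
      list_sum (add_monoid A) [\<alpha> x \<otimes>\<^bsub>A\<^esub> y. (x, y) \<leftarrow> xs] =
      list_sum (add_monoid A) [x \<otimes>\<^bsub>A\<^esub> \<tau> \<alpha> y. (x, y) \<leftarrow> xs])"

end

theory Submission
  imports Defs
begin

text \<open>Since \<open>R = A\<^sup>B\<close> lies in \<open>B\<close>, the maps \<open>\<lambda>\<^sub>r\<close> and \<open>\<rho>\<^sub>r\<close> are central in \<open>S\<close>. So the right bialgebroid
  structure can be taken to be the left one read with source and target exchanged:
  \<open>s\<^sub>R = \<rho>\<close>, \<open>t\<^sub>R = \<lambda>\<close>, \<open>\<Delta>\<^sub>R = \<Delta>\<close>, \<open>\<epsilon>\<^sub>R = \<epsilon>\<close>, and mixed coassociativity becomes coassociativity.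
  An identity in \<open>S \<otimes>\<^sub>R S\<close> or \<open>S \<otimes>\<^sub>R S \<otimes>\<^sub>R S\<close> is checked on the multilinear maps
  \<open>x \<otimes> y \<mapsto> \<Sum> \<alpha>(x) \<beta>(y)\<close>, where \<open>\<Delta>(\<alpha>)\<close> becomes \<open>\<alpha>(x y)\<close>.
  The pairings \<open>\<alpha>(t\<^sup>1) t\<^sup>2\<close> and \<open>t\<^sup>1 \<alpha>(t\<^sup>2)\<close> of \<open>S\<close> with \<open>T\<close> take values in \<open>R\<close> and are nondegenerate
  in \<open>\<alpha>\<close> by the left and right quasibases, so \<open>\<tau>\<close> exists, is unique and bijective, and the antipode
  axioms can be tested against \<open>T\<close>.\<close>

text \<open>The formula for \<open>\<tau>\<close> is forced: for a right quasibasis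
  \<open>(\<gamma>\<^sub>j, u\<^sub>j)\<close> each \<open>\<alpha>\<close> is \<open>\<Sum>
  \<gamma>\<^sub>j(-) u\<^sub>j\<^sup>1 \<alpha>(u\<^sub>j\<^sup>2)\<close>, so
  \<open>\<tau>(\<alpha>) = \<Sum> \<gamma>\<^sub>j(-) \<alpha>(u\<^sub>j\<^sup>1)
  u\<^sub>j\<^sup>2\<close>. Bilinear maps separate tensors because the left quasibasis expands a
  second factor in the \<open>\<beta>\<^sub>i\<close> with coefficients in \<open>R\<close>; these
  move to the first factor, and the resulting first factors can be read off from the bilinear map
  and the \<open>t\<^sub>i\<close>. Anti-multiplicativity of \<open>\<tau>\<close> comes from an
  action on \<open>T\<close>: \<open>f \<otimes> g\<close> with \<open>f\<close>, \<open>g\<close>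
  in \<open>S\<close> preserves \<open>T\<close>, so the defining condition may be applied to
  \<open>\<beta>(t\<^sup>1) \<otimes> t\<^sup>2\<close> and to
  \<open>t\<^sup>1 \<otimes> \<beta>(t\<^sup>2)\<close>. The formal obstacle is that the axioms
  quantify over all Sweedler representatives and that \<open>S\<close> carries several bimodule
  records. Hence \<open>repr\<close> describes representatives of \<open>\<Delta>(\<alpha>)\<close>
  by values alone, and \<open>End_bimod\<close> captures what the left, right and mixed records
  share.\<close>

section \<open>Sums over lists\<close>

lemma list_sum_Nil [simp]: "list_sum G [] = \<one>\<^bsub>G\<^esub>"
  and list_sum_Cons [simp]: "list_sum G (x # xs) = x \<otimes>\<^bsub>G\<^esub> list_sum G xs"
  by (simp_all add: list_sum_def)

lemma list_sum_cong:
  "(\<And>x. x \<in> set xs \<Longrightarrow> f x = g x) \<Longrightarrow> list_sum G (map f xs) = list_sum G (map g xs)"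
  by (metis map_eq_conv)

context monoid
begin

lemma list_sum_closed [intro, simp]: "set xs \<subseteq> carrier G \<Longrightarrow> list_sum G xs \<in> carrier G"
  by (induction xs) auto

lemma list_sum_map_closed:
  "(\<And>x. x \<in> set xs \<Longrightarrow> f x \<in> carrier G) \<Longrightarrow> list_sum G (map f xs) \<in> carrier G"
  by (rule list_sum_closed) auto

lemma list_sum_append:
  "set xs \<subseteq> carrier G \<Longrightarrow> set ys \<subseteq> carrier G \<Longrightarrow>
    list_sum G (xs @ ys) = list_sum G xs \<otimes> list_sum G ys"
  by (induction xs) (auto simp: m_assoc)

lemma list_sum_concat:
  "(\<And>xs. xs \<in> set xss \<Longrightarrow> set xs \<subseteq> carrier G) \<Longrightarrow>
    list_sum G (concat xss) = list_sum G (map (list_sum G) xss)"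
proof (induction xss)
  case (Cons xs xss)
  moreover from Cons have "set (concat xss) \<subseteq> carrier G" by auto
  ultimately show ?case by (simp add: list_sum_append)
qed simp

text \<open>Comprehensions with two generators, as in the Sweedler formulas, unfold to
  \<open>concat (map ...)\<close>; this turns them into iterated sums.\<close>

lemma list_sum_map_concat:
  assumes "\<And>y. y \<in> set (concat (map f xs)) \<Longrightarrow> g y \<in> carrier G"
  shows "list_sum G (map g (concat (map f xs))) = list_sum G (map (\<lambda>x. list_sum G (map g (f x))) xs)"
proof -
  have g: "g y \<in> carrier G" if "x \<in> set xs" "y \<in> set (f x)" for x y
    using that by (intro assms) auto
  have "list_sum G (map g (concat (map f xs))) = list_sum G (concat (map (map g \<circ> f) xs))"
    by (simp add: map_concat)
  also have "\<dots> = list_sum G (map (list_sum G) (map (map g \<circ> f) xs))"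
    using g by (intro list_sum_concat) auto
  finally show ?thesis by (simp add: comp_def)
qed

lemma list_sum_one: "list_sum G (map (\<lambda>_. \<one>) xs) = \<one>"
  by (induction xs) auto

lemma hom_list_sum:
  assumes "h \<in> hom G H" "h \<one> = \<one>\<^bsub>H\<^esub>" "set xs \<subseteq> carrier G"
  shows "h (list_sum G xs) = list_sum H (map h xs)"
  using assms(3) by (induction xs) (use assms(1,2) in \<open>auto simp: hom_def\<close>)

end

lemma (in comm_monoid) list_sum_mult:
  assumes "\<And>x. x \<in> set xs \<Longrightarrow> f x \<in> carrier G" "\<And>x. x \<in> set xs \<Longrightarrow> g x \<in> carrier G"
  shows "list_sum G (map (\<lambda>x. f x \<otimes> g x) xs) = list_sum G (map f xs) \<otimes> list_sum G (map g xs)"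
  using assms
proof (induction xs)
  case (Cons x xs)
  then have "list_sum G (map f xs) \<in> carrier G" "list_sum G (map g xs) \<in> carrier G"
    by (auto intro!: list_sum_map_closed)
  with Cons show ?case by (simp add: m_ac)
qed simp

lemma (in comm_monoid) list_sum_swap:
  assumes "\<And>x y. x \<in> set xs \<Longrightarrow> y \<in> set ys \<Longrightarrow> f x y \<in> carrier G"
  shows "list_sum G (map (\<lambda>x. list_sum G (map (f x) ys)) xs) =
    list_sum G (map (\<lambda>y. list_sum G (map (\<lambda>x. f x y) xs)) ys)"
  using assms
proof (induction xs)
  case (Cons x xs)
  have "list_sum G (map (\<lambda>y. f x y \<otimes> list_sum G (map (\<lambda>x. f x y) xs)) ys) =
      list_sum G (map (f x) ys) \<otimes> list_sum G (map (\<lambda>y. list_sum G (map (\<lambda>x. f x y) xs)) ys)"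
    by (rule list_sum_mult) (use Cons.prems in \<open>auto intro!: list_sum_map_closed\<close>)
  with Cons show ?case by simp
qed (simp add: list_sum_one)

lemma (in group) hom_list_sum_group:
  assumes "group H" "h \<in> hom G H" "set xs \<subseteq> carrier G"
  shows "h (list_sum G xs) = list_sum H (map h xs)"
  using assms(3) by (rule hom_list_sum[OF assms(2) hom_one[OF assms(2) is_group assms(1)]])

lemma (in comm_group) hom_imp_list_sum:
  assumes "group H" "h \<in> carrier G \<rightarrow> carrier H"
    and "\<And>x y. x \<in> carrier G \<Longrightarrow> y \<in> carrier G \<Longrightarrow> h (x \<otimes> y) = h x \<otimes>\<^bsub>H\<^esub> h y"
    and "\<And>x. x \<in> set xs \<Longrightarrow> f x \<in> carrier G"
  shows "h (list_sum G (map f xs)) = list_sum H (map (\<lambda>x. h (f x)) xs)"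
proof -
  have "h \<in> hom G H" using assms by (auto simp: hom_def)
  then have "h (list_sum G (map f xs)) = list_sum H (map h (map f xs))"
    using assms by (intro hom_list_sum_group) auto
  then show ?thesis by (simp add: comp_def)
qed


section \<open>Abelian groups given by generators and relations\<close>

lemma keys_sum_list_frag_of: "Poly_Mapping.keys (\<Sum>p\<leftarrow>xs. frag_of p) \<subseteq> set xs"
proof (induction xs)
  case (Cons x xs)
  have "Poly_Mapping.keys (frag_of x + (\<Sum>p\<leftarrow>xs. frag_of p)) \<subseteq>
      Poly_Mapping.keys (frag_of x) \<union> Poly_Mapping.keys (\<Sum>p\<leftarrow>xs. frag_of p)"
    by (rule keys_add)
  with Cons show ?case by auto
qed simp

lemma free_Abelian_group_diff_closed:
  "a \<in> carrier (free_Abelian_group S) \<Longrightarrow> b \<in> carrier (free_Abelian_group S) \<Longrightarrow>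
    a - b \<in> carrier (free_Abelian_group S)"
  using keys_diff[of a b] by auto

text \<open>As simp rules these would replace the operations of a quotient group by set operations
  on cosets and hide the group structure.\<close>

declare one_FactGroup [simp del] mult_FactGroup [simp del]

text \<open>Twofold and threefold tensor products are both quotients of a free abelian group by
  relations; what they share is proved once here.\<close>

locale presented_group =
  fixes S :: "'x set" and rels :: "('x \<Rightarrow>\<^sub>0 int) set"
  assumes rels_closed: "rels \<subseteq> carrier (free_Abelian_group S)"
begin

abbreviation F where "F \<equiv> free_Abelian_group S"
abbreviation I where "I \<equiv> generate F rels"
abbreviation Q where "Q \<equiv> F Mod I"
abbreviation cls where "cls xs \<equiv> I #>\<^bsub>F\<^esub> (\<Sum>p\<leftarrow>xs. frag_of p)"

sublocale F: comm_group F by (rule abelian_free_Abelian_group)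

lemma subgroup_I: "subgroup I F"
  using rels_closed by (rule F.generate_is_subgroup)

sublocale I: normal I F
  using subgroup_I by (rule F.subgroup_imp_normal)

sublocale Q: comm_group Q
proof (rule group.group_comm_groupI)
  show "group Q" by (rule I.factorgroup_is_group)
  fix x y assume "x \<in> carrier Q" "y \<in> carrier Q"
  then obtain a b where "a \<in> carrier F" "x = I #>\<^bsub>F\<^esub> a" "b \<in> carrier F" "y = I #>\<^bsub>F\<^esub> b"
    by (auto simp: FactGroup_def RCOSETS_def)
  then show "x \<otimes>\<^bsub>Q\<^esub> y = y \<otimes>\<^bsub>Q\<^esub> x"
    by (simp add: FactGroup_def I.rcos_sum del: carrier_free_Abelian_group_iff mult_free_Abelian_group)
       (metis F.m_comm)
qed

lemma coset_closed: "a \<in> carrier F \<Longrightarrow> I #>\<^bsub>F\<^esub> a \<in> carrier Q"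
  by (auto simp: FactGroup_def RCOSETS_def)

lemma coset_mult: "a \<in> carrier F \<Longrightarrow> b \<in> carrier F \<Longrightarrow>
    I #>\<^bsub>F\<^esub> (a + b) = (I #>\<^bsub>F\<^esub> a) \<otimes>\<^bsub>Q\<^esub> (I #>\<^bsub>F\<^esub> b)"
  using I.rcos_sum[of a b] by (simp add: FactGroup_def)

lemma sum_list_closed: "set xs \<subseteq> S \<Longrightarrow> (\<Sum>p\<leftarrow>xs. frag_of p) \<in> carrier F"
  using keys_sum_list_frag_of by fastforce

lemma cls_closed: "set xs \<subseteq> S \<Longrightarrow> cls xs \<in> carrier Q"
  by (intro coset_closed sum_list_closed)

lemma cls_Nil: "cls [] = \<one>\<^bsub>Q\<^esub>"
  using subgroup_I by (simp add: FactGroup_def F.coset_mult_one[simplified] F.generate_incl[OF rels_closed])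

lemma cls_append: "set xs \<subseteq> S \<Longrightarrow> set ys \<subseteq> S \<Longrightarrow> cls (xs @ ys) = cls xs \<otimes>\<^bsub>Q\<^esub> cls ys"
  using coset_mult[OF sum_list_closed sum_list_closed] by simp

lemma cls_eq_list_sum: "set xs \<subseteq> S \<Longrightarrow> cls xs = list_sum Q (map (\<lambda>p. cls [p]) xs)"
proof (induction xs)
  case Nil
  then show ?case using cls_Nil by simp
next
  case (Cons x xs)
  then have "cls ([x] @ xs) = cls [x] \<otimes>\<^bsub>Q\<^esub> cls xs"
    by (intro cls_append) auto
  with Cons show ?case by simp
qed

lemma coset_rel: "r \<in> rels \<Longrightarrow> I #>\<^bsub>F\<^esub> r = \<one>\<^bsub>Q\<^esub>"
  by (simp add: FactGroup_def F.coset_join2 rels_closed subgroup_I generate.incl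
      subsetD[OF rels_closed] del: carrier_free_Abelian_group_iff)

lemma cls_eq_if_rel:
  assumes "frag_of a - frag_of b \<in> rels" "a \<in> S" "b \<in> S"
  shows "cls [a] = cls [b]"
proof -
  have "I #>\<^bsub>F\<^esub> (frag_of b + (frag_of a - frag_of b)) = (I #>\<^bsub>F\<^esub> frag_of b) \<otimes>\<^bsub>Q\<^esub> \<one>\<^bsub>Q\<^esub>"
    using assms coset_mult[of "frag_of b" "frag_of a - frag_of b"] coset_rel rels_closed by auto
  moreover have "I #>\<^bsub>F\<^esub> frag_of b \<in> carrier Q" using assms by (intro coset_closed) simp
  ultimately show ?thesis by simp
qed

lemma cls_mult_if_rel:
  assumes "frag_of a - frag_of b - frag_of c \<in> rels" "a \<in> S" "b \<in> S" "c \<in> S"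
  shows "cls [a] = cls [b] \<otimes>\<^bsub>Q\<^esub> cls [c]"
proof -
  have "I #>\<^bsub>F\<^esub> (frag_of b + frag_of c + (frag_of a - frag_of b - frag_of c)) =
      (I #>\<^bsub>F\<^esub> (frag_of b + frag_of c)) \<otimes>\<^bsub>Q\<^esub> \<one>\<^bsub>Q\<^esub>"
    using assms coset_mult[of "frag_of b + frag_of c" "frag_of a - frag_of b - frag_of c"]
      coset_rel rels_closed F.m_closed[of "frag_of b" "frag_of c"] by auto
  moreover have "I #>\<^bsub>F\<^esub> (frag_of b + frag_of c) = (I #>\<^bsub>F\<^esub> frag_of b) \<otimes>\<^bsub>Q\<^esub> (I #>\<^bsub>F\<^esub> frag_of c)"
    using assms by (intro coset_mult) auto
  moreover have "I #>\<^bsub>F\<^esub> frag_of b \<in> carrier Q" "I #>\<^bsub>F\<^esub> frag_of c \<in> carrier Q"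
    using assms by (auto intro!: coset_closed)
  ultimately show ?thesis by simp
qed

text \<open>Extend \<phi> to a homomorphism on \<open>F\<close>. It kills the relations, hence
  \<open>I\<close>, and sends a formal sum to the list sum, so congruent formal sums have equal
  images. Hypothesis \<open>rel\<close> ranges over every extension of \<phi>, since the one used is
  only chosen inside the proof.\<close>

lemma cls_universal:
  assumes G: "comm_group G" and \<phi>: "\<phi> ` S \<subseteq> carrier G"
    and rel: "\<And>h r. h \<in> hom F G \<Longrightarrow> (\<And>s. s \<in> S \<Longrightarrow> h (frag_of s) = \<phi> s) \<Longrightarrow> r \<in> rels \<Longrightarrow> h r = \<one>\<^bsub>G\<^esub>"
    and xs: "set xs \<subseteq> S" and ys: "set ys \<subseteq> S" and eq: "cls xs = cls ys"
  shows "list_sum G (map \<phi> xs) = list_sum G (map \<phi> ys)"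
proof -
  interpret G: comm_group G by fact
  obtain h where h: "h \<in> hom F G" "\<And>s. s \<in> S \<Longrightarrow> h (frag_of s) = \<phi> s"
    using G.free_Abelian_group_universal[OF \<phi>] by blast
  interpret h: group_hom F G h by (intro group_hom.intro group_hom_axioms.intro h) auto
  have "rels \<subseteq> kernel F G h"
    using rel[OF h] rels_closed by (auto simp: kernel_def simp del: carrier_free_Abelian_group_iff)
  then have "I \<subseteq> kernel F G h"
    using F.generate_subgroup_incl h.subgroup_kernel by blast
  then have I1: "h i = \<one>\<^bsub>G\<^esub>" "i \<in> carrier F" if "i \<in> I" for i using that by (auto simp: kernel_def)
  have sum: "h (\<Sum>p\<leftarrow>zs. frag_of p) = list_sum G (map \<phi> zs)" if "set zs \<subseteq> S" for zs
    using that
  proof (induction zs)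
    case Nil
    then show ?case using h.hom_one by simp
  next
    case (Cons z zs)
    then have "h (frag_of z \<otimes>\<^bsub>F\<^esub> (\<Sum>p\<leftarrow>zs. frag_of p)) = h (frag_of z) \<otimes>\<^bsub>G\<^esub> h (\<Sum>p\<leftarrow>zs. frag_of p)"
      by (intro h.hom_mult sum_list_closed) auto
    with Cons h(2) show ?case by simp
  qed
  have "(\<Sum>p\<leftarrow>xs. frag_of p) \<in> cls xs"
    using F.rcos_self[OF sum_list_closed[OF xs] subgroup_I] .
  then obtain i where i: "i \<in> I" "(\<Sum>p\<leftarrow>xs. frag_of p) = i + (\<Sum>p\<leftarrow>ys. frag_of p)"
    unfolding eq by (auto simp: r_coset_def)
  have "h (i \<otimes>\<^bsub>F\<^esub> (\<Sum>p\<leftarrow>ys. frag_of p)) = h i \<otimes>\<^bsub>G\<^esub> h (\<Sum>p\<leftarrow>ys. frag_of p)"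
    using I1(2)[OF i(1)] sum_list_closed[OF ys] by (rule h.hom_mult)
  then have "h (\<Sum>p\<leftarrow>xs. frag_of p) = h (\<Sum>p\<leftarrow>ys. frag_of p)"
    using i I1 h.hom_closed[OF sum_list_closed[OF ys]] by (simp del: h.hom_closed)
  then show ?thesis by (simp add: sum xs ys)
qed

text \<open>Lists give only sums of generators, whereas \<open>F\<close> also contains differences.
  The hypothesis \<open>neg\<close> turns the inverse of a generator back into a generator; for
  tensors this is \<open>(- x) \<otimes> y\<close>.\<close>

lemma coset_is_cls:
  assumes neg: "\<And>s. s \<in> S \<Longrightarrow> \<exists>s'\<in>S. cls [s] \<otimes>\<^bsub>Q\<^esub> cls [s'] = \<one>\<^bsub>Q\<^esub>" and q: "q \<in> carrier Q"
  shows "\<exists>xs. set xs \<subseteq> S \<and> q = cls xs"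
proof -
  have neg_list: "\<exists>ys. set ys \<subseteq> S \<and> cls ys = inv\<^bsub>Q\<^esub> (cls xs)" if "set xs \<subseteq> S" for xs
    using that
  proof (induction xs)
    case Nil
    then show ?case using cls_Nil Q.inv_one by (intro exI[of _ "[]"]) (metis empty_set empty_subsetI)
  next
    case (Cons x xs)
    then obtain ys x' where ys: "set ys \<subseteq> S" "cls ys = inv\<^bsub>Q\<^esub> (cls xs)"
      and x': "x' \<in> S" "cls [x] \<otimes>\<^bsub>Q\<^esub> cls [x'] = \<one>\<^bsub>Q\<^esub>"
      using neg by fastforce
    have c: "cls [x] \<in> carrier Q" "cls [x'] \<in> carrier Q" "cls xs \<in> carrier Q"
      using cls_closed[of "[x]"] cls_closed[of "[x']"] cls_closed[of xs] Cons x' by simp_all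
    have "cls ([x'] @ ys) = cls [x'] \<otimes>\<^bsub>Q\<^esub> cls ys" using x' ys by (intro cls_append) auto
    also have "cls [x'] = inv\<^bsub>Q\<^esub> (cls [x])" using x' c Q.inv_equality Q.m_comm by metis
    also have "inv\<^bsub>Q\<^esub> (cls [x]) \<otimes>\<^bsub>Q\<^esub> cls ys = inv\<^bsub>Q\<^esub> (cls [x] \<otimes>\<^bsub>Q\<^esub> cls xs)"
      using c ys Q.inv_mult by auto
    also have "cls [x] \<otimes>\<^bsub>Q\<^esub> cls xs = cls ([x] @ xs)"
      using Cons by (intro cls_append[symmetric]) auto
    finally show ?case using x' ys by (intro exI[of _ "x' # ys"]) auto
  qed
  obtain a where a: "a \<in> carrier F" "q = I #>\<^bsub>F\<^esub> a"
    using q by (auto simp: FactGroup_def RCOSETS_def)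
  have "\<exists>xs. set xs \<subseteq> S \<and> I #>\<^bsub>F\<^esub> a = cls xs" using a(1)[simplified]
  proof (induction rule: free_Abelian_group_induct[consumes 1, case_names zero diff gen])
    case zero
    then show ?case by (intro exI[of _ "[]"]) simp
  next
    case (diff x y)
    then obtain xs ys where xs: "set xs \<subseteq> S" "I #>\<^bsub>F\<^esub> x = cls xs" and ys: "set ys \<subseteq> S" "I #>\<^bsub>F\<^esub> y = cls ys"
      by blast
    obtain ys' where ys': "set ys' \<subseteq> S" "cls ys' = inv\<^bsub>Q\<^esub> (cls ys)" using neg_list ys by blast
    have xy: "x \<in> carrier F" "y \<in> carrier F" "x - y \<in> carrier F"
      using diff keys_diff[of x y] by auto
    have "(I #>\<^bsub>F\<^esub> (x - y)) \<otimes>\<^bsub>Q\<^esub> (I #>\<^bsub>F\<^esub> y) = I #>\<^bsub>F\<^esub> x"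
      using coset_mult[OF xy(3) xy(2)] by simp
    then have "I #>\<^bsub>F\<^esub> (x - y) = (I #>\<^bsub>F\<^esub> x) \<otimes>\<^bsub>Q\<^esub> inv\<^bsub>Q\<^esub> (I #>\<^bsub>F\<^esub> y)"
      using coset_closed xy by (metis Q.inv_solve_right)
    also have "\<dots> = cls (xs @ ys')" using cls_append xs ys ys' by simp
    finally show ?case using xs ys' by (intro exI[of _ "xs @ ys'"]) auto
  next
    case (gen s)
    then show ?case by (intro exI[of _ "[s]"]) simp
  qed
  then show ?thesis using a by simp
qed

end

section \<open>Tensor products\<close>

definition balanced ::
  "'r set \<Rightarrow> ('l, 'm, 'r) bimod \<Rightarrow> ('r, 'n, 's) bimod \<Rightarrow> ('g, 'z) monoid_scheme \<Rightarrow>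
    ('m \<Rightarrow> 'n \<Rightarrow> 'g) \<Rightarrow> bool"
  where "balanced Rs M N G \<phi> \<longleftrightarrow>
    (\<forall>x\<in>carrier M. \<forall>y\<in>carrier N. \<phi> x y \<in> carrier G) \<and>
    (\<forall>x\<in>carrier M. \<forall>x'\<in>carrier M. \<forall>y\<in>carrier N. \<phi> (x \<otimes>\<^bsub>M\<^esub> x') y = \<phi> x y \<otimes>\<^bsub>G\<^esub> \<phi> x' y) \<and>
    (\<forall>x\<in>carrier M. \<forall>y\<in>carrier N. \<forall>y'\<in>carrier N. \<phi> x (y \<otimes>\<^bsub>N\<^esub> y') = \<phi> x y \<otimes>\<^bsub>G\<^esub> \<phi> x y') \<and>
    (\<forall>x\<in>carrier M. \<forall>r\<in>Rs. \<forall>y\<in>carrier N. \<phi> (ract M x r) y = \<phi> x (lact N r y))"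

lemma balancedI:
  assumes "\<And>x y. x \<in> carrier M \<Longrightarrow> y \<in> carrier N \<Longrightarrow> \<phi> x y \<in> carrier G"
    and "\<And>x x' y. x \<in> carrier M \<Longrightarrow> x' \<in> carrier M \<Longrightarrow> y \<in> carrier N \<Longrightarrow>
      \<phi> (x \<otimes>\<^bsub>M\<^esub> x') y = \<phi> x y \<otimes>\<^bsub>G\<^esub> \<phi> x' y"
    and "\<And>x y y'. x \<in> carrier M \<Longrightarrow> y \<in> carrier N \<Longrightarrow> y' \<in> carrier N \<Longrightarrow>
      \<phi> x (y \<otimes>\<^bsub>N\<^esub> y') = \<phi> x y \<otimes>\<^bsub>G\<^esub> \<phi> x y'"
    and "\<And>x r y. x \<in> carrier M \<Longrightarrow> r \<in> Rs \<Longrightarrow> y \<in> carrier N \<Longrightarrow>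
      \<phi> (ract M x r) y = \<phi> x (lact N r y)"
  shows "balanced Rs M N G \<phi>"
  using assms by (simp add: balanced_def)

lemma balancedD:
  assumes "balanced Rs M N G \<phi>"
  shows "x \<in> carrier M \<Longrightarrow> y \<in> carrier N \<Longrightarrow> \<phi> x y \<in> carrier G"
    and "x \<in> carrier M \<Longrightarrow> x' \<in> carrier M \<Longrightarrow> y \<in> carrier N \<Longrightarrow>
      \<phi> (x \<otimes>\<^bsub>M\<^esub> x') y = \<phi> x y \<otimes>\<^bsub>G\<^esub> \<phi> x' y"
    and "x \<in> carrier M \<Longrightarrow> y \<in> carrier N \<Longrightarrow> y' \<in> carrier N \<Longrightarrow>
      \<phi> x (y \<otimes>\<^bsub>N\<^esub> y') = \<phi> x y \<otimes>\<^bsub>G\<^esub> \<phi> x y'"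
    and "x \<in> carrier M \<Longrightarrow> r \<in> Rs \<Longrightarrow> y \<in> carrier N \<Longrightarrow>
      \<phi> (ract M x r) y = \<phi> x (lact N r y)"
  using assms by (simp_all add: balanced_def)

text \<open>The relations mention only the two groups and the inner actions, so these are what is
  asked for. The outer actions and the bimodule axioms enter in
  \<open>tensor_bimodule\<close>.\<close>

locale tensor_pair = M: comm_group M + N: comm_group N
  for Rs :: "'r set" and M :: "('l, 'm, 'r) bimod" and N :: "('r, 'n, 's) bimod" +
  assumes ract_closed': "\<lbrakk> x \<in> carrier M; r \<in> Rs \<rbrakk> \<Longrightarrow> ract M x r \<in> carrier M"
    and lact_closed': "\<lbrakk> r \<in> Rs; y \<in> carrier N \<rbrakk> \<Longrightarrow> lact N r y \<in> carrier N"
begin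

sublocale T: presented_group "carrier M \<times> carrier N" "tensor_rels Rs M N"
  by unfold_locales
    (auto simp: tensor_rels_def ract_closed' lact_closed'
      simp del: carrier_free_Abelian_group_iff intro!: free_Abelian_group_diff_closed)

abbreviation TG where "TG \<equiv> tensor_group Rs M N"
abbreviation ts where "ts \<equiv> tensor_sum Rs M N"

lemma TG_eq: "TG = T.Q"
  by (simp add: tensor_group_def Let_def)

lemma ts_eq: "ts xs = T.cls xs"
  by (simp add: tensor_sum_def Let_def)

lemma comm_group_TG: "comm_group TG"
  unfolding TG_eq by (rule T.Q.comm_group_axioms)

sublocale TG: comm_group TG by (rule comm_group_TG)

lemma ts_closed: "set xs \<subseteq> carrier M \<times> carrier N \<Longrightarrow> ts xs \<in> carrier TG"
  unfolding TG_eq ts_eq by (rule T.cls_closed)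

lemma ts_append: "set xs \<subseteq> carrier M \<times> carrier N \<Longrightarrow> set ys \<subseteq> carrier M \<times> carrier N \<Longrightarrow>
    ts (xs @ ys) = ts xs \<otimes>\<^bsub>TG\<^esub> ts ys"
  unfolding TG_eq ts_eq by (rule T.cls_append)

lemma ts_list_sum: "set xs \<subseteq> carrier M \<times> carrier N \<Longrightarrow>
    ts xs = list_sum TG (map (\<lambda>(x, y). ts [(x, y)]) xs)"
  unfolding TG_eq ts_eq by (subst T.cls_eq_list_sum) (auto intro!: list_sum_cong)

lemma ts_map:
  assumes "\<And>p. p \<in> set xs \<Longrightarrow> f p \<in> carrier M \<times> carrier N"
  shows "ts (map f xs) = list_sum TG (map (\<lambda>p. ts [f p]) xs)"
proof -
  have "set (map f xs) \<subseteq> carrier M \<times> carrier N"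
    using assms by (simp only: set_map image_subset_iff) blast
  then show ?thesis by (subst ts_list_sum) (simp_all add: case_prod_beta comp_def)
qed

lemma pure_balanced: "balanced Rs M N TG (\<lambda>x y. ts [(x, y)])"
proof (rule balancedI)
  fix x x' y assume "x \<in> carrier M" "x' \<in> carrier M" "y \<in> carrier N"
  then show "ts [(x \<otimes>\<^bsub>M\<^esub> x', y)] = ts [(x, y)] \<otimes>\<^bsub>TG\<^esub> ts [(x', y)]"
    unfolding TG_eq ts_eq by (intro T.cls_mult_if_rel) (auto simp: tensor_rels_def)
next
  fix x y y' assume "x \<in> carrier M" "y \<in> carrier N" "y' \<in> carrier N"
  then show "ts [(x, y \<otimes>\<^bsub>N\<^esub> y')] = ts [(x, y)] \<otimes>\<^bsub>TG\<^esub> ts [(x, y')]"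
    unfolding TG_eq ts_eq by (intro T.cls_mult_if_rel) (auto simp: tensor_rels_def)
next
  fix x r y assume "x \<in> carrier M" "r \<in> Rs" "y \<in> carrier N"
  then show "ts [(ract M x r, y)] = ts [(x, lact N r y)]"
    unfolding ts_eq
    by (intro T.cls_eq_if_rel) (auto simp: tensor_rels_def ract_closed' lact_closed')
qed (auto intro!: ts_closed)

lemma ex_rep:
  assumes "t \<in> carrier TG" obtains xs where "set xs \<subseteq> carrier M \<times> carrier N" "t = ts xs"
proof -
  have "\<exists>s'\<in>carrier M \<times> carrier N. T.cls [s] \<otimes>\<^bsub>T.Q\<^esub> T.cls [s'] = \<one>\<^bsub>T.Q\<^esub>"
    if s: "s \<in> carrier M \<times> carrier N" for s
  proof -
    obtain x y where s: "s = (x, y)" "x \<in> carrier M" "y \<in> carrier N" using s by auto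
    \<comment> \<open>Additivity in the first argument at zero plus zero makes this class
      idempotent, and an idempotent of a group is trivial.\<close>
    have one: "ts [(\<one>\<^bsub>M\<^esub>, y)] = \<one>\<^bsub>TG\<^esub>"
      using balancedD(2)[OF pure_balanced, of "\<one>\<^bsub>M\<^esub>" "\<one>\<^bsub>M\<^esub>" y] s ts_closed[of "[(\<one>\<^bsub>M\<^esub>, y)]"] by simp
    have "ts [(x \<otimes>\<^bsub>M\<^esub> inv\<^bsub>M\<^esub> x, y)] = ts [(x, y)] \<otimes>\<^bsub>TG\<^esub> ts [(inv\<^bsub>M\<^esub> x, y)]"
      using s by (intro balancedD(2)[OF pure_balanced]) auto
    then show ?thesis using s one unfolding TG_eq ts_eq
      by (intro bexI[of _ "(inv\<^bsub>M\<^esub> x, y)"]) auto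
  qed
  from T.coset_is_cls[OF this] assms that show thesis unfolding TG_eq ts_eq by blast
qed

lemma ts_universal:
  assumes G: "comm_group G" and \<phi>: "balanced Rs M N G \<phi>"
    and xs: "set xs \<subseteq> carrier M \<times> carrier N" and ys: "set ys \<subseteq> carrier M \<times> carrier N"
    and eq: "ts xs = ts ys"
  shows "list_sum G (map (\<lambda>(x, y). \<phi> x y) xs) = list_sum G (map (\<lambda>(x, y). \<phi> x y) ys)"
proof (rule T.cls_universal[OF G])
  interpret G: comm_group G by fact
  note \<phi> = balancedD[OF \<phi>]
  show "(\<lambda>(x, y). \<phi> x y) ` (carrier M \<times> carrier N) \<subseteq> carrier G"
    using \<phi>(1) by auto
  fix h r
  assume h: "h \<in> hom T.F G" and h_of: "\<And>s. s \<in> carrier M \<times> carrier N \<Longrightarrow> h (frag_of s) = (\<lambda>(x, y). \<phi> x y) s"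
    and r: "r \<in> tensor_rels Rs M N"
  interpret h: group_hom T.F G h by (intro group_hom.intro group_hom_axioms.intro h) auto
  have diff: "h (a - b) = h a \<otimes>\<^bsub>G\<^esub> inv\<^bsub>G\<^esub> (h b)" if "a \<in> carrier T.F" "b \<in> carrier T.F" for a b
    using that h.hom_mult[of a "inv\<^bsub>T.F\<^esub> b"] h.hom_inv[of b] by simp
  have two: "h (frag_of a - frag_of b) = h (frag_of a) \<otimes>\<^bsub>G\<^esub> inv\<^bsub>G\<^esub> (h (frag_of b))"
    if "a \<in> carrier M \<times> carrier N" "b \<in> carrier M \<times> carrier N" for a b
    using that by (intro diff) auto
  have three: "h (frag_of a - frag_of b - frag_of c) =
      h (frag_of a) \<otimes>\<^bsub>G\<^esub> inv\<^bsub>G\<^esub> (h (frag_of b)) \<otimes>\<^bsub>G\<^esub> inv\<^bsub>G\<^esub> (h (frag_of c))"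
    if "a \<in> carrier M \<times> carrier N" "b \<in> carrier M \<times> carrier N" "c \<in> carrier M \<times> carrier N" for a b c
    using that by (subst diff) (auto intro!: free_Abelian_group_diff_closed simp: two simp del: carrier_free_Abelian_group_iff)
  from r show "h r = \<one>\<^bsub>G\<^esub>" unfolding tensor_rels_def
    by (elim UnE CollectE exE conjE)
      (simp_all add: two three h_of \<phi> ract_closed' lact_closed' G.m_assoc G.m_comm[of "\<phi> _ _" "_ \<otimes>\<^bsub>G\<^esub> _"])
qed (use xs ys eq in \<open>simp_all add: ts_eq\<close>)

text \<open>\<open>tensor_lift\<close> evaluates at a representative picked by \<open>SOME\<close>;
  \<open>ts_universal\<close> makes the choice immaterial.\<close>

lemma lift_ts:
  assumes "comm_group G" "balanced Rs M N G \<phi>" "set xs \<subseteq> carrier M \<times> carrier N"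
  shows "tensor_lift Rs M N G \<phi> (ts xs) = list_sum G (map (\<lambda>(x, y). \<phi> x y) xs)"
proof -
  define ys where "ys = (SOME ys. represents Rs M N ys (ts xs))"
  have "represents Rs M N ys (ts xs)"
    unfolding ys_def by (rule someI[of _ xs]) (simp add: represents_def assms)
  then show ?thesis
    unfolding tensor_lift_def ys_def[symmetric]
    by (intro ts_universal[OF assms(1,2)]) (use assms in \<open>auto simp: represents_def\<close>)
qed

lemma lift_pure:
  assumes "comm_group G" "balanced Rs M N G \<phi>" "x \<in> carrier M" "y \<in> carrier N"
  shows "tensor_lift Rs M N G \<phi> (ts [(x, y)]) = \<phi> x y"
proof -
  interpret G: comm_group G by fact
  show ?thesis using assms balancedD(1)[OF assms(2)] by (subst lift_ts) auto
qed

lemma lift_hom: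
  assumes "comm_group G" "balanced Rs M N G \<phi>"
  shows "tensor_lift Rs M N G \<phi> \<in> hom TG G"
proof (rule homI)
  interpret G: comm_group G by fact
  have c: "set (map (\<lambda>(x, y). \<phi> x y) xs) \<subseteq> carrier G" if "set xs \<subseteq> carrier M \<times> carrier N" for xs
    using that balancedD(1)[OF assms(2)] by auto
  fix t assume "t \<in> carrier TG"
  then obtain xs where xs: "set xs \<subseteq> carrier M \<times> carrier N" "t = ts xs" by (rule ex_rep)
  then show "tensor_lift Rs M N G \<phi> t \<in> carrier G" using c by (simp add: lift_ts[OF assms])
  fix t' assume "t' \<in> carrier TG"
  then obtain ys where ys: "set ys \<subseteq> carrier M \<times> carrier N" "t' = ts ys" by (rule ex_rep)
  have "t \<otimes>\<^bsub>TG\<^esub> t' = ts (xs @ ys)" using xs ys by (simp add: ts_append)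
  then show "tensor_lift Rs M N G \<phi> (t \<otimes>\<^bsub>TG\<^esub> t') =
      tensor_lift Rs M N G \<phi> t \<otimes>\<^bsub>G\<^esub> tensor_lift Rs M N G \<phi> t'"
    using xs ys c[OF xs(1)] c[OF ys(1)] by (simp add: lift_ts[OF assms] G.list_sum_append del: set_map)
qed

lemma lift_cong:
  assumes "comm_group G" "balanced Rs M N G \<phi>" "t \<in> carrier TG"
    "\<And>x y. x \<in> carrier M \<Longrightarrow> y \<in> carrier N \<Longrightarrow> \<phi> x y = \<psi> x y"
  shows "tensor_lift Rs M N G \<phi> t = tensor_lift Rs M N G \<psi> t"
proof -
  obtain xs where xs: "set xs \<subseteq> carrier M \<times> carrier N" "t = ts xs" using assms(3) by (rule ex_rep)
  \<comment> \<open>All arguments in the definition of \<open>balanced\<close> lie in the carriers,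
    which the inner actions preserve; so \<psi> inherits the property from \<phi>.\<close>
  have "balanced Rs M N G \<psi>"
    using assms(2,4) by (simp add: balanced_def ract_closed' lact_closed')
  with xs show ?thesis
    using assms by (auto simp: lift_ts intro!: list_sum_cong)
qed

end

lemma tensor_carrier [simp]: "carrier (tensor Rs M N) = carrier (tensor_group Rs M N)"
  and tensor_mult [simp]: "monoid.mult (tensor Rs M N) = monoid.mult (tensor_group Rs M N)"
  and tensor_one [simp]: "\<one>\<^bsub>tensor Rs M N\<^esub> = \<one>\<^bsub>tensor_group Rs M N\<^esub>"
  and list_sum_tensor [simp]: "list_sum (tensor Rs M N) = list_sum (tensor_group Rs M N)"
  by (simp_all add: tensor_def mk_bimod_def Let_def list_sum_def fun_eq_iff)

section \<open>The outer actions on a tensor product of bimodules\<close>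

locale tensor_bimodule = MB: bimodule L R M + NB: bimodule R S N
  for L :: "('l, 'p) ring_scheme" and R :: "('r, 'q) ring_scheme" and S :: "('s, 't) ring_scheme"
    and M :: "('l, 'm, 'r) bimod" and N :: "('r, 'n, 's) bimod"
begin

sublocale tensor_pair "carrier R" M N
  by unfold_locales (auto intro: MB.ract_closed NB.lact_closed)

lemma lact_balanced:
  assumes "a \<in> carrier L"
  shows "balanced (carrier R) M N TG (\<lambda>x y. ts [(lact M a x, y)])"
  using assms balancedD[OF pure_balanced]
  by (intro balancedI) (simp_all add: MB.lact_closed MB.lact_add MB.lact_ract[symmetric] MB.ract_closed)

lemma ract_balanced:
  assumes "b \<in> carrier S"
  shows "balanced (carrier R) M N TG (\<lambda>x y. ts [(x, ract N y b)])"
  using assms balancedD[OF pure_balanced]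
  by (intro balancedI) (simp_all add: NB.ract_closed NB.ract_add NB.lact_ract)

lemma lact_ts:
  assumes "a \<in> carrier L" "set xs \<subseteq> carrier M \<times> carrier N"
  shows "lact (tensor (carrier R) M N) a (ts xs) = ts (map (\<lambda>(x, y). (lact M a x, y)) xs)"
proof -
  have "ts (map (\<lambda>(x, y). (lact M a x, y)) xs) = list_sum TG (map (\<lambda>(x, y). ts [(lact M a x, y)]) xs)"
    using assms by (subst ts_list_sum) (auto simp: MB.lact_closed intro!: list_sum_cong)
  then show ?thesis
    using lift_ts[OF comm_group_TG lact_balanced] assms
    by (simp add: tensor_def mk_bimod_def Let_def)
qed

lemma ract_ts:
  assumes "b \<in> carrier S" "set xs \<subseteq> carrier M \<times> carrier N"
  shows "ract (tensor (carrier R) M N) (ts xs) b = ts (map (\<lambda>(x, y). (x, ract N y b)) xs)"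
proof -
  have "ts (map (\<lambda>(x, y). (x, ract N y b)) xs) = list_sum TG (map (\<lambda>(x, y). ts [(x, ract N y b)]) xs)"
    using assms by (subst ts_list_sum) (auto simp: NB.ract_closed intro!: list_sum_cong)
  then show ?thesis
    using lift_ts[OF comm_group_TG ract_balanced] assms
    by (simp add: tensor_def mk_bimod_def Let_def)
qed

lemma lact_hom: "a \<in> carrier L \<Longrightarrow> lact (tensor (carrier R) M N) a \<in> hom TG TG"
  using lift_hom[OF comm_group_TG lact_balanced[of a]]
  by (simp add: tensor_def mk_bimod_def Let_def)

lemma ract_hom: "b \<in> carrier S \<Longrightarrow> (\<lambda>t. ract (tensor (carrier R) M N) t b) \<in> hom TG TG"
  using lift_hom[OF comm_group_TG ract_balanced[of b]]
  by (simp add: tensor_def mk_bimod_def Let_def)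

lemma tensor_add_lact:
  assumes "a \<in> carrier L" "a' \<in> carrier L" "t \<in> carrier TG"
  shows "lact (tensor (carrier R) M N) (a \<oplus>\<^bsub>L\<^esub> a') t =
    lact (tensor (carrier R) M N) a t \<otimes>\<^bsub>TG\<^esub> lact (tensor (carrier R) M N) a' t"
proof -
  obtain xs where xs: "set xs \<subseteq> carrier M \<times> carrier N" "t = ts xs" using assms(3) by (rule ex_rep)
  have "list_sum TG (map (\<lambda>p. ts [case p of (x, y) \<Rightarrow> (lact M (a \<oplus>\<^bsub>L\<^esub> a') x, y)]) xs) = list_sum TG (map (\<lambda>p. (\<lambda>p. ts [case p of (x, y) \<Rightarrow> (lact M a x, y)]) p \<otimes>\<^bsub>TG\<^esub> (\<lambda>p. ts [case p of (x, y) \<Rightarrow> (lact M a' x, y)]) p) xs)"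
    using assms xs(1) balancedD(2)[OF pure_balanced]
    by (intro list_sum_cong) (auto simp: MB.lact_closed MB.add_lact)
  also have "\<dots> = list_sum TG (map (\<lambda>p. ts [case p of (x, y) \<Rightarrow> (lact M a x, y)]) xs) \<otimes>\<^bsub>TG\<^esub> list_sum TG (map (\<lambda>p. ts [case p of (x, y) \<Rightarrow> (lact M a' x, y)]) xs)"
    using assms xs(1) by (intro TG.list_sum_mult ts_closed) (auto simp: MB.lact_closed)
  finally show ?thesis
    using assms xs by (simp add: lact_ts) (subst (1 2 3) ts_map; auto simp: MB.lact_closed)
qed

lemma tensor_add_ract:
  assumes "b \<in> carrier S" "b' \<in> carrier S" "t \<in> carrier TG"
  shows "ract (tensor (carrier R) M N) t (b \<oplus>\<^bsub>S\<^esub> b') =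
    ract (tensor (carrier R) M N) t b \<otimes>\<^bsub>TG\<^esub> ract (tensor (carrier R) M N) t b'"
proof -
  obtain xs where xs: "set xs \<subseteq> carrier M \<times> carrier N" "t = ts xs" using assms(3) by (rule ex_rep)
  have "list_sum TG (map (\<lambda>p. ts [case p of (x, y) \<Rightarrow> (x, ract N y (b \<oplus>\<^bsub>S\<^esub> b'))]) xs) = list_sum TG (map (\<lambda>p. (\<lambda>p. ts [case p of (x, y) \<Rightarrow> (x, ract N y b)]) p \<otimes>\<^bsub>TG\<^esub> (\<lambda>p. ts [case p of (x, y) \<Rightarrow> (x, ract N y b')]) p) xs)"
    using assms xs(1) balancedD(3)[OF pure_balanced]
    by (intro list_sum_cong) (auto simp: NB.ract_closed NB.add_ract)
  also have "\<dots> = list_sum TG (map (\<lambda>p. ts [case p of (x, y) \<Rightarrow> (x, ract N y b)]) xs) \<otimes>\<^bsub>TG\<^esub> list_sum TG (map (\<lambda>p. ts [case p of (x, y) \<Rightarrow> (x, ract N y b')]) xs)"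
    using assms xs(1) by (intro TG.list_sum_mult ts_closed) (auto simp: NB.ract_closed)
  finally show ?thesis
    using assms xs by (simp add: ract_ts) (subst (1 2 3) ts_map; auto simp: NB.ract_closed)
qed

end

text \<open>Fixing one outer argument leaves a balanced map of two arguments; in this form the
  results on two factors apply directly to trilinear maps.\<close>

definition balanced3 ::
  "'r set \<Rightarrow> 's set \<Rightarrow> ('l, 'm, 'r) bimod \<Rightarrow> ('r, 'n, 's) bimod \<Rightarrow> ('s, 'p, 'q) bimod \<Rightarrow>
    ('g, 'z) monoid_scheme \<Rightarrow> ('m \<Rightarrow> 'n \<Rightarrow> 'p \<Rightarrow> 'g) \<Rightarrow> bool"
  where "balanced3 Rs Rs' M N P G \<theta> \<longleftrightarrow>
    (\<forall>z\<in>carrier P. balanced Rs M N G (\<lambda>x y. \<theta> x y z)) \<and>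
    (\<forall>x\<in>carrier M. balanced Rs' N P G (\<lambda>y z. \<theta> x y z))"

lemma tensor3_relsI:
  "x \<in> carrier M \<Longrightarrow> x' \<in> carrier M \<Longrightarrow> y \<in> carrier N \<Longrightarrow> z \<in> carrier P \<Longrightarrow>
    frag_of (x \<otimes>\<^bsub>M\<^esub> x', y, z) - frag_of (x, y, z) - frag_of (x', y, z) \<in> tensor3_rels Rs Rs' M N P"
  "x \<in> carrier M \<Longrightarrow> y \<in> carrier N \<Longrightarrow> y' \<in> carrier N \<Longrightarrow> z \<in> carrier P \<Longrightarrow>
    frag_of (x, y \<otimes>\<^bsub>N\<^esub> y', z) - frag_of (x, y, z) - frag_of (x, y', z) \<in> tensor3_rels Rs Rs' M N P"
  "x \<in> carrier M \<Longrightarrow> y \<in> carrier N \<Longrightarrow> z \<in> carrier P \<Longrightarrow> z' \<in> carrier P \<Longrightarrow>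
    frag_of (x, y, z \<otimes>\<^bsub>P\<^esub> z') - frag_of (x, y, z) - frag_of (x, y, z') \<in> tensor3_rels Rs Rs' M N P"
  "x \<in> carrier M \<Longrightarrow> r \<in> Rs \<Longrightarrow> y \<in> carrier N \<Longrightarrow> z \<in> carrier P \<Longrightarrow>
    frag_of (ract M x r, y, z) - frag_of (x, lact N r y, z) \<in> tensor3_rels Rs Rs' M N P"
  "x \<in> carrier M \<Longrightarrow> y \<in> carrier N \<Longrightarrow> s \<in> Rs' \<Longrightarrow> z \<in> carrier P \<Longrightarrow>
    frag_of (x, ract N y s, z) - frag_of (x, y, lact P s z) \<in> tensor3_rels Rs Rs' M N P"
  unfolding tensor3_rels_def
  by (rule UnI1, rule UnI1, rule UnI1, rule UnI1, blast)
    (rule UnI1, rule UnI1, rule UnI1, rule UnI2, blast,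
     rule UnI1, rule UnI1, rule UnI2, blast, rule UnI1, rule UnI2, blast, rule UnI2, blast)

locale tensor_triple = M: comm_group M + N: comm_group N + P: comm_group P
  for Rs :: "'r set" and Rs' :: "'s set" and M :: "('l, 'm, 'r) bimod"
    and N :: "('r, 'n, 's) bimod" and P :: "('s, 'p, 'q) bimod" +
  assumes ract_M_closed: "\<lbrakk> x \<in> carrier M; r \<in> Rs \<rbrakk> \<Longrightarrow> ract M x r \<in> carrier M"
    and lact_N_closed: "\<lbrakk> r \<in> Rs; y \<in> carrier N \<rbrakk> \<Longrightarrow> lact N r y \<in> carrier N"
    and ract_N_closed: "\<lbrakk> y \<in> carrier N; s \<in> Rs' \<rbrakk> \<Longrightarrow> ract N y s \<in> carrier N"
    and lact_P_closed: "\<lbrakk> s \<in> Rs'; z \<in> carrier P \<rbrakk> \<Longrightarrow> lact P s z \<in> carrier P"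
begin

sublocale T: presented_group "carrier M \<times> carrier N \<times> carrier P" "tensor3_rels Rs Rs' M N P"
  by unfold_locales
    (auto simp: tensor3_rels_def ract_M_closed lact_N_closed ract_N_closed lact_P_closed
      simp del: carrier_free_Abelian_group_iff intro!: free_Abelian_group_diff_closed)

abbreviation ts3 where "ts3 \<equiv> tensor3_sum Rs Rs' M N P"

lemma ts3_eq: "ts3 xs = T.cls xs"
  by (simp add: tensor3_sum_def Let_def)

lemma ts3_list_sum: "set xs \<subseteq> carrier M \<times> carrier N \<times> carrier P \<Longrightarrow>
    ts3 xs = list_sum T.Q (map (\<lambda>(x, y, z). ts3 [(x, y, z)]) xs)"
  unfolding ts3_eq by (subst T.cls_eq_list_sum) (auto intro!: list_sum_cong)

lemma pure_balanced3: "balanced3 Rs Rs' M N P T.Q (\<lambda>x y z. ts3 [(x, y, z)])"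
  unfolding balanced3_def
proof (intro conjI ballI; rule balancedI)
  have closed: "ts3 [(x, y, z)] \<in> carrier T.Q" if "x \<in> carrier M" "y \<in> carrier N" "z \<in> carrier P" for x y z
    unfolding ts3_eq using that by (intro T.cls_closed) auto
  show "\<And>z x y. z \<in> carrier P \<Longrightarrow> x \<in> carrier M \<Longrightarrow> y \<in> carrier N \<Longrightarrow> ts3 [(x, y, z)] \<in> carrier T.Q"
    "\<And>z x y. z \<in> carrier M \<Longrightarrow> x \<in> carrier N \<Longrightarrow> y \<in> carrier P \<Longrightarrow> ts3 [(z, x, y)] \<in> carrier T.Q"
    by (simp_all add: closed)
next
  fix z x x' y assume "z \<in> carrier P" "x \<in> carrier M" "x' \<in> carrier M" "y \<in> carrier N"
  then show "ts3 [(x \<otimes>\<^bsub>M\<^esub> x', y, z)] = ts3 [(x, y, z)] \<otimes>\<^bsub>T.Q\<^esub> ts3 [(x', y, z)]"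
    unfolding ts3_eq by (intro T.cls_mult_if_rel) (auto intro: tensor3_relsI)
next
  fix z x y y' assume "z \<in> carrier P" "x \<in> carrier M" "y \<in> carrier N" "y' \<in> carrier N"
  then show "ts3 [(x, y \<otimes>\<^bsub>N\<^esub> y', z)] = ts3 [(x, y, z)] \<otimes>\<^bsub>T.Q\<^esub> ts3 [(x, y', z)]"
    unfolding ts3_eq by (intro T.cls_mult_if_rel) (auto intro: tensor3_relsI)
next
  fix z x r y assume "z \<in> carrier P" "x \<in> carrier M" "r \<in> Rs" "y \<in> carrier N"
  then show "ts3 [(ract M x r, y, z)] = ts3 [(x, lact N r y, z)]"
    unfolding ts3_eq
    by (intro T.cls_eq_if_rel) (auto intro: tensor3_relsI simp: ract_M_closed lact_N_closed)
next
  fix x y y' z assume "x \<in> carrier M" "y \<in> carrier N" "y' \<in> carrier N" "z \<in> carrier P"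
  then show "ts3 [(x, y \<otimes>\<^bsub>N\<^esub> y', z)] = ts3 [(x, y, z)] \<otimes>\<^bsub>T.Q\<^esub> ts3 [(x, y', z)]"
    unfolding ts3_eq by (intro T.cls_mult_if_rel) (auto intro: tensor3_relsI)
next
  fix x y z z' assume "x \<in> carrier M" "y \<in> carrier N" "z \<in> carrier P" "z' \<in> carrier P"
  then show "ts3 [(x, y, z \<otimes>\<^bsub>P\<^esub> z')] = ts3 [(x, y, z)] \<otimes>\<^bsub>T.Q\<^esub> ts3 [(x, y, z')]"
    unfolding ts3_eq by (intro T.cls_mult_if_rel) (auto intro: tensor3_relsI)
next
  fix x y s z assume "x \<in> carrier M" "y \<in> carrier N" "s \<in> Rs'" "z \<in> carrier P"
  then show "ts3 [(x, ract N y s, z)] = ts3 [(x, y, lact P s z)]"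
    unfolding ts3_eq
    by (intro T.cls_eq_if_rel) (auto intro: tensor3_relsI simp: ract_N_closed lact_P_closed)
qed

end

text \<open>The relations evaluate the actions only at elements of the carriers and of
  \<open>Rs\<close>. This identifies tensor products over the left and right structures of
  \<open>S\<close>, whose action functions may differ elsewhere.\<close>

lemma tensor_sum_cong:
  assumes "carrier M = carrier M'" "monoid.mult M = monoid.mult M'"
    "carrier N = carrier N'" "monoid.mult N = monoid.mult N'"
    "\<And>x r. x \<in> carrier M \<Longrightarrow> r \<in> Rs \<Longrightarrow> ract M x r = ract M' x r"
    "\<And>r y. r \<in> Rs \<Longrightarrow> y \<in> carrier N \<Longrightarrow> lact N r y = lact N' r y"
  shows "tensor_sum Rs M N = tensor_sum Rs M' N'"
proof -
  have "{frag_of (ract M x r, y) - frag_of (x, lact N r y) | x r y.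
       x \<in> carrier M \<and> r \<in> Rs \<and> y \<in> carrier N} =
    {frag_of (ract M' x r, y) - frag_of (x, lact N' r y) | x r y.
       x \<in> carrier M \<and> r \<in> Rs \<and> y \<in> carrier N}"
    using assms(5,6) by (intro Collect_cong) metis
  then have "tensor_rels Rs M N = tensor_rels Rs M' N'"
    using assms(1-4) by (simp add: tensor_rels_def)
  then show ?thesis using assms(1,3) by (simp add: tensor_sum_def fun_eq_iff)
qed

section \<open>Direct summands\<close>

text \<open>\<open>g\<close> is the projection onto \<open>P\<close> along \<open>Q\<close> followed
  by the inverse of \<open>f\<close>. It is linear because both \<open>P\<close> and
  \<open>Q\<close> are stable under the actions.\<close>

lemma iso_to_direct_summand_retract:
  assumes "iso_to_direct_summand L R M N"
    and M: "comm_group M" and N: "comm_group N"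
    and lact_M: "\<And>a x. a \<in> L \<Longrightarrow> x \<in> carrier M \<Longrightarrow> lact M a x \<in> carrier M"
    and ract_M: "\<And>x b. x \<in> carrier M \<Longrightarrow> b \<in> R \<Longrightarrow> ract M x b \<in> carrier M"
    and lact_N: "\<And>a x y. a \<in> L \<Longrightarrow> x \<in> carrier N \<Longrightarrow> y \<in> carrier N \<Longrightarrow>
      lact N a (x \<otimes>\<^bsub>N\<^esub> y) = lact N a x \<otimes>\<^bsub>N\<^esub> lact N a y"
    and ract_N: "\<And>x y b. x \<in> carrier N \<Longrightarrow> y \<in> carrier N \<Longrightarrow> b \<in> R \<Longrightarrow>
      ract N (x \<otimes>\<^bsub>N\<^esub> y) b = ract N x b \<otimes>\<^bsub>N\<^esub> ract N y b"
  obtains f g where "f \<in> bimod_hom L R M N" "g \<in> bimod_hom L R N M"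
    "\<And>x. x \<in> carrier M \<Longrightarrow> g (f x) = x"
proof -
  interpret M: comm_group M by fact
  interpret N: comm_group N by fact
  from assms(1) obtain P Q f where P: "sub_bimod L R P N" and Q: "sub_bimod L R Q N"
    and PQ: "P \<inter> Q = {\<one>\<^bsub>N\<^esub>}" "P <#>\<^bsub>N\<^esub> Q = carrier N"
    and f: "f \<in> bimod_hom L R M N" "bij_betw f (carrier M) P"
    unfolding iso_to_direct_summand_def by blast
  have P_sub: "subgroup P N" and Q_sub: "subgroup Q N" using P Q by (auto simp: sub_bimod_def)
  have PN: "p \<in> carrier N" if "p \<in> P" for p using that P_sub subgroup.mem_carrier by fast
  have QN: "q \<in> carrier N" if "q \<in> Q" for q using that Q_sub subgroup.mem_carrier by fast
  \<comment> \<open>Equal sums give \<open>- p' + p = q' - q\<close> in additive notation, an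
    element of \<open>P \<inter> Q\<close>, hence zero.\<close>
  have unique: "p = p'" if "p \<in> P" "p' \<in> P" "q \<in> Q" "q' \<in> Q" "p \<otimes>\<^bsub>N\<^esub> q = p' \<otimes>\<^bsub>N\<^esub> q'" for p p' q q'
  proof -
    have "inv\<^bsub>N\<^esub> p' \<otimes>\<^bsub>N\<^esub> p = q' \<otimes>\<^bsub>N\<^esub> inv\<^bsub>N\<^esub> q"
    proof -
      have "inv\<^bsub>N\<^esub> p' \<otimes>\<^bsub>N\<^esub> p = inv\<^bsub>N\<^esub> p' \<otimes>\<^bsub>N\<^esub> (p \<otimes>\<^bsub>N\<^esub> q) \<otimes>\<^bsub>N\<^esub> inv\<^bsub>N\<^esub> q"
        using that(1-4) PN QN by (simp add: N.m_assoc)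
      also have "\<dots> = q' \<otimes>\<^bsub>N\<^esub> inv\<^bsub>N\<^esub> q"
        using that PN QN by (simp add: N.m_assoc[symmetric])
      finally show ?thesis .
    qed
    moreover have "inv\<^bsub>N\<^esub> p' \<otimes>\<^bsub>N\<^esub> p \<in> P" "q' \<otimes>\<^bsub>N\<^esub> inv\<^bsub>N\<^esub> q \<in> Q"
      using that P_sub Q_sub by (simp_all add: subgroup.m_closed subgroup.m_inv_closed)
    ultimately have "inv\<^bsub>N\<^esub> p' \<otimes>\<^bsub>N\<^esub> p = \<one>\<^bsub>N\<^esub>" using PQ(1) by auto
    then show ?thesis using that PN by (metis N.inv_closed N.inv_equality N.inv_inv)
  qed
  define pr where "pr v = (THE p. p \<in> P \<and> (\<exists>q\<in>Q. v = p \<otimes>\<^bsub>N\<^esub> q))" for v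
  have pr_eq: "pr (p \<otimes>\<^bsub>N\<^esub> q) = p" if "p \<in> P" "q \<in> Q" for p q
    unfolding pr_def using that unique by (intro the_equality) blast+
  have decomp: "\<exists>p\<in>P. \<exists>q\<in>Q. v = p \<otimes>\<^bsub>N\<^esub> q" if "v \<in> carrier N" for v
    using that PQ(2) unfolding set_mult_def by blast
  define g where "g v = inv_into (carrier M) f (pr v)" for v
  have fM: "f x \<in> P" if "x \<in> carrier M" for x using f(2) that by (auto simp: bij_betw_def)
  have f_g: "f (g v) = pr v" "g v \<in> carrier M" if "v \<in> carrier N" for v
  proof -
    have "pr v \<in> f ` carrier M" using decomp[OF that] pr_eq f(2) by (auto simp: bij_betw_def)
    then show "f (g v) = pr v" "g v \<in> carrier M"
      unfolding g_def by (auto intro: f_inv_into_f inv_into_into)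
  qed
  have inj: "x = y" if "x \<in> carrier M" "y \<in> carrier M" "f x = f y" for x y
    using f(2) that by (auto simp: bij_betw_def inj_on_def)
  note f_hom = f(1)[unfolded bimod_hom_def hom_def, simplified]
  have g_f: "g (f x) = x" if "x \<in> carrier M" for x
    using that fM[OF that] pr_eq[of "f x" "\<one>\<^bsub>N\<^esub>"] subgroup.one_closed[OF Q_sub] PN
    by (intro inj f_g) (auto simp: f_g)
  have "g \<in> bimod_hom L R N M"
    unfolding bimod_hom_def
  proof (intro CollectI conjI homI ballI)
    fix v assume v: "v \<in> carrier N"
    then show "g v \<in> carrier M" by (rule f_g)
    obtain p q where pq: "p \<in> P" "q \<in> Q" "v = p \<otimes>\<^bsub>N\<^esub> q" using decomp v by blast
    show "g (v \<otimes>\<^bsub>N\<^esub> w) = g v \<otimes>\<^bsub>M\<^esub> g w" if w: "w \<in> carrier N" for w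
    proof -
      obtain p' q' where pq': "p' \<in> P" "q' \<in> Q" "w = p' \<otimes>\<^bsub>N\<^esub> q'" using decomp w by blast
      have "v \<otimes>\<^bsub>N\<^esub> w = (p \<otimes>\<^bsub>N\<^esub> p') \<otimes>\<^bsub>N\<^esub> (q \<otimes>\<^bsub>N\<^esub> q')"
        using pq pq' PN QN by (simp add: N.m_ac)
      then have "pr (v \<otimes>\<^bsub>N\<^esub> w) = pr v \<otimes>\<^bsub>N\<^esub> pr w"
        using pq pq' pr_eq P_sub Q_sub by (simp add: subgroup.m_closed)
      then show ?thesis using v w by (intro inj) (simp_all add: f_g f_hom)
    qed
    show "g (lact N a v) = lact M a (g v)" if a: "a \<in> L" for a
    proof -
      have c: "lact N a p \<in> P" "lact N a q \<in> Q" using a pq P Q by (auto simp: sub_bimod_def)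
      have eq: "lact N a v = lact N a p \<otimes>\<^bsub>N\<^esub> lact N a q"
        using a pq PN QN lact_N by simp
      have "lact N a v \<in> carrier N" unfolding eq using c PN QN by simp
      moreover have "pr (lact N a v) = lact N a (pr v)" unfolding eq using c pq pr_eq by simp
      ultimately show ?thesis using v a by (intro inj) (simp_all add: f_g f_hom lact_M)
    qed
    show "g (ract N v b) = ract M (g v) b" if b: "b \<in> R" for b
    proof -
      have c: "ract N p b \<in> P" "ract N q b \<in> Q" using b pq P Q by (auto simp: sub_bimod_def)
      have eq: "ract N v b = ract N p b \<otimes>\<^bsub>N\<^esub> ract N q b"
        using b pq PN QN ract_N by simp
      have "ract N v b \<in> carrier N" unfolding eq using c PN QN by simp
      moreover have "pr (ract N v b) = ract N (pr v) b" unfolding eq using c pq pr_eq by simp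
      ultimately show ?thesis using v b by (intro inj) (simp_all add: f_g f_hom ract_M)
    qed
  qed
  with f(1) g_f that show thesis by blast
qed

section \<open>The endomorphism algebra\<close>

lemma reg_bimod_simps [simp]:
  "carrier (reg_bimod A) = carrier A"
  "monoid.mult (reg_bimod A) = add A"
  "\<one>\<^bsub>reg_bimod A\<^esub> = \<zero>\<^bsub>A\<^esub>"
  "lact (reg_bimod A) = (\<lambda>a x. a \<otimes>\<^bsub>A\<^esub> x)"
  "ract (reg_bimod A) = (\<lambda>x a. x \<otimes>\<^bsub>A\<^esub> a)"
  by (simp_all add: reg_bimod_def mk_bimod_def)

lemma (in abelian_group) comm_group_if_add_eq:
  assumes "carrier M = carrier G" "monoid.mult M = add G" "\<one>\<^bsub>M\<^esub> = \<zero>\<^bsub>G\<^esub>"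
  shows "comm_group M"
proof (rule comm_groupI)
  fix x assume "x \<in> carrier M"
  then show "\<exists>y\<in>carrier M. y \<otimes>\<^bsub>M\<^esub> x = \<one>\<^bsub>M\<^esub>"
    using assms by (intro bexI[of _ "\<ominus> x"]) (auto simp: l_neg)
qed (use assms in \<open>auto simp: a_ac\<close>)

lemma (in ring) reg_bimodule:
  assumes X: "subring X R" and Y: "subring Y R"
  shows "bimodule (R\<lparr>carrier := X\<rparr>) (R\<lparr>carrier := Y\<rparr>) (reg_bimod R)"
proof -
  interpret X: ring "R\<lparr>carrier := X\<rparr>" using X by (rule subring_is_ring)
  interpret Y: ring "R\<lparr>carrier := Y\<rparr>" using Y by (rule subring_is_ring)
  interpret M: comm_group "reg_bimod R" by (rule comm_group_if_add_eq) simp_all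
  have XY: "X \<subseteq> carrier R" "Y \<subseteq> carrier R" using X Y by (auto dest: subringE(1))
  show ?thesis
    by unfold_locales (use XY in \<open>auto simp: r_distr l_distr m_assoc subset_iff\<close>)
qed

section \<open>A subalgebra and the evaluation of balanced maps on the tensor square\<close>

locale extension = assoc_algebra K A
  for K :: "('k, 'm) ring_scheme" and A :: "('k, 'a, 'n) module_scheme" (structure) +
  fixes B :: "'a set"
  assumes unital_subalgebra: "unital_subalgebra K A B"
begin

lemma subring_B: "subring B A"
  using unital_subalgebra by (simp add: unital_subalgebra_def)

lemma B_subset: "B \<subseteq> carrier A" and B_closed [simp]: "b \<in> B \<Longrightarrow> b \<in> carrier A"
  using subringE(1)[OF subring_B] by auto

text \<open>Acting rings are given by their carriers in the definitions but as rings in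
  \<open>tensor_bimodule\<close>. So \<open>A\<close> is inserted with a changed carrier, and the
  rewrite rule turns the carriers back into the sets \<open>B\<close> and
  \<open>carrier A\<close>.\<close>

sublocale tensor_bimodule "A\<lparr>carrier := carrier A\<rparr>" "A\<lparr>carrier := B\<rparr>" "A\<lparr>carrier := carrier A\<rparr>"
    "reg_bimod A" "reg_bimod A"
  rewrites "carrier (A\<lparr>carrier := X\<rparr>) = X" for X
  by (intro tensor_bimodule.intro reg_bimodule subring_B carrier_is_subring) simp

abbreviation TT where "TT \<equiv> tensor_group B (reg_bimod A) (reg_bimod A)"
abbreviation TS where "TS \<equiv> tensor_square A B"
abbreviation pt where "pt x y \<equiv> ts [(x, y)]"
abbreviation bal where "bal \<equiv> balanced B (reg_bimod A) (reg_bimod A) (add_monoid A)"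
text \<open>\<open>ev \<phi> t\<close> is what is informally written
  \<open>\<phi>(t\<^sup>1, t\<^sup>2)\<close>.\<close>

abbreviation ev where "ev \<equiv> tensor_lift B (reg_bimod A) (reg_bimod A) (add_monoid A)"
abbreviation asum where "asum f xs \<equiv> list_sum (add_monoid A) (map f xs)"

lemma asum_closed [intro]: "(\<And>x. x \<in> set xs \<Longrightarrow> f x \<in> carrier A) \<Longrightarrow> asum f xs \<in> carrier A"
  using add.list_sum_map_closed .

lemma asum_hom:
  assumes "h \<in> carrier A \<rightarrow> carrier A"
    "\<And>x y. x \<in> carrier A \<Longrightarrow> y \<in> carrier A \<Longrightarrow> h (x \<oplus> y) = h x \<oplus> h y"
    "\<And>x. x \<in> set xs \<Longrightarrow> f x \<in> carrier A"
  shows "h (asum f xs) = asum (\<lambda>x. h (f x)) xs"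
  using add.hom_imp_list_sum[of "add_monoid A" h xs f] assms add.is_group by simp

lemma asum_l_distr:
  "a \<in> carrier A \<Longrightarrow> (\<And>x. x \<in> set xs \<Longrightarrow> f x \<in> carrier A) \<Longrightarrow> asum f xs \<otimes> a = asum (\<lambda>x. f x \<otimes> a) xs"
  by (rule asum_hom) (auto simp: l_distr)

lemma asum_r_distr:
  "a \<in> carrier A \<Longrightarrow> (\<And>x. x \<in> set xs \<Longrightarrow> f x \<in> carrier A) \<Longrightarrow> a \<otimes> asum f xs = asum (\<lambda>x. a \<otimes> f x) xs"
  by (rule asum_hom) (auto simp: r_distr)

lemma asum_add:
  "(\<And>x. x \<in> set xs \<Longrightarrow> f x \<in> carrier A) \<Longrightarrow> (\<And>x. x \<in> set xs \<Longrightarrow> g x \<in> carrier A) \<Longrightarrow>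
    asum (\<lambda>x. f x \<oplus> g x) xs = asum f xs \<oplus> asum g xs"
  using add.list_sum_mult[of xs f g] by simp

lemma comm_group_add: "comm_group (add_monoid A)"
  by (rule add.comm_group_axioms)

lemma balI:
  assumes "\<And>x y. x \<in> carrier A \<Longrightarrow> y \<in> carrier A \<Longrightarrow> \<phi> x y \<in> carrier A"
    and "\<And>x x' y. x \<in> carrier A \<Longrightarrow> x' \<in> carrier A \<Longrightarrow> y \<in> carrier A \<Longrightarrow> \<phi> (x \<oplus> x') y = \<phi> x y \<oplus> \<phi> x' y"
    and "\<And>x y y'. x \<in> carrier A \<Longrightarrow> y \<in> carrier A \<Longrightarrow> y' \<in> carrier A \<Longrightarrow> \<phi> x (y \<oplus> y') = \<phi> x y \<oplus> \<phi> x y'"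
    and "\<And>x b y. x \<in> carrier A \<Longrightarrow> b \<in> B \<Longrightarrow> y \<in> carrier A \<Longrightarrow> \<phi> (x \<otimes> b) y = \<phi> x (b \<otimes> y)"
  shows "bal \<phi>"
  using assms by (intro balancedI) simp_all

lemma balD:
  assumes "bal \<phi>"
  shows "x \<in> carrier A \<Longrightarrow> y \<in> carrier A \<Longrightarrow> \<phi> x y \<in> carrier A"
    and "x \<in> carrier A \<Longrightarrow> x' \<in> carrier A \<Longrightarrow> y \<in> carrier A \<Longrightarrow> \<phi> (x \<oplus> x') y = \<phi> x y \<oplus> \<phi> x' y"
    and "x \<in> carrier A \<Longrightarrow> y \<in> carrier A \<Longrightarrow> y' \<in> carrier A \<Longrightarrow> \<phi> x (y \<oplus> y') = \<phi> x y \<oplus> \<phi> x y'"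
    and "x \<in> carrier A \<Longrightarrow> b \<in> B \<Longrightarrow> y \<in> carrier A \<Longrightarrow> \<phi> (x \<otimes> b) y = \<phi> x (b \<otimes> y)"
  using balancedD[OF assms] by simp_all

lemma pt_closed: "x \<in> carrier A \<Longrightarrow> y \<in> carrier A \<Longrightarrow> pt x y \<in> carrier TT"
  by (rule ts_closed) simp

lemma ex_rep_A:
  assumes "t \<in> carrier TT"
  obtains xs where "set xs \<subseteq> carrier A \<times> carrier A" "t = ts xs"
  using ex_rep[OF assms] by auto

lemma ev_rep:
  assumes "bal \<phi>" "set xs \<subseteq> carrier A \<times> carrier A"
  shows "ev \<phi> (ts xs) = asum (\<lambda>(x, y). \<phi> x y) xs"
  using lift_ts[OF comm_group_add assms(1)] assms(2) by simp

lemma ev_closed: "bal \<phi> \<Longrightarrow> t \<in> carrier TT \<Longrightarrow> ev \<phi> t \<in> carrier A"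
  using hom_in_carrier[OF lift_hom[OF comm_group_add]] by auto

lemma ev_pt: "bal \<phi> \<Longrightarrow> x \<in> carrier A \<Longrightarrow> y \<in> carrier A \<Longrightarrow> ev \<phi> (pt x y) = \<phi> x y"
  using lift_pure[OF comm_group_add] by auto

lemma ev_list_sum:
  assumes "bal \<phi>" "\<And>x. x \<in> set xs \<Longrightarrow> f x \<in> carrier TT"
  shows "ev \<phi> (list_sum TT (map f xs)) = asum (\<lambda>x. ev \<phi> (f x)) xs"
  using TG.hom_list_sum_group[OF add.is_group lift_hom[OF comm_group_add assms(1)], of "map f xs"] assms(2)
  by (auto simp: comp_def)

lemma ev_cong:
  assumes "bal \<phi>" "t \<in> carrier TT" "\<And>x y. x \<in> carrier A \<Longrightarrow> y \<in> carrier A \<Longrightarrow> \<phi> x y = \<psi> x y"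
  shows "ev \<phi> t = ev \<psi> t"
  using lift_cong[OF comm_group_add assms(1,2)] assms(3) by simp

lemma ev_comp:
  assumes \<phi>: "bal \<phi>" and h: "h \<in> carrier A \<rightarrow> carrier A"
    "\<And>x y. x \<in> carrier A \<Longrightarrow> y \<in> carrier A \<Longrightarrow> h (x \<oplus> y) = h x \<oplus> h y"
    and t: "t \<in> carrier TT"
  shows "h (ev \<phi> t) = ev (\<lambda>x y. h (\<phi> x y)) t"
proof -
  obtain xs where xs: "set xs \<subseteq> carrier A \<times> carrier A" "t = ts xs"
    using ex_rep_A t by blast
  have "bal (\<lambda>x y. h (\<phi> x y))" using h balD[OF \<phi>] by (intro balI) auto
  moreover have "h (asum (\<lambda>(x, y). \<phi> x y) xs) = asum (\<lambda>p. h (case p of (x, y) \<Rightarrow> \<phi> x y)) xs"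
    using xs balD(1)[OF \<phi>] by (intro asum_hom h) auto
  ultimately show ?thesis
    using xs \<phi> by (simp add: ev_rep) (auto intro!: list_sum_cong)
qed

lemma ev_sum:
  assumes "\<And>p. p \<in> set ps \<Longrightarrow> bal (\<phi> p)" "t \<in> carrier TT"
  shows "bal (\<lambda>x y. asum (\<lambda>p. \<phi> p x y) ps)"
    and "ev (\<lambda>x y. asum (\<lambda>p. \<phi> p x y) ps) t = asum (\<lambda>p. ev (\<phi> p) t) ps"
proof -
  note \<phi> = assms(1)[THEN balD(1)] assms(1)[THEN balD(2)] assms(1)[THEN balD(3)] assms(1)[THEN balD(4)]
  show bal: "bal (\<lambda>x y. asum (\<lambda>p. \<phi> p x y) ps)"
    using \<phi> by (intro balI) (auto simp: asum_add[symmetric] intro!: list_sum_cong)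
  obtain xs where xs: "set xs \<subseteq> carrier A \<times> carrier A" "t = ts xs"
    using ex_rep_A assms(2) by blast
  have "asum (\<lambda>(x, y). asum (\<lambda>p. \<phi> p x y) ps) xs =
      asum (\<lambda>q. asum (\<lambda>p. \<phi> p (fst q) (snd q)) ps) xs"
    by (auto intro!: list_sum_cong)
  also have "\<dots> = asum (\<lambda>p. asum (\<lambda>q. \<phi> p (fst q) (snd q)) xs) ps"
    using xs(1) \<phi>(1) by (intro add.list_sum_swap) (auto simp: subset_iff)
  also have "\<dots> = asum (\<lambda>p. asum (\<lambda>(x, y). \<phi> p x y) xs) ps"
    by (auto intro!: list_sum_cong)
  finally show "ev (\<lambda>x y. asum (\<lambda>p. \<phi> p x y) ps) t = asum (\<lambda>p. ev (\<phi> p) t) ps"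
    using xs assms(1) bal by (auto simp: ev_rep intro!: list_sum_cong)
qed

lemma lact_closed_TS: "a \<in> carrier A \<Longrightarrow> t \<in> carrier TT \<Longrightarrow> lact TS a t \<in> carrier TT"
  and ract_closed_TS: "a \<in> carrier A \<Longrightarrow> t \<in> carrier TT \<Longrightarrow> ract TS t a \<in> carrier TT"
  using hom_in_carrier[OF lact_hom] hom_in_carrier[OF ract_hom] unfolding tensor_square_def by auto

lemma lact_rep: "a \<in> carrier A \<Longrightarrow> set xs \<subseteq> carrier A \<times> carrier A \<Longrightarrow>
    lact TS a (ts xs) =
    ts (map (\<lambda>(x, y). (a \<otimes> x, y)) xs)"
  using lact_ts[of a xs] by (simp add: tensor_square_def)

lemma ract_rep: "a \<in> carrier A \<Longrightarrow> set xs \<subseteq> carrier A \<times> carrier A \<Longrightarrow>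
    ract TS (ts xs) a =
    ts (map (\<lambda>(x, y). (x, y \<otimes> a)) xs)"
  using ract_ts[of a xs] by (simp add: tensor_square_def)

lemma ev_lact:
  assumes "bal \<phi>" "a \<in> carrier A" "t \<in> carrier TT"
  shows "bal (\<lambda>x y. \<phi> (a \<otimes> x) y)" and "ev \<phi> (lact TS a t) = ev (\<lambda>x y. \<phi> (a \<otimes> x) y) t"
proof -
  note \<phi> = balD[OF assms(1)]
  show bal: "bal (\<lambda>x y. \<phi> (a \<otimes> x) y)"
    using \<phi> assms(2) by (intro balI) (auto simp: r_distr m_assoc[symmetric])
  obtain xs where xs: "set xs \<subseteq> carrier A \<times> carrier A" "t = ts xs"
    using ex_rep_A assms(3) by blast
  have "set (map (\<lambda>(x, y). (a \<otimes> x, y)) xs) \<subseteq> carrier A \<times> carrier A" using xs(1) assms(2) by auto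
  then show "ev \<phi> (lact TS a t) = ev (\<lambda>x y. \<phi> (a \<otimes> x) y) t"
    using xs assms bal by (simp add: lact_rep ev_rep) (auto intro!: list_sum_cong)
qed

lemma ev_ract:
  assumes "bal \<phi>" "a \<in> carrier A" "t \<in> carrier TT"
  shows "bal (\<lambda>x y. \<phi> x (y \<otimes> a))" and "ev \<phi> (ract TS t a) = ev (\<lambda>x y. \<phi> x (y \<otimes> a)) t"
proof -
  note \<phi> = balD[OF assms(1)]
  show bal: "bal (\<lambda>x y. \<phi> x (y \<otimes> a))"
    using \<phi> assms(2) by (intro balI) (auto simp: l_distr m_assoc)
  obtain xs where xs: "set xs \<subseteq> carrier A \<times> carrier A" "t = ts xs"
    using ex_rep_A assms(3) by blast
  have "set (map (\<lambda>(x, y). (x, y \<otimes> a)) xs) \<subseteq> carrier A \<times> carrier A" using xs(1) assms(2) by auto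
  then show "ev \<phi> (ract TS t a) = ev (\<lambda>x y. \<phi> x (y \<otimes> a)) t"
    using xs assms bal by (simp add: ract_rep ev_rep) (auto intro!: list_sum_cong)
qed

section \<open>The algebra of bimodule endomorphisms\<close>

abbreviation E where "E \<equiv> End_alg A B"
abbreviation S where "S \<equiv> carrier E"

lemma End_carrier_iff: "\<alpha> \<in> S \<longleftrightarrow> \<alpha> \<in> extensional (carrier A) \<and> \<alpha> \<in> carrier A \<rightarrow> carrier A \<and>
    (\<forall>x\<in>carrier A. \<forall>y\<in>carrier A. \<alpha> (x \<oplus> y) = \<alpha> x \<oplus> \<alpha> y) \<and>
    (\<forall>b\<in>B. \<forall>x\<in>carrier A. \<alpha> (b \<otimes> x) = b \<otimes> \<alpha> x) \<and> (\<forall>x\<in>carrier A. \<forall>b\<in>B. \<alpha> (x \<otimes> b) = \<alpha> x \<otimes> b)"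
  by (auto simp: End_alg_def bimod_hom_def hom_def)

lemma EndI:
  assumes "\<And>x. x \<in> carrier A \<Longrightarrow> f x \<in> carrier A"
    "\<And>x y. x \<in> carrier A \<Longrightarrow> y \<in> carrier A \<Longrightarrow> f (x \<oplus> y) = f x \<oplus> f y"
    "\<And>b x. b \<in> B \<Longrightarrow> x \<in> carrier A \<Longrightarrow> f (b \<otimes> x) = b \<otimes> f x"
    "\<And>b x. b \<in> B \<Longrightarrow> x \<in> carrier A \<Longrightarrow> f (x \<otimes> b) = f x \<otimes> b"
  shows "(\<lambda>x\<in>carrier A. f x) \<in> S"
  using assms by (auto simp: End_carrier_iff)

lemma EndD:
  assumes "\<alpha> \<in> S"
  shows End_closed: "x \<in> carrier A \<Longrightarrow> \<alpha> x \<in> carrier A"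
    and End_add: "x \<in> carrier A \<Longrightarrow> y \<in> carrier A \<Longrightarrow> \<alpha> (x \<oplus> y) = \<alpha> x \<oplus> \<alpha> y"
    and End_l: "b \<in> B \<Longrightarrow> x \<in> carrier A \<Longrightarrow> \<alpha> (b \<otimes> x) = b \<otimes> \<alpha> x"
    and End_r: "b \<in> B \<Longrightarrow> x \<in> carrier A \<Longrightarrow> \<alpha> (x \<otimes> b) = \<alpha> x \<otimes> b"
  using assms by (auto simp: End_carrier_iff)

lemma End_eqI: "\<alpha> \<in> S \<Longrightarrow> \<beta> \<in> S \<Longrightarrow> (\<And>x. x \<in> carrier A \<Longrightarrow> \<alpha> x = \<beta> x) \<Longrightarrow> \<alpha> = \<beta>"
  by (meson End_carrier_iff extensionalityI)

lemma End_asum: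
  "\<alpha> \<in> S \<Longrightarrow> (\<And>x. x \<in> set xs \<Longrightarrow> f x \<in> carrier A) \<Longrightarrow> \<alpha> (asum f xs) = asum (\<lambda>x. \<alpha> (f x)) xs"
  by (rule asum_hom) (auto simp: EndD)

lemma End_simps:
  "\<alpha> \<otimes>\<^bsub>E\<^esub> \<beta> = compose (carrier A) \<alpha> \<beta>"
  "\<one>\<^bsub>E\<^esub> = (\<lambda>x\<in>carrier A. x)"
  "\<zero>\<^bsub>E\<^esub> = (\<lambda>x\<in>carrier A. \<zero>)"
  "\<alpha> \<oplus>\<^bsub>E\<^esub> \<beta> = (\<lambda>x\<in>carrier A. \<alpha> x \<oplus> \<beta> x)"
  "k \<odot>\<^bsub>E\<^esub> \<alpha> = (\<lambda>x\<in>carrier A. k \<odot>\<^bsub>A\<^esub> \<alpha> x)"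
  by (simp_all add: End_alg_def)

lemma End_apply [simp]:
  assumes "x \<in> carrier A"
  shows "(\<alpha> \<otimes>\<^bsub>E\<^esub> \<beta>) x = \<alpha> (\<beta> x)" "\<one>\<^bsub>E\<^esub> x = x" "\<zero>\<^bsub>E\<^esub> x = \<zero>"
    "(\<alpha> \<oplus>\<^bsub>E\<^esub> \<beta>) x = \<alpha> x \<oplus> \<beta> x" "(k \<odot>\<^bsub>E\<^esub> \<alpha>) x = k \<odot>\<^bsub>A\<^esub> \<alpha> x"
  using assms by (simp_all add: End_simps compose_def)

lemma End_ops_closed [simp, intro]:
  "\<alpha> \<in> S \<Longrightarrow> \<beta> \<in> S \<Longrightarrow> \<alpha> \<otimes>\<^bsub>E\<^esub> \<beta> \<in> S"
  "\<one>\<^bsub>E\<^esub> \<in> S" "\<zero>\<^bsub>E\<^esub> \<in> S"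
  "\<alpha> \<in> S \<Longrightarrow> \<beta> \<in> S \<Longrightarrow> \<alpha> \<oplus>\<^bsub>E\<^esub> \<beta> \<in> S"
  "k \<in> carrier K \<Longrightarrow> \<alpha> \<in> S \<Longrightarrow> k \<odot>\<^bsub>E\<^esub> \<alpha> \<in> S"
  unfolding End_simps compose_def
  by (rule EndI; auto simp: EndD r_distr l_distr a_ac M.add.m_ac smult_r_distr smult_mult_left smult_mult_right)+

lemma End_neg: "\<alpha> \<in> S \<Longrightarrow> (\<lambda>x\<in>carrier A. \<ominus> \<alpha> x) \<in> S"
  by (rule EndI) (auto simp: EndD minus_add l_minus r_minus)

lemma End_assoc_algebra: "assoc_algebra K E"
proof -
  have E_ag: "abelian_group E"
  proof (rule abelian_groupI)
    show "\<exists>\<beta>\<in>S. \<beta> \<oplus>\<^bsub>E\<^esub> \<alpha> = \<zero>\<^bsub>E\<^esub>" if "\<alpha> \<in> S" for \<alpha>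
      using that End_neg[OF that]
      by (intro bexI[of _ "\<lambda>x\<in>carrier A. \<ominus> \<alpha> x"] End_eqI) (auto simp: EndD l_neg)
    show "(\<alpha> \<oplus>\<^bsub>E\<^esub> \<beta>) \<oplus>\<^bsub>E\<^esub> \<gamma> = \<alpha> \<oplus>\<^bsub>E\<^esub> (\<beta> \<oplus>\<^bsub>E\<^esub> \<gamma>)"
      if "\<alpha> \<in> S" "\<beta> \<in> S" "\<gamma> \<in> S" for \<alpha> \<beta> \<gamma>
      using that by (intro End_eqI) (simp_all add: EndD M.a_assoc)
    show "\<alpha> \<oplus>\<^bsub>E\<^esub> \<beta> = \<beta> \<oplus>\<^bsub>E\<^esub> \<alpha>" if "\<alpha> \<in> S" "\<beta> \<in> S" for \<alpha> \<beta>
      using that by (intro End_eqI) (simp_all add: EndD M.a_comm)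
  qed (auto intro!: End_eqI simp: EndD)
  have "ring E"
    by (rule ringI[OF E_ag])
      (auto intro!: End_eqI monoidI simp: EndD)
  moreover have "module K E"
    by (rule moduleI[OF R.is_cring E_ag])
      (auto intro!: End_eqI simp: EndD smult_l_distr smult_r_distr smult_assoc1)
  moreover have "\<alpha> (k \<odot>\<^bsub>A\<^esub> x) = k \<odot>\<^bsub>A\<^esub> \<alpha> x" if "\<alpha> \<in> S" "k \<in> carrier K" "x \<in> carrier A" for \<alpha> k x
  proof -
    have "k \<odot>\<^bsub>A\<^esub> \<one> \<in> B"
      using that unital_subalgebra subringE(3)[OF subring_B] by (simp add: unital_subalgebra_def)
    then have "\<alpha> ((k \<odot>\<^bsub>A\<^esub> \<one>) \<otimes> x) = (k \<odot>\<^bsub>A\<^esub> \<one>) \<otimes> \<alpha> x" using that by (intro End_l)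
    then show ?thesis using that by (simp add: smult_mult_left EndD)
  qed
  ultimately show ?thesis
    by (intro assoc_algebra.intro assoc_algebra_axioms.intro) (auto intro!: End_eqI simp: EndD)
qed

sublocale E: assoc_algebra K E by (rule End_assoc_algebra)

lemma End_list_sum:
  assumes "\<And>p. p \<in> set ps \<Longrightarrow> f p \<in> S" "x \<in> carrier A"
  shows "list_sum (add_monoid E) (map f ps) x = asum (\<lambda>p. f p x) ps"
  using assms by (induction ps) simp_all

lemma End_list_sum_closed:
  "(\<And>p. p \<in> set ps \<Longrightarrow> f p \<in> S) \<Longrightarrow> list_sum (add_monoid E) (map f ps) \<in> S"
  using E.add.list_sum_map_closed .

end

section \<open>Depth two quasibases\<close>

text \<open>The mirror image of \<open>left_D2_quasibasis\<close>: here the endomorphism is applied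
  to the second factor and its value is absorbed from the left,
  \<open>a \<otimes> a' = \<Sum> a \<gamma>(a') u\<close>.\<close>

definition right_D2_quasibasis ::
  "('k, 'a, 'n) module_scheme \<Rightarrow> 'a set \<Rightarrow> (('a \<Rightarrow> 'a) \<times> (('a \<times> 'a) \<Rightarrow>\<^sub>0 int) set) list \<Rightarrow> bool"
  where "right_D2_quasibasis A B p \<longleftrightarrow>
    set p \<subseteq> carrier (End_alg A B) \<times> T_set A B \<and>
    (\<forall>a\<in>carrier A. \<forall>a'\<in>carrier A.
      tensor_sum B (reg_bimod A) (reg_bimod A) [(a, a')] =
      list_sum (tensor_square A B) [lact (tensor_square A B) (a \<otimes>\<^bsub>A\<^esub> \<gamma> a') u. (\<gamma>, u) \<leftarrow> p])"

section \<open>Powers of the regular bimodule\<close>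

lemma reg_power_simps [simp]:
  "carrier (bimod_power (reg_bimod A) n) = ({..<n} \<rightarrow>\<^sub>E carrier A)"
  "x \<otimes>\<^bsub>bimod_power (reg_bimod A) n\<^esub> y = (\<lambda>i\<in>{..<n}. x i \<oplus>\<^bsub>A\<^esub> y i)"
  "\<one>\<^bsub>bimod_power (reg_bimod A) n\<^esub> = (\<lambda>i\<in>{..<n}. \<zero>\<^bsub>A\<^esub>)"
  "lact (bimod_power (reg_bimod A) n) a v = (\<lambda>i\<in>{..<n}. a \<otimes>\<^bsub>A\<^esub> v i)"
  "ract (bimod_power (reg_bimod A) n) v a = (\<lambda>i\<in>{..<n}. v i \<otimes>\<^bsub>A\<^esub> a)"
  by (simp_all add: bimod_power_def mk_bimod_def product_group_def)

context ring
begin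

abbreviation reg_power where "reg_power n \<equiv> bimod_power (reg_bimod R) n"

lemma reg_power_eqI:
  "x \<in> carrier (reg_power n) \<Longrightarrow> y \<in> carrier (reg_power n) \<Longrightarrow>
    (\<And>i. i < n \<Longrightarrow> x i = y i) \<Longrightarrow> x = y"
  by (auto intro: PiE_ext)

lemma reg_power_apply: "v \<in> carrier (reg_power n) \<Longrightarrow> i < n \<Longrightarrow> v i \<in> carrier R"
  by auto

lemma reg_power_closed:
  "x \<in> carrier (reg_power n) \<Longrightarrow> y \<in> carrier (reg_power n) \<Longrightarrow>
    x \<otimes>\<^bsub>reg_power n\<^esub> y \<in> carrier (reg_power n)"
  "\<one>\<^bsub>reg_power n\<^esub> \<in> carrier (reg_power n)"
  "a \<in> carrier R \<Longrightarrow> x \<in> carrier (reg_power n) \<Longrightarrow>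
    lact (reg_power n) a x \<in> carrier (reg_power n)"
  "a \<in> carrier R \<Longrightarrow> x \<in> carrier (reg_power n) \<Longrightarrow>
    ract (reg_power n) x a \<in> carrier (reg_power n)"
  by (auto intro!: restrict_PiE_iff[THEN iffD2])

lemma comm_group_reg_power: "comm_group (reg_power n)" (is "comm_group ?P")
proof (rule comm_groupI)
  note [simp] = reg_power_apply[of _ n] and [simp del] = reg_power_simps(1)
  show "x \<otimes>\<^bsub>?P\<^esub> y \<otimes>\<^bsub>?P\<^esub> z = x \<otimes>\<^bsub>?P\<^esub> (y \<otimes>\<^bsub>?P\<^esub> z)"
    if "x \<in> carrier ?P" "y \<in> carrier ?P" "z \<in> carrier ?P" for x y z
    by (rule reg_power_eqI[where n = n]; (intro reg_power_closed that)?) (use that in \<open>simp add: a_assoc\<close>)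
  show "x \<otimes>\<^bsub>?P\<^esub> y = y \<otimes>\<^bsub>?P\<^esub> x" if "x \<in> carrier ?P" "y \<in> carrier ?P" for x y
    by (rule reg_power_eqI[where n = n]; (intro reg_power_closed that)?) (use that in \<open>simp add: a_comm\<close>)
  show "\<one>\<^bsub>?P\<^esub> \<otimes>\<^bsub>?P\<^esub> x = x" if "x \<in> carrier ?P" for x
    by (rule reg_power_eqI[where n = n]; (intro reg_power_closed that)?) (use that in simp)
  show "\<exists>y\<in>carrier ?P. y \<otimes>\<^bsub>?P\<^esub> x = \<one>\<^bsub>?P\<^esub>" if "x \<in> carrier ?P" for x
  proof
    have "(\<lambda>i\<in>{..<n}. \<ominus> x i) \<in> {..<n} \<rightarrow>\<^sub>E carrier R"
      using that by (intro restrict_PiE_iff[THEN iffD2]) simp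
    then show neg: "(\<lambda>i\<in>{..<n}. \<ominus> x i) \<in> carrier ?P" by (simp add: reg_power_simps(1))
    show "(\<lambda>i\<in>{..<n}. \<ominus> x i) \<otimes>\<^bsub>?P\<^esub> x = \<one>\<^bsub>?P\<^esub>"
      by (rule reg_power_eqI[where n = n]; (intro reg_power_closed neg that)?) (use that in \<open>simp add: l_neg\<close>)
  qed
qed (rule reg_power_closed; assumption)+

lemma list_sum_delta:
  assumes "distinct xs" "j \<in> set xs" "c \<in> carrier R"
  shows "list_sum (add_monoid R) (map (\<lambda>i. if i = j then c else \<zero>) xs) = c"
proof -
  have *: "list_sum (add_monoid R) (map (\<lambda>i. if i = j then c else \<zero>) ys) = \<zero>" if "j \<notin> set ys" for ys
    using that by (induction ys) auto
  show ?thesis using assms by (induction xs) (auto simp: *)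
qed

lemma list_sum_reg_power:
  "j < n \<Longrightarrow> list_sum (reg_power n) (map F xs) j =
    list_sum (add_monoid R) (map (\<lambda>i. F i j) xs)"
  by (induction xs) auto

text \<open>Expansion in the standard basis \<open>e\<close>. Left D2 makes the splitting linear
  over \<open>A\<close> on the right and right D2 on the left, and each needs the coefficients on
  its own side.\<close>

lemma reg_power_decomposition:
  fixes e and n :: nat defines "e \<equiv> \<lambda>i. \<lambda>j\<in>{..<n}. if i = j then \<one> else \<zero>"
  assumes v: "v \<in> carrier (reg_power n)"
  shows "v = list_sum (reg_power n)
      (map (\<lambda>i. ract (reg_power n) (e i) (v i)) [0..<n])" (is "_ = ?l")
    and "v = list_sum (reg_power n)
      (map (\<lambda>i. lact (reg_power n) (v i) (e i)) [0..<n])" (is "_ = ?r")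
proof -
  let ?P = "reg_power n"
  interpret P: comm_group ?P by (rule comm_group_reg_power)
  have vc: "v j \<in> carrier R" if "j < n" for j using v that by (auto simp: PiE_iff)
  have "?l \<in> carrier ?P" "?r \<in> carrier ?P"
    using vc by (intro P.list_sum_map_closed; auto simp: e_def)+
  moreover have "v j = ?l j" "v j = ?r j" if "j < n" for j
  proof -
    have "list_sum (add_monoid R) (map (\<lambda>i. e i j \<otimes> v i) [0..<n]) =
        list_sum (add_monoid R) (map (\<lambda>i. if i = j then v j else \<zero>) [0..<n])"
      "list_sum (add_monoid R) (map (\<lambda>i. v i \<otimes> e i j) [0..<n]) =
        list_sum (add_monoid R) (map (\<lambda>i. if i = j then v j else \<zero>) [0..<n])"
      using that vc by (intro list_sum_cong; auto simp: e_def)+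
    then show "v j = ?l j" "v j = ?r j"
      using that vc by (simp_all add: list_sum_reg_power list_sum_delta)
  qed
  ultimately show "v = ?l" "v = ?r"
    using v by (auto intro: reg_power_eqI simp del: reg_power_simps)
qed

end

context extension
begin

lemma pt_balanced:
  "x \<in> carrier A \<Longrightarrow> x' \<in> carrier A \<Longrightarrow> y \<in> carrier A \<Longrightarrow> pt (x \<oplus> x') y = pt x y \<otimes>\<^bsub>TT\<^esub> pt x' y"
  "x \<in> carrier A \<Longrightarrow> y \<in> carrier A \<Longrightarrow> y' \<in> carrier A \<Longrightarrow> pt x (y \<oplus> y') = pt x y \<otimes>\<^bsub>TT\<^esub> pt x y'"
  "x \<in> carrier A \<Longrightarrow> b \<in> B \<Longrightarrow> y \<in> carrier A \<Longrightarrow> pt (x \<otimes> b) y = pt x (b \<otimes> y)"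
  using balancedD[OF pure_balanced] by simp_all

lemma lact_pt: "a \<in> carrier A \<Longrightarrow> x \<in> carrier A \<Longrightarrow> y \<in> carrier A \<Longrightarrow> lact TS a (pt x y) = pt (a \<otimes> x) y"
  and ract_pt: "a \<in> carrier A \<Longrightarrow> x \<in> carrier A \<Longrightarrow> y \<in> carrier A \<Longrightarrow> ract TS (pt x y) a = pt x (y \<otimes> a)"
  by (simp_all add: lact_rep ract_rep)

lemma TS_simps [simp]:
  "carrier TS = carrier TT" "monoid.mult TS = monoid.mult TT" "\<one>\<^bsub>TS\<^esub> = \<one>\<^bsub>TT\<^esub>" "list_sum TS = list_sum TT"
  by (simp_all add: tensor_square_def)

lemma comm_group_TS: "comm_group TS"
  using TG.is_group TG.m_comm TG.m_assoc
  by (intro comm_groupI) (auto intro: exI[of _ "inv\<^bsub>TT\<^esub> _"] TG.l_inv_ex)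

text \<open>Treats both sides of depth two at once: \<open>X\<close> and \<open>Y\<close> contain
  \<open>B\<close>, and in each application one of them is all of \<open>A\<close>. A splitting of
  \<open>A \<otimes> A\<close> through a power of \<open>A\<close> has maps \<open>f\<close> and
  \<open>g\<close>. The coordinates of \<open>f\<close> at \<open>a \<otimes> 1\<close> and
  \<open>1 \<otimes> a\<close> are endomorphisms, the \<open>u i = g (e i)\<close> lie in
  \<open>T\<close>, and expanding \<open>f t\<close> in the basis \<open>e\<close> before applying
  \<open>g\<close> recovers \<open>t\<close>.\<close>

lemma D2_retract:
  assumes iso: "iso_to_direct_summand X Y TS (bimod_power (reg_bimod A) N)"
    and X: "B \<subseteq> X" "X \<subseteq> carrier A" and Y: "B \<subseteq> Y" "Y \<subseteq> carrier A"
  obtains f u where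
    "\<And>i. i < N \<Longrightarrow> (\<lambda>a\<in>carrier A. f (pt a \<one>) i) \<in> S"
    "\<And>i. i < N \<Longrightarrow> (\<lambda>a\<in>carrier A. f (pt \<one> a) i) \<in> S"
    "\<And>i. u i \<in> T_set A B"
    "\<And>a t i. a \<in> X \<Longrightarrow> t \<in> carrier TT \<Longrightarrow> i < N \<Longrightarrow> f (lact TS a t) i = a \<otimes> f t i"
    "\<And>a t i. a \<in> Y \<Longrightarrow> t \<in> carrier TT \<Longrightarrow> i < N \<Longrightarrow> f (ract TS t a) i = f t i \<otimes> a"
    "\<And>t. X = carrier A \<Longrightarrow> t \<in> carrier TT \<Longrightarrow>
      t = list_sum TT (map (\<lambda>i. lact TS (f t i) (u i)) [0..<N])"
    "\<And>t. Y = carrier A \<Longrightarrow> t \<in> carrier TT \<Longrightarrow>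
      t = list_sum TT (map (\<lambda>i. ract TS (u i) (f t i)) [0..<N])"
proof -
  let ?P = "bimod_power (reg_bimod A) N"
  interpret P: comm_group ?P by (rule comm_group_reg_power)
  have XY: "a \<in> X \<Longrightarrow> a \<in> carrier A" "a \<in> Y \<Longrightarrow> a \<in> carrier A"
    "b \<in> B \<Longrightarrow> b \<in> X" "b \<in> B \<Longrightarrow> b \<in> Y" for a b
    using X Y by auto
  obtain f g where f: "f \<in> bimod_hom X Y TS ?P" and g: "g \<in> bimod_hom X Y ?P TS"
    and gf: "\<And>t. t \<in> carrier TS \<Longrightarrow> g (f t) = t"
    using iso comm_group_TS comm_group_reg_power
  proof (rule iso_to_direct_summand_retract)
    show "lact ?P a (x \<otimes>\<^bsub>?P\<^esub> y) = lact ?P a x \<otimes>\<^bsub>?P\<^esub> lact ?P a y"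
      if "a \<in> X" "x \<in> carrier ?P" "y \<in> carrier ?P" for a x y
      using that XY reg_power_apply[of _ N] by (auto simp: r_distr intro!: restrict_ext)
    show "ract ?P (x \<otimes>\<^bsub>?P\<^esub> y) b = ract ?P x b \<otimes>\<^bsub>?P\<^esub> ract ?P y b"
      if "x \<in> carrier ?P" "y \<in> carrier ?P" "b \<in> Y" for b x y
      using that XY reg_power_apply[of _ N] by (auto simp: l_distr intro!: restrict_ext)
  qed (simp_all add: lact_closed_TS ract_closed_TS XY)
  define e where "e = (\<lambda>i. \<lambda>j\<in>{..<N}. if i = j then \<one> else \<zero>)"
  have e: "e i \<in> carrier ?P" for i by (simp add: e_def)
  \<comment> \<open>The entries of \<open>e i\<close> are 0 and 1, so they commute with every
    scalar; this is what puts \<open>g (e i)\<close> into \<open>T\<close>.\<close>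
  have e_comm: "lact ?P b (e i) = ract ?P (e i) b" if "b \<in> carrier A" for b i
    using that by (auto simp: e_def intro!: restrict_ext)
  have f_mem: "f t \<in> carrier ?P" if "t \<in> carrier TT" for t
    using f that by (auto simp: bimod_hom_def hom_def)
  have f_mult: "f (t \<otimes>\<^bsub>TT\<^esub> t') = f t \<otimes>\<^bsub>?P\<^esub> f t'" if "t \<in> carrier TT" "t' \<in> carrier TT" for t t'
    using f that by (simp add: bimod_hom_def hom_def del: reg_power_simps)
  have f_lact: "f (lact TS a t) i = a \<otimes> f t i" if "a \<in> X" "t \<in> carrier TT" "i < N" for a t i
    using f that by (simp add: bimod_hom_def)
  have f_ract: "f (ract TS t a) i = f t i \<otimes> a" if "a \<in> Y" "t \<in> carrier TT" "i < N" for a t i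
    using f that by (simp add: bimod_hom_def)
  have g_hom: "g \<in> hom ?P TT" using g by (auto simp: bimod_hom_def hom_def)
  have g_lact: "g (lact ?P a v) = lact TS a (g v)" if "a \<in> X" "v \<in> carrier ?P" for a v
    using g that by (simp add: bimod_hom_def del: reg_power_simps)
  have g_ract: "g (ract ?P v a) = ract TS (g v) a" if "a \<in> Y" "v \<in> carrier ?P" for a v
    using g that by (simp add: bimod_hom_def del: reg_power_simps)
  have f_apply: "f t i \<in> carrier A" if "t \<in> carrier TT" "i < N" for t i
    using reg_power_apply[OF f_mem] that by simp
  show thesis
  proof (rule that[of f "\<lambda>i. g (e i)"])
    fix i assume i: "i < N"
    show "(\<lambda>a\<in>carrier A. f (pt a \<one>) i) \<in> S"
    proof (rule EndI)
      fix x assume x: "x \<in> carrier A"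
      then show "f (pt x \<one>) i \<in> carrier A" using i by (intro f_apply pt_closed) simp_all
      show "f (pt (x \<oplus> y) \<one>) i = f (pt x \<one>) i \<oplus> f (pt y \<one>) i" if "y \<in> carrier A" for y
        using x i that by (simp add: pt_balanced f_mult pt_closed)
      show "f (pt (b \<otimes> x) \<one>) i = b \<otimes> f (pt x \<one>) i" if "b \<in> B" for b
        using x i that f_lact[of b "pt x \<one>"] by (simp add: lact_pt pt_closed XY)
      \<comment> \<open>Over \<open>B\<close> one has
        \<open>x b \<otimes> 1 = x \<otimes> b\<close>, which is the right action of
        \<open>b\<close> on \<open>x \<otimes> 1\<close>.\<close>
      show "f (pt (x \<otimes> b) \<one>) i = f (pt x \<one>) i \<otimes> b" if "b \<in> B" for b
        using x i that f_ract[of b "pt x \<one>"] by (simp add: ract_pt pt_closed pt_balanced XY)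
    qed
    show "(\<lambda>a\<in>carrier A. f (pt \<one> a) i) \<in> S"
    proof (rule EndI)
      fix x assume x: "x \<in> carrier A"
      then show "f (pt \<one> x) i \<in> carrier A" using i by (intro f_apply pt_closed) simp_all
      show "f (pt \<one> (x \<oplus> y)) i = f (pt \<one> x) i \<oplus> f (pt \<one> y) i" if "y \<in> carrier A" for y
        using x i that by (simp add: pt_balanced f_mult pt_closed)
      show "f (pt \<one> (b \<otimes> x)) i = b \<otimes> f (pt \<one> x) i" if "b \<in> B" for b
        using x i that f_lact[of b "pt \<one> x"]
        by (simp add: lact_pt pt_closed pt_balanced(3)[symmetric] XY)
      show "f (pt \<one> (x \<otimes> b)) i = f (pt \<one> x) i \<otimes> b" if "b \<in> B" for b
        using x i that f_ract[of b "pt \<one> x"] by (simp add: ract_pt pt_closed XY)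
    qed
  next
    fix i
    have "lact TS b (g (e i)) = ract TS (g (e i)) b" if "b \<in> B" for b
      using g_lact[OF XY(3)[OF that] e] g_ract[OF XY(4)[OF that] e] e_comm[OF B_closed[OF that]]
      by metis
    then show "g (e i) \<in> T_set A B" using hom_in_carrier[OF g_hom e] by (simp add: T_set_def)
  next
    fix t assume X_eq: "X = carrier A" and t: "t \<in> carrier TT"
    have "t = g (f t)" using gf t by simp
    also have "f t = list_sum ?P (map (\<lambda>i. lact ?P (f t i) (e i)) [0..<N])"
      using reg_power_decomposition(2)[OF f_mem[OF t]] unfolding e_def .
    also have "g \<dots> = list_sum TT (map g (map (\<lambda>i. lact ?P (f t i) (e i)) [0..<N]))"
      using f_apply[OF t] e by (intro P.hom_list_sum_group[OF TG.is_group g_hom])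
        (auto intro!: reg_power_closed simp del: reg_power_simps)
    also have "\<dots> = list_sum TT (map (\<lambda>i. lact TS (f t i) (g (e i))) [0..<N])"
      unfolding map_map comp_def
      using f_apply[OF t] X_eq by (intro list_sum_cong g_lact e) simp
    finally show "t = list_sum TT (map (\<lambda>i. lact TS (f t i) (g (e i))) [0..<N])" .
  next
    fix t assume Y_eq: "Y = carrier A" and t: "t \<in> carrier TT"
    have "t = g (f t)" using gf t by simp
    also have "f t = list_sum ?P (map (\<lambda>i. ract ?P (e i) (f t i)) [0..<N])"
      using reg_power_decomposition(1)[OF f_mem[OF t]] unfolding e_def .
    also have "g \<dots> = list_sum TT (map g (map (\<lambda>i. ract ?P (e i) (f t i)) [0..<N]))"
      using f_apply[OF t] e by (intro P.hom_list_sum_group[OF TG.is_group g_hom])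
        (auto intro!: reg_power_closed simp del: reg_power_simps)
    also have "\<dots> = list_sum TT (map (\<lambda>i. ract TS (g (e i)) (f t i)) [0..<N])"
      unfolding map_map comp_def
      using f_apply[OF t] Y_eq by (intro list_sum_cong g_ract e) simp
    finally show "t = list_sum TT (map (\<lambda>i. ract TS (g (e i)) (f t i)) [0..<N])" .
  qed (use f_lact f_ract in auto)
qed

text \<open>Right \<open>A\<close>-linearity of \<open>f\<close> fixes its coordinates:
  \<open>f (a \<otimes> a') i = \<beta> i a \<otimes> a'\<close> with \<open>\<beta> i a\<close> the
  coordinate at \<open>a \<otimes> 1\<close>. The expansion from \<open>D2_retract\<close> is then
  the quasibasis identity.\<close>

lemma left_D2_quasibasis_exists:
  assumes "iso_to_direct_summand B (carrier A) TS (bimod_power (reg_bimod A) N)"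
  shows "\<exists>q. left_D2_quasibasis A B q"
proof -
  obtain f u where f: "\<And>i. i < N \<Longrightarrow> (\<lambda>a\<in>carrier A. f (pt a \<one>) i) \<in> S"
      "\<And>a t i. a \<in> carrier A \<Longrightarrow> t \<in> carrier TT \<Longrightarrow> i < N \<Longrightarrow> f (ract TS t a) i = f t i \<otimes> a"
      "\<And>t. t \<in> carrier TT \<Longrightarrow> t = list_sum TT (map (\<lambda>i. ract TS (u i) (f t i)) [0..<N])"
    and u: "\<And>i. u i \<in> T_set A B"
    using assms by (rule D2_retract) (auto simp: B_subset)
  define \<beta> where "\<beta> i = (\<lambda>a\<in>carrier A. f (pt a \<one>) i)" for i
  have "pt a a' = list_sum TT (map (\<lambda>i. ract TS (u i) (\<beta> i a \<otimes> a')) [0..<N])"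
    if a: "a \<in> carrier A" "a' \<in> carrier A" for a a'
  proof -
    have "f (pt a a') i = \<beta> i a \<otimes> a'" if "i < N" for i
      using f(2)[of a' "pt a \<one>"] a that by (simp add: \<beta>_def ract_pt pt_closed)
    then show ?thesis
      by (subst f(3)[OF pt_closed[OF a]]) (auto intro!: list_sum_cong)
  qed
  moreover have "\<beta> i \<in> S" if "i < N" for i
    unfolding \<beta>_def using that by (rule f(1))
  ultimately have "left_D2_quasibasis A B (map (\<lambda>i. (\<beta> i, u i)) [0..<N])"
    using u by (auto simp: left_D2_quasibasis_def comp_def)
  then show ?thesis by blast
qed

lemma right_D2_quasibasis_exists:
  assumes "iso_to_direct_summand (carrier A) B TS (bimod_power (reg_bimod A) N)"
  shows "\<exists>p. right_D2_quasibasis A B p"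
proof -
  obtain f u where f: "\<And>i. i < N \<Longrightarrow> (\<lambda>a\<in>carrier A. f (pt \<one> a) i) \<in> S"
      "\<And>a t i. a \<in> carrier A \<Longrightarrow> t \<in> carrier TT \<Longrightarrow> i < N \<Longrightarrow> f (lact TS a t) i = a \<otimes> f t i"
      "\<And>t. t \<in> carrier TT \<Longrightarrow> t = list_sum TT (map (\<lambda>i. lact TS (f t i) (u i)) [0..<N])"
    and u: "\<And>i. u i \<in> T_set A B"
    using assms by (rule D2_retract) (auto simp: B_subset)
  define \<gamma> where "\<gamma> i = (\<lambda>a\<in>carrier A. f (pt \<one> a) i)" for i
  have "pt a a' = list_sum TT (map (\<lambda>i. lact TS (a \<otimes> \<gamma> i a') (u i)) [0..<N])"
    if a: "a \<in> carrier A" "a' \<in> carrier A" for a a'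
  proof -
    have "f (pt a a') i = a \<otimes> \<gamma> i a'" if "i < N" for i
      using f(2)[of a "pt \<one> a'"] a that by (simp add: \<gamma>_def lact_pt pt_closed)
    then show ?thesis
      by (subst f(3)[OF pt_closed[OF a]]) (auto intro!: list_sum_cong)
  qed
  moreover have "\<gamma> i \<in> S" if "i < N" for i
    unfolding \<gamma>_def using that by (rule f(1))
  ultimately have "right_D2_quasibasis A B (map (\<lambda>i. (\<gamma> i, u i)) [0..<N])"
    using u by (auto simp: right_D2_quasibasis_def comp_def)
  then show ?thesis by blast
qed

section \<open>Elements of T and their pairings with endomorphisms\<close>

lemma T_setD: "t \<in> T_set A B \<Longrightarrow> t \<in> carrier TT"
  "t \<in> T_set A B \<Longrightarrow> b \<in> B \<Longrightarrow> lact TS b t = ract TS t b"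
  by (simp_all add: T_set_def)

text \<open>Multiplication by \<open>b\<close> from either side moves inside \<phi> and becomes an
  action on \<open>t\<close>, where left and right agree because \<open>t\<close> lies in
  \<open>T\<close>. This is why the pairings take values in \<open>R\<close>.\<close>

lemma ev_T_central:
  assumes \<phi>: "bal \<phi>" and t: "t \<in> T_set A B"
    and l: "\<And>b x y. b \<in> B \<Longrightarrow> x \<in> carrier A \<Longrightarrow> y \<in> carrier A \<Longrightarrow> \<phi> (b \<otimes> x) y = b \<otimes> \<phi> x y"
    and r: "\<And>b x y. b \<in> B \<Longrightarrow> x \<in> carrier A \<Longrightarrow> y \<in> carrier A \<Longrightarrow> \<phi> x (y \<otimes> b) = \<phi> x y \<otimes> b"
  shows "ev \<phi> t \<in> centralizer A B"
proof -
  have "b \<otimes> ev \<phi> t = ev \<phi> t \<otimes> b" if b: "b \<in> B" for b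
  proof -
    note tc = T_setD(1)[OF t] and bA = B_closed[OF b]
    have "b \<otimes> ev \<phi> t = ev (\<lambda>x y. b \<otimes> \<phi> x y) t"
      using \<phi> tc bA by (intro ev_comp) (auto simp: r_distr)
    also have "\<dots> = ev (\<lambda>x y. \<phi> (b \<otimes> x) y) t"
      using ev_cong[OF ev_lact(1)[OF \<phi> bA tc] tc, of "\<lambda>x y. b \<otimes> \<phi> x y"] l b by simp
    also have "\<dots> = ev \<phi> (lact TS b t)" using ev_lact(2)[OF \<phi> bA tc] by simp
    also have "\<dots> = ev \<phi> (ract TS t b)" using T_setD(2)[OF t b] by simp
    also have "\<dots> = ev (\<lambda>x y. \<phi> x (y \<otimes> b)) t" using ev_ract(2)[OF \<phi> bA tc] by simp
    also have "\<dots> = ev (\<lambda>x y. \<phi> x y \<otimes> b) t"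
      using ev_cong[OF ev_ract(1)[OF \<phi> bA tc] tc, of "\<lambda>x y. \<phi> x y \<otimes> b"] r b by simp
    also have "\<dots> = ev \<phi> t \<otimes> b"
      using \<phi> tc bA by (intro ev_comp[symmetric]) (auto simp: l_distr)
    finally show ?thesis .
  qed
  then show ?thesis using ev_closed[OF \<phi> T_setD(1)[OF t]] by (simp add: centralizer_def)
qed

abbreviation evL where "evL \<alpha> \<equiv> ev (\<lambda>x y. \<alpha> x \<otimes> y)"
abbreviation evR where "evR \<alpha> \<equiv> ev (\<lambda>x y. x \<otimes> \<alpha> y)"

lemma bal_L: "\<alpha> \<in> S \<Longrightarrow> bal (\<lambda>x y. \<alpha> x \<otimes> y)"
  and bal_R: "\<alpha> \<in> S \<Longrightarrow> bal (\<lambda>x y. x \<otimes> \<alpha> y)"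
  by (intro balI; simp add: EndD l_distr r_distr m_assoc)+

lemma evL_central: "\<alpha> \<in> S \<Longrightarrow> t \<in> T_set A B \<Longrightarrow> evL \<alpha> t \<in> centralizer A B"
  by (rule ev_T_central[OF bal_L]) (auto simp: EndD m_assoc)

lemma evR_central: "\<alpha> \<in> S \<Longrightarrow> t \<in> T_set A B \<Longrightarrow> evR \<alpha> t \<in> centralizer A B"
  by (rule ev_T_central[OF bal_R]) (auto simp: EndD m_assoc)

end

section \<open>The antipode\<close>

locale irreducible = extension K A B
  for K :: "('k, 'm) ring_scheme" and A :: "('k, 'a, 'n) module_scheme" (structure) and B +
  assumes depth_two: "depth_two A B"
    and centralizer_subset: "centralizer A B \<subseteq> B"
begin

text \<open>\<open>R\<close> is contained in \<open>B\<close> and commutes with it, so it is the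
  center of \<open>B\<close>; hence the letter.\<close>

abbreviation Z where "Z \<equiv> centralizer A B"

lemma Z_in_B [simp]: "r \<in> Z \<Longrightarrow> r \<in> B"
  using centralizer_subset by auto

lemma Z_closed [simp]: "r \<in> Z \<Longrightarrow> r \<in> carrier A"
  by simp

lemma Z_B_comm: "r \<in> Z \<Longrightarrow> b \<in> B \<Longrightarrow> b \<otimes> r = r \<otimes> b"
  unfolding centralizer_def by blast

lemma Z_comm: "r \<in> Z \<Longrightarrow> s \<in> Z \<Longrightarrow> r \<otimes> s = s \<otimes> r"
  using Z_B_comm[of s r] by simp

text \<open>The same choice term as in \<open>End_comult\<close>, so that the coproduct unfolds to a
  list over \<open>qb\<close>.\<close>

definition qb where "qb = (SOME q. left_D2_quasibasis A B q)"

definition pb where "pb = (SOME p. right_D2_quasibasis A B p)"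

lemma qb: "left_D2_quasibasis A B qb"
  using depth_two left_D2_quasibasis_exists unfolding depth_two_def qb_def by (metis someI_ex)

lemma pb: "right_D2_quasibasis A B pb"
  using depth_two right_D2_quasibasis_exists unfolding depth_two_def pb_def by (metis someI_ex)

lemma qb_mem: "p \<in> set qb \<Longrightarrow> fst p \<in> S" "p \<in> set qb \<Longrightarrow> snd p \<in> T_set A B"
    "p \<in> set qb \<Longrightarrow> snd p \<in> carrier TT" "(\<beta>, t) \<in> set qb \<Longrightarrow> \<beta> \<in> S"
    "(\<beta>, t) \<in> set qb \<Longrightarrow> t \<in> T_set A B" "(\<beta>, t) \<in> set qb \<Longrightarrow> t \<in> carrier TT"
  and pb_mem: "p \<in> set pb \<Longrightarrow> fst p \<in> S" "p \<in> set pb \<Longrightarrow> snd p \<in> T_set A B"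
    "p \<in> set pb \<Longrightarrow> snd p \<in> carrier TT" "(\<gamma>, u) \<in> set pb \<Longrightarrow> \<gamma> \<in> S"
    "(\<gamma>, u) \<in> set pb \<Longrightarrow> u \<in> T_set A B" "(\<gamma>, u) \<in> set pb \<Longrightarrow> u \<in> carrier TT"
  using qb pb T_setD(1) by (auto simp: left_D2_quasibasis_def right_D2_quasibasis_def)

lemma pt_qb: "a \<in> carrier A \<Longrightarrow> a' \<in> carrier A \<Longrightarrow>
    pt a a' = list_sum TT (map (\<lambda>p. ract TS (snd p) (fst p a \<otimes> a')) qb)"
  using qb by (simp add: left_D2_quasibasis_def case_prod_unfold)

lemma pt_pb: "a \<in> carrier A \<Longrightarrow> a' \<in> carrier A \<Longrightarrow>
    pt a a' = list_sum TT (map (\<lambda>p. lact TS (a \<otimes> fst p a') (snd p)) pb)"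
  using pb by (simp add: right_D2_quasibasis_def case_prod_unfold)

text \<open>Write \<open>a \<otimes> 1\<close> in the quasibasis; right \<open>A\<close>-linearity
  of \<phi> lets the factor \<open>fst p a\<close> out. Applied to \<open>\<alpha>(x) y\<close>, it
  expands endomorphisms; applied to \<open>\<alpha>(x y) z\<close> as a map of
  \<open>y \<otimes> z\<close>, it computes the coproduct.\<close>

lemma ev_qb:
  assumes \<phi>: "bal \<phi>" and a: "a \<in> carrier A"
    and r: "\<And>x y c. x \<in> carrier A \<Longrightarrow> y \<in> carrier A \<Longrightarrow> c \<in> carrier A \<Longrightarrow> \<phi> x (y \<otimes> c) = \<phi> x y \<otimes> c"
  shows "\<phi> a \<one> = asum (\<lambda>p. ev \<phi> (snd p) \<otimes> fst p a) qb"
proof -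
  have "\<phi> a \<one> = ev \<phi> (pt a \<one>)" using \<phi> a by (simp add: ev_pt)
  also have "\<dots> = asum (\<lambda>p. ev \<phi> (ract TS (snd p) (fst p a \<otimes> \<one>))) qb"
    using \<phi> a by (simp add: pt_qb ev_list_sum ract_closed_TS qb_mem EndD)
  also have "\<dots> = asum (\<lambda>p. ev \<phi> (snd p) \<otimes> fst p a) qb"
  proof (rule list_sum_cong)
    fix p assume p: "p \<in> set qb"
    define c where "c = fst p a"
    have c: "c \<in> carrier A" using p a by (simp add: c_def qb_mem EndD)
    have "ev \<phi> (ract TS (snd p) c) = ev (\<lambda>x y. \<phi> x (y \<otimes> c)) (snd p)"
      using ev_ract(2) \<phi> c qb_mem(3)[OF p] by simp
    also have "\<dots> = ev (\<lambda>x y. \<phi> x y \<otimes> c) (snd p)"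
      using ev_ract(1)[OF \<phi> c] qb_mem(3)[OF p] r c by (intro ev_cong)
    also have "\<dots> = ev \<phi> (snd p) \<otimes> c"
      using \<phi> qb_mem(3)[OF p] c by (intro ev_comp[symmetric]) (auto simp: l_distr)
    finally show "ev \<phi> (ract TS (snd p) (fst p a \<otimes> \<one>)) = ev \<phi> (snd p) \<otimes> fst p a"
      using c by (simp add: c_def)
  qed
  finally show ?thesis .
qed

lemma ev_pb:
  assumes \<phi>: "bal \<phi>" and a: "a \<in> carrier A"
    and l: "\<And>x y c. x \<in> carrier A \<Longrightarrow> y \<in> carrier A \<Longrightarrow> c \<in> carrier A \<Longrightarrow> \<phi> (c \<otimes> x) y = c \<otimes> \<phi> x y"
  shows "\<phi> \<one> a = asum (\<lambda>p. fst p a \<otimes> ev \<phi> (snd p)) pb"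
proof -
  have "\<phi> \<one> a = ev \<phi> (pt \<one> a)" using \<phi> a by (simp add: ev_pt)
  also have "\<dots> = asum (\<lambda>p. ev \<phi> (lact TS (\<one> \<otimes> fst p a) (snd p))) pb"
    using \<phi> a by (simp add: pt_pb ev_list_sum lact_closed_TS pb_mem EndD)
  also have "\<dots> = asum (\<lambda>p. fst p a \<otimes> ev \<phi> (snd p)) pb"
  proof (rule list_sum_cong)
    fix p assume p: "p \<in> set pb"
    define c where "c = fst p a"
    have c: "c \<in> carrier A" using p a by (simp add: c_def pb_mem EndD)
    have "ev \<phi> (lact TS c (snd p)) = ev (\<lambda>x y. \<phi> (c \<otimes> x) y) (snd p)"
      using ev_lact(2) \<phi> c pb_mem(3)[OF p] by simp
    also have "\<dots> = ev (\<lambda>x y. c \<otimes> \<phi> x y) (snd p)"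
      using ev_lact(1)[OF \<phi> c] pb_mem(3)[OF p] l c by (intro ev_cong)
    also have "\<dots> = c \<otimes> ev \<phi> (snd p)"
      using \<phi> pb_mem(3)[OF p] c by (intro ev_comp[symmetric]) (auto simp: r_distr)
    finally show "ev \<phi> (lact TS (\<one> \<otimes> fst p a) (snd p)) = fst p a \<otimes> ev \<phi> (snd p)"
      using c by (simp add: c_def)
  qed
  finally show ?thesis .
qed

text \<open>A dual basis formula: the coefficients are values of the pairing at the elements of the
  quasibasis, so they determine \<alpha>. This and \<open>End_pb\<close> are the source of
  nondegeneracy.\<close>

lemma End_qb: "\<alpha> \<in> S \<Longrightarrow> a \<in> carrier A \<Longrightarrow> \<alpha> a = asum (\<lambda>p. evL \<alpha> (snd p) \<otimes> fst p a) qb"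
  using ev_qb[OF bal_L, of \<alpha> a] by (simp add: EndD m_assoc)

lemma End_pb: "\<alpha> \<in> S \<Longrightarrow> a \<in> carrier A \<Longrightarrow> \<alpha> a = asum (\<lambda>p. fst p a \<otimes> evR \<alpha> (snd p)) pb"
  using ev_pb[OF bal_R, of \<alpha> a] by (simp add: EndD m_assoc)

lemma End_eq_evL:
  assumes "\<alpha> \<in> S" "\<beta> \<in> S" "\<And>t. t \<in> T_set A B \<Longrightarrow> evL \<alpha> t = evL \<beta> t"
  shows "\<alpha> = \<beta>"
proof (rule End_eqI[OF assms(1,2)])
  fix a assume "a \<in> carrier A"
  then show "\<alpha> a = \<beta> a"
    unfolding End_qb[OF assms(1) \<open>a \<in> _\<close>] End_qb[OF assms(2) \<open>a \<in> _\<close>]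
    using assms(3) qb_mem(2) by (intro list_sum_cong) simp
qed

lemma End_eq_evR:
  assumes "\<alpha> \<in> S" "\<beta> \<in> S" "\<And>t. t \<in> T_set A B \<Longrightarrow> evR \<alpha> t = evR \<beta> t"
  shows "\<alpha> = \<beta>"
proof (rule End_eqI[OF assms(1,2)])
  fix a assume "a \<in> carrier A"
  then show "\<alpha> a = \<beta> a"
    unfolding End_pb[OF assms(1) \<open>a \<in> _\<close>] End_pb[OF assms(2) \<open>a \<in> _\<close>]
    using assms(3) pb_mem(2) by (intro list_sum_cong) simp
qed

text \<open>The quasibasis identity extended from pure tensors by additivity. It is the expansion
  dual to \<open>End_qb\<close>, now of the tensor instead of the endomorphism.\<close>

lemma tensor_qb:
  assumes t: "t \<in> carrier TT"
  shows "t = list_sum TT (map (\<lambda>p. ract TS (snd p) (evL (fst p) t)) qb)"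
proof -
  obtain xs where xs: "set xs \<subseteq> carrier A \<times> carrier A" "t = ts xs"
    using t by (rule ex_rep_A)
  have xs': "fst z \<in> carrier A" "snd z \<in> carrier A" if "z \<in> set xs" for z using xs(1) that by auto
  have "t = list_sum TT (map (\<lambda>z. pt (fst z) (snd z)) xs)"
    using ts_list_sum[of xs] xs by (simp add: case_prod_unfold)
  also have "\<dots> = list_sum TT (map (\<lambda>z. list_sum TT (map (\<lambda>p. ract TS (snd p) (fst p (fst z) \<otimes> snd z)) qb)) xs)"
    using xs' by (intro list_sum_cong pt_qb) simp_all
  also have "\<dots> = list_sum TT (map (\<lambda>p. list_sum TT (map (\<lambda>z. ract TS (snd p) (fst p (fst z) \<otimes> snd z)) xs)) qb)"
    using xs' qb_mem by (intro TG.list_sum_swap ract_closed_TS) (auto simp: EndD)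
  also have "\<dots> = list_sum TT (map (\<lambda>p. ract TS (snd p) (evL (fst p) t)) qb)"
  proof (rule list_sum_cong)
    fix p assume p: "p \<in> set qb"
    have "evL (fst p) t = asum (\<lambda>z. fst p (fst z) \<otimes> snd z) xs"
      using xs by (simp add: ev_rep bal_L qb_mem p case_prod_unfold)
    moreover have "ract TS (snd p) (asum (\<lambda>z. fst p (fst z) \<otimes> snd z) xs) =
        list_sum TT (map (\<lambda>z. ract TS (snd p) (fst p (fst z) \<otimes> snd z)) xs)"
      using p xs' qb_mem tensor_add_ract[of _ _ "snd p"]
      by (intro add.hom_imp_list_sum[of TT "ract TS (snd p)", simplified])
        (auto simp: EndD ract_closed_TS tensor_square_def[symmetric])
    ultimately show "list_sum TT (map (\<lambda>z. ract TS (snd p) (fst p (fst z) \<otimes> snd z)) xs) =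
        ract TS (snd p) (evL (fst p) t)" by simp
  qed
  finally show ?thesis .
qed

lemma tensor_pb:
  assumes t: "t \<in> carrier TT"
  shows "t = list_sum TT (map (\<lambda>p. lact TS (evR (fst p) t) (snd p)) pb)"
proof -
  obtain xs where xs: "set xs \<subseteq> carrier A \<times> carrier A" "t = ts xs"
    using t by (rule ex_rep_A)
  have xs': "fst z \<in> carrier A" "snd z \<in> carrier A" if "z \<in> set xs" for z using xs(1) that by auto
  have "t = list_sum TT (map (\<lambda>z. pt (fst z) (snd z)) xs)"
    using ts_list_sum[of xs] xs by (simp add: case_prod_unfold)
  also have "\<dots> = list_sum TT (map (\<lambda>z. list_sum TT (map (\<lambda>p. lact TS (fst z \<otimes> fst p (snd z)) (snd p)) pb)) xs)"
    using xs' by (intro list_sum_cong pt_pb) simp_all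
  also have "\<dots> = list_sum TT (map (\<lambda>p. list_sum TT (map (\<lambda>z. lact TS (fst z \<otimes> fst p (snd z)) (snd p)) xs)) pb)"
    using xs' pb_mem by (intro TG.list_sum_swap lact_closed_TS) (auto simp: EndD)
  also have "\<dots> = list_sum TT (map (\<lambda>p. lact TS (evR (fst p) t) (snd p)) pb)"
  proof (rule list_sum_cong)
    fix p assume p: "p \<in> set pb"
    have "evR (fst p) t = asum (\<lambda>z. fst z \<otimes> fst p (snd z)) xs"
      using xs by (simp add: ev_rep bal_R pb_mem p case_prod_unfold)
    moreover have "lact TS (asum (\<lambda>z. fst z \<otimes> fst p (snd z)) xs) (snd p) =
        list_sum TT (map (\<lambda>z. lact TS (fst z \<otimes> fst p (snd z)) (snd p)) xs)"
      using p xs' pb_mem tensor_add_lact[of _ _ "snd p"]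
      by (intro add.hom_imp_list_sum[of TT "\<lambda>a. lact TS a (snd p)", simplified])
        (auto simp: EndD lact_closed_TS tensor_square_def[symmetric])
    ultimately show "list_sum TT (map (\<lambda>z. lact TS (fst z \<otimes> fst p (snd z)) (snd p)) xs) =
        lact TS (evR (fst p) t) (snd p)" by simp
  qed
  finally show ?thesis .
qed

lemma evL_lact: "\<alpha> \<in> S \<Longrightarrow> b \<in> B \<Longrightarrow> t \<in> carrier TT \<Longrightarrow> evL \<alpha> (lact TS b t) = b \<otimes> evL \<alpha> t"
proof -
  assume *: "\<alpha> \<in> S" "b \<in> B" "t \<in> carrier TT"
  have "evL \<alpha> (lact TS b t) = ev (\<lambda>x y. \<alpha> (b \<otimes> x) \<otimes> y) t"
    using * by (intro ev_lact(2) bal_L) auto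
  also have "\<dots> = ev (\<lambda>x y. b \<otimes> (\<alpha> x \<otimes> y)) t"
    using ev_lact(1)[OF bal_L, of \<alpha> b t] * by (intro ev_cong) (auto simp: EndD m_assoc)
  also have "\<dots> = b \<otimes> evL \<alpha> t"
    using * by (intro ev_comp[symmetric] bal_L) (auto simp: r_distr)
  finally show ?thesis .
qed

lemma evR_ract: "\<alpha> \<in> S \<Longrightarrow> b \<in> B \<Longrightarrow> t \<in> carrier TT \<Longrightarrow> evR \<alpha> (ract TS t b) = evR \<alpha> t \<otimes> b"
proof -
  assume *: "\<alpha> \<in> S" "b \<in> B" "t \<in> carrier TT"
  have "evR \<alpha> (ract TS t b) = ev (\<lambda>x y. x \<otimes> \<alpha> (y \<otimes> b)) t"
    using * by (intro ev_ract(2) bal_R) auto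
  also have "\<dots> = ev (\<lambda>x y. (x \<otimes> \<alpha> y) \<otimes> b) t"
    using ev_ract(1)[OF bal_R, of \<alpha> b t] * by (intro ev_cong) (auto simp: EndD m_assoc)
  also have "\<dots> = evR \<alpha> t \<otimes> b"
    using * by (intro ev_comp[symmetric] bal_R) (auto simp: l_distr)
  finally show ?thesis .
qed

text \<open>Expand \<open>t\<close> by \<open>tensor_pb\<close>. For \<open>t\<close> in
  \<open>T\<close> the coefficients \<open>evR (fst p) t\<close> lie in
  \<open>R \<subseteq> B\<close>, so left \<open>B\<close>-linearity of \<alpha> lets them out. The
  pairing on the first factor thus becomes a combination of pairings on the second, which is what
  the antipode has to achieve.\<close>

lemma evL_evR_pb:
  assumes "\<alpha> \<in> S" "t \<in> T_set A B"
  shows "evL \<alpha> t = asum (\<lambda>p. evR (fst p) t \<otimes> evL \<alpha> (snd p)) pb"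
proof -
  have "evL \<alpha> t = evL \<alpha> (list_sum TT (map (\<lambda>p. lact TS (evR (fst p) t) (snd p)) pb))"
    using tensor_pb[OF T_setD(1)] assms by simp
  also have "\<dots> = asum (\<lambda>p. evL \<alpha> (lact TS (evR (fst p) t) (snd p))) pb"
    using assms by (intro ev_list_sum bal_L lact_closed_TS) (auto intro: Z_closed Z_in_B evR_central pb_mem simp del: Z_closed)
  also have "\<dots> = asum (\<lambda>p. evR (fst p) t \<otimes> evL \<alpha> (snd p)) pb"
    using assms by (intro list_sum_cong evL_lact) (auto intro: Z_closed Z_in_B evR_central pb_mem simp del: Z_closed)
  finally show ?thesis .
qed

lemma evR_evL_qb:
  assumes "\<alpha> \<in> S" "t \<in> T_set A B"
  shows "evR \<alpha> t = asum (\<lambda>p. evR \<alpha> (snd p) \<otimes> evL (fst p) t) qb"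
proof -
  have "evR \<alpha> t = evR \<alpha> (list_sum TT (map (\<lambda>p. ract TS (snd p) (evL (fst p) t)) qb))"
    using tensor_qb[OF T_setD(1)] assms by simp
  also have "\<dots> = asum (\<lambda>p. evR \<alpha> (ract TS (snd p) (evL (fst p) t))) qb"
    using assms by (intro ev_list_sum bal_R ract_closed_TS) (auto intro: Z_closed Z_in_B evL_central qb_mem simp del: Z_closed)
  also have "\<dots> = asum (\<lambda>p. evR \<alpha> (snd p) \<otimes> evL (fst p) t) qb"
    using assms by (intro list_sum_cong evR_ract) (auto intro: Z_closed Z_in_B evL_central qb_mem simp del: Z_closed)
  finally show ?thesis .
qed

text \<open>Coefficients from \<open>R\<close> commute with \<open>B\<close>, so they do not disturb
  \<open>B\<close>-linearity on either side.\<close>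

lemma
  assumes "\<And>p. p \<in> set ps \<Longrightarrow> f p \<in> S" "\<And>p. p \<in> set ps \<Longrightarrow> c p \<in> Z"
  shows Z_comb_right: "(\<lambda>a\<in>carrier A. asum (\<lambda>p. f p a \<otimes> c p) ps) \<in> S"
    and Z_comb_left: "(\<lambda>a\<in>carrier A. asum (\<lambda>p. c p \<otimes> f p a) ps) \<in> S"
proof -
  have c: "c p \<in> carrier A" "c p \<in> B" if "p \<in> set ps" for p using assms(2)[OF that] by auto
  have cb: "c p \<otimes> b = b \<otimes> c p" if "p \<in> set ps" "b \<in> B" for p b
    using Z_B_comm[OF assms(2)[OF that(1)] that(2)] by simp
  have cb': "c p \<otimes> (b \<otimes> x) = b \<otimes> (c p \<otimes> x)" if "p \<in> set ps" "b \<in> B" "x \<in> carrier A" for p b x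
    using that c by (simp add: m_assoc[symmetric] cb)
  show "(\<lambda>a\<in>carrier A. asum (\<lambda>p. f p a \<otimes> c p) ps) \<in> S"
    using assms(1) c
    by (intro EndI) (auto simp: EndD asum_add[symmetric] asum_r_distr asum_l_distr l_distr m_assoc cb
        intro!: list_sum_cong)
  show "(\<lambda>a\<in>carrier A. asum (\<lambda>p. c p \<otimes> f p a) ps) \<in> S"
    using assms(1) c
    by (intro EndI) (auto simp: EndD asum_add[symmetric] asum_r_distr asum_l_distr r_distr m_assoc cb'
        intro!: list_sum_cong)
qed

text \<open>The only possible formula: by \<open>End_pb\<close> the coefficients of the image of
  \<alpha> are its values under \<open>evR\<close> at the \<open>snd p\<close>, and these must equal
  \<open>evL \<alpha> (snd p)\<close>.\<close>

definition antipode where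
  "antipode \<alpha> = (\<lambda>a\<in>carrier A. asum (\<lambda>p. fst p a \<otimes> evL \<alpha> (snd p)) pb)"

lemma antipode_closed: "\<alpha> \<in> S \<Longrightarrow> antipode \<alpha> \<in> S"
  unfolding antipode_def by (intro Z_comb_right evL_central pb_mem(1,2))

lemma evR_antipode:
  assumes "\<alpha> \<in> S" "t \<in> T_set A B"
  shows "evR (antipode \<alpha>) t = evL \<alpha> t"
proof -
  have c: "evL \<alpha> (snd p) \<in> carrier A" if "p \<in> set pb" for p
    using evL_central[OF assms(1) pb_mem(2)[OF that]] by simp
  have b: "bal (\<lambda>x y. (x \<otimes> fst p y) \<otimes> evL \<alpha> (snd p))" if "p \<in> set pb" for p
    using balD[OF bal_R[OF pb_mem(1)[OF that]]] c[OF that]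
    by (intro balI) (simp_all add: l_distr)
  have "evR (antipode \<alpha>) t = ev (\<lambda>x y. asum (\<lambda>p. (x \<otimes> fst p y) \<otimes> evL \<alpha> (snd p)) pb) t"
    using assms c T_setD(1)
    by (intro ev_cong bal_R antipode_closed)
      (auto simp: antipode_def asum_r_distr EndD pb_mem m_assoc intro!: list_sum_cong)
  also have "\<dots> = asum (\<lambda>p. ev (\<lambda>x y. (x \<otimes> fst p y) \<otimes> evL \<alpha> (snd p)) t) pb"
    using b T_setD(1)[OF assms(2)] by (rule ev_sum(2))
  also have "\<dots> = asum (\<lambda>p. evR (fst p) t \<otimes> evL \<alpha> (snd p)) pb"
    using c T_setD(1)[OF assms(2)]
    by (intro list_sum_cong ev_comp[symmetric] bal_R) (auto simp: l_distr pb_mem)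
  also have "\<dots> = evL \<alpha> t" using evL_evR_pb[OF assms] by simp
  finally show ?thesis .
qed

text \<open>Gives surjectivity of the antipode. The preimage is built from the left quasibasis in
  the way \<open>antipode\<close> is built from the right one, and \<open>evR_evL_qb\<close> takes
  the place of \<open>evL_evR_pb\<close>.\<close>

lemma ex_evL_eq_evR:
  assumes "\<beta> \<in> S"
  shows "\<exists>\<alpha>\<in>S. \<forall>t\<in>T_set A B. evL \<alpha> t = evR \<beta> t"
proof (intro bexI ballI)
  define \<alpha> where "\<alpha> = (\<lambda>a\<in>carrier A. asum (\<lambda>p. evR \<beta> (snd p) \<otimes> fst p a) qb)"
  show \<alpha>: "\<alpha> \<in> S"
    unfolding \<alpha>_def using assms by (intro Z_comb_left evR_central qb_mem(1,2))
  have \<alpha>_apply: "\<alpha> a = asum (\<lambda>p. evR \<beta> (snd p) \<otimes> fst p a) qb" if "a \<in> carrier A" for a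
    using that by (simp add: \<alpha>_def)
  fix t assume t: "t \<in> T_set A B"
  have c: "evR \<beta> (snd p) \<in> carrier A" if "p \<in> set qb" for p
    using evR_central[OF assms qb_mem(2)[OF that]] by simp
  have b: "bal (\<lambda>x y. evR \<beta> (snd p) \<otimes> (fst p x \<otimes> y))" if "p \<in> set qb" for p
    using balD[OF bal_L[OF qb_mem(1)[OF that]]] c[OF that]
    by (intro balI) (simp_all add: r_distr)
  have "evL \<alpha> t = ev (\<lambda>x y. asum (\<lambda>p. evR \<beta> (snd p) \<otimes> (fst p x \<otimes> y)) qb) t"
    using \<alpha> c T_setD(1)[OF t]
    by (intro ev_cong bal_L)
      (auto simp: \<alpha>_apply asum_l_distr EndD qb_mem m_assoc intro!: list_sum_cong)
  also have "\<dots> = asum (\<lambda>p. ev (\<lambda>x y. evR \<beta> (snd p) \<otimes> (fst p x \<otimes> y)) t) qb"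
    using b T_setD(1)[OF t] by (rule ev_sum(2))
  also have "\<dots> = asum (\<lambda>p. evR \<beta> (snd p) \<otimes> evL (fst p) t) qb"
    using c T_setD(1)[OF t]
    by (intro list_sum_cong ev_comp[symmetric] bal_L) (auto simp: r_distr qb_mem)
  also have "\<dots> = evR \<beta> t" using evR_evL_qb[OF assms t] by simp
  finally show "evL \<alpha> t = evR \<beta> t" .
qed

text \<open>The definition ranges over all representing lists of \<open>t\<close>; both sums are
  independent of the list, and some list exists.\<close>

lemma antipode_condition_iff:
  assumes "\<tau> \<in> S \<rightarrow> S"
  shows "antipode_condition A B \<tau> \<longleftrightarrow> (\<forall>\<alpha>\<in>S. \<forall>t\<in>T_set A B. evL \<alpha> t = evR (\<tau> \<alpha>) t)"
proof -
  have "(\<forall>xs. represents B (reg_bimod A) (reg_bimod A) xs t \<longrightarrow>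
      asum (\<lambda>(x, y). \<alpha> x \<otimes> y) xs = asum (\<lambda>(x, y). x \<otimes> \<tau> \<alpha> y) xs) \<longleftrightarrow> evL \<alpha> t = evR (\<tau> \<alpha>) t"
    if "\<alpha> \<in> S" "t \<in> T_set A B" for \<alpha> t
  proof -
    have \<tau>: "\<tau> \<alpha> \<in> S" using assms that by auto
    have 1: "asum (\<lambda>(x, y). \<alpha> x \<otimes> y) xs = evL \<alpha> t" "asum (\<lambda>(x, y). x \<otimes> \<tau> \<alpha> y) xs = evR (\<tau> \<alpha>) t"
      if "represents B (reg_bimod A) (reg_bimod A) xs t" for xs
      using that ev_rep[OF bal_L[OF \<open>\<alpha> \<in> _\<close>], of xs] ev_rep[OF bal_R[OF \<tau>], of xs]
      by (auto simp: represents_def)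
    obtain xs where "represents B (reg_bimod A) (reg_bimod A) xs t"
      using ex_rep_A[OF T_setD(1)[OF \<open>t \<in> _\<close>]] by (metis represents_def reg_bimod_simps(1))
    with 1 show ?thesis by metis
  qed
  then show ?thesis unfolding antipode_condition_def by meson
qed

text \<open>Uniqueness is stated among extensional functions because the condition says nothing
  about values outside \<open>S\<close>. There it is nondegeneracy of \<open>evR\<close>.\<close>

lemma antipode_unique:
  "\<exists>!\<tau>. \<tau> \<in> S \<rightarrow>\<^sub>E S \<and> antipode_condition A B \<tau>"
proof (rule ex1I[of _ "\<lambda>\<alpha>\<in>S. antipode \<alpha>"])
  show "(\<lambda>\<alpha>\<in>S. antipode \<alpha>) \<in> S \<rightarrow>\<^sub>E S \<and>
      antipode_condition A B (\<lambda>\<alpha>\<in>S. antipode \<alpha>)"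
    by (subst antipode_condition_iff) (auto simp: antipode_closed evR_antipode)
  fix \<tau> assume \<tau>: "\<tau> \<in> S \<rightarrow>\<^sub>E S \<and> antipode_condition A B \<tau>"
  then have "\<tau> \<in> S \<rightarrow> S" by (auto simp: PiE_iff)
  with \<tau> have "\<forall>\<alpha>\<in>S. \<forall>t\<in>T_set A B. evL \<alpha> t = evR (\<tau> \<alpha>) t"
    using antipode_condition_iff by blast
  moreover have "\<tau> \<alpha> \<in> S" if "\<alpha> \<in> S" for \<alpha> using \<tau> that by (auto simp: PiE_iff)
  ultimately have "\<tau> \<alpha> = antipode \<alpha>" if "\<alpha> \<in> S" for \<alpha>
    using that by (intro End_eq_evR) (auto simp: antipode_closed evR_antipode)
  then show "\<tau> = (\<lambda>\<alpha>\<in>S. antipode \<alpha>)"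
    using \<tau> by (intro extensionalityI[of _ S]) (auto simp: PiE_def)
qed

end

section \<open>The bialgebroid structures\<close>

context irreducible
begin

text \<open>Covers the left, right and mixed bimodule records on \<open>S\<close> at once. The
  actions are prescribed only for arguments in \<open>R\<close> and \<open>S\<close>, since the
  records need not agree elsewhere.\<close>

definition End_bimod :: "('a, 'a \<Rightarrow> 'a, 'a) bimod \<Rightarrow> bool"
  where "End_bimod C \<longleftrightarrow> carrier C = S \<and> monoid.mult C = add E \<and> \<one>\<^bsub>C\<^esub> = \<zero>\<^bsub>E\<^esub> \<and>
    (\<forall>r\<in>Z. \<forall>\<alpha>\<in>S. lact C r \<alpha> = (\<lambda>x\<in>carrier A. r \<otimes> \<alpha> x)) \<and>
    (\<forall>r\<in>Z. \<forall>\<alpha>\<in>S. ract C \<alpha> r = (\<lambda>x\<in>carrier A. \<alpha> x \<otimes> r))"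

lemma End_bimodD:
  assumes "End_bimod C"
  shows "carrier C = S" "monoid.mult C = add E" "\<one>\<^bsub>C\<^esub> = \<zero>\<^bsub>E\<^esub>"
    and "r \<in> Z \<Longrightarrow> \<alpha> \<in> S \<Longrightarrow> lact C r \<alpha> = (\<lambda>x\<in>carrier A. r \<otimes> \<alpha> x)"
    and "r \<in> Z \<Longrightarrow> \<alpha> \<in> S \<Longrightarrow> ract C \<alpha> r = (\<lambda>x\<in>carrier A. \<alpha> x \<otimes> r)"
  using assms by (simp_all add: End_bimod_def)

lemma scale_closed:
  assumes "r \<in> Z" "\<alpha> \<in> S"
  shows "(\<lambda>x\<in>carrier A. r \<otimes> \<alpha> x) \<in> S" "(\<lambda>x\<in>carrier A. \<alpha> x \<otimes> r) \<in> S"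
proof -
  have "r \<otimes> (b \<otimes> x) = b \<otimes> (r \<otimes> x)" if "b \<in> B" "x \<in> carrier A" for b x
    using that assms Z_B_comm[of r b] by (simp add: m_assoc[symmetric])
  then show "(\<lambda>x\<in>carrier A. r \<otimes> \<alpha> x) \<in> S" "(\<lambda>x\<in>carrier A. \<alpha> x \<otimes> r) \<in> S"
    using assms Z_B_comm[of r]
    by (intro EndI; simp add: EndD r_distr l_distr m_assoc)+
qed

lemma End_bimod_act_closed:
  assumes "End_bimod C" "r \<in> Z" "\<alpha> \<in> S"
  shows "lact C r \<alpha> \<in> S" "ract C \<alpha> r \<in> S"
  using assms by (simp_all add: End_bimodD scale_closed)

lemma End_bimod_comm_group: "End_bimod C \<Longrightarrow> comm_group C"
  by (rule E.comm_group_if_add_eq) (simp_all add: End_bimodD)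

lemma End_bimod_list_sum: "End_bimod C \<Longrightarrow> list_sum C = list_sum (add_monoid E)"
  by (simp add: list_sum_def fun_eq_iff End_bimodD)

lemma End_bimod_tensor_pair: "End_bimod C \<Longrightarrow> End_bimod C' \<Longrightarrow> tensor_pair Z C C'"
  by (intro tensor_pair.intro tensor_pair_axioms.intro End_bimod_comm_group)
    (simp_all add: End_bimodD(1) End_bimod_act_closed)

lemma End_bimod_tensor_triple:
  "End_bimod M \<Longrightarrow> End_bimod N \<Longrightarrow> End_bimod P \<Longrightarrow> tensor_triple Z Z M N P"
  by (intro tensor_triple.intro tensor_triple_axioms.intro End_bimod_comm_group)
    (simp_all add: End_bimodD(1) End_bimod_act_closed)

text \<open>\<open>End_qb\<close> read inside \<open>S\<close>: its coefficients lie in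
  \<open>R\<close>, so they act through the bimodule structure.\<close>

lemma End_eq_comb:
  assumes C: "End_bimod C" and \<beta>: "\<beta> \<in> S"
  shows "\<beta> = list_sum C (map (\<lambda>p. lact C (evL \<beta> (snd p)) (fst p)) qb)"
proof (rule End_eqI[OF \<beta>])
  have c: "lact C (evL \<beta> (snd p)) (fst p) \<in> S" if "p \<in> set qb" for p
    using that C \<beta> by (intro End_bimod_act_closed evL_central qb_mem(1,2))
  then show "list_sum C (map (\<lambda>p. lact C (evL \<beta> (snd p)) (fst p)) qb) \<in> S"
    using C by (simp add: End_bimod_list_sum End_list_sum_closed)
  fix x assume x: "x \<in> carrier A"
  have "list_sum C (map (\<lambda>p. lact C (evL \<beta> (snd p)) (fst p)) qb) x =
      asum (\<lambda>p. lact C (evL \<beta> (snd p)) (fst p) x) qb"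
    using c x C by (simp add: End_bimod_list_sum End_list_sum)
  also have "\<dots> = asum (\<lambda>p. evL \<beta> (snd p) \<otimes> fst p x) qb"
    using x \<beta> C by (intro list_sum_cong) (simp add: End_bimodD evL_central qb_mem)
  finally show "\<beta> x = list_sum C (map (\<lambda>p. lact C (evL \<beta> (snd p)) (fst p)) qb) x"
    using End_qb[OF \<beta> x] by simp
qed

text \<open>The element \<open>\<alpha> \<otimes> \<beta>\<close> of \<open>S \<otimes>\<^sub>R S\<close> equals \<open>\<Sum>\<^sub>i \<alpha>(-) \<beta>(t\<^sub>i\<^sup>1) t\<^sub>i\<^sup>2 \<otimes> \<beta>\<^sub>i\<close>.
  Hence a sum of tensors in \<open>S \<otimes>\<^sub>R S\<close> is determined by the map \<open>x \<otimes> y \<mapsto> \<Sum> \<alpha>(x) \<beta>(y)\<close>.\<close>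

lemma balanced_expand:
  assumes C: "End_bimod C" "End_bimod C'" and G: "comm_group G" and \<theta>: "balanced Z C C' G \<theta>"
    and \<alpha>: "\<alpha> \<in> S" and \<beta>: "\<beta> \<in> S"
  shows "\<theta> \<alpha> \<beta> = list_sum G (map (\<lambda>p. \<theta> (\<lambda>x\<in>carrier A. \<alpha> x \<otimes> evL \<beta> (snd p)) (fst p)) qb)"
proof -
  interpret G: comm_group G by fact
  interpret C': comm_group C' using C(2) by (rule End_bimod_comm_group)
  note \<theta>D = balancedD[OF \<theta>, unfolded End_bimodD(1)[OF C(1)] End_bimodD(1)[OF C(2)]]
  have c: "evL \<beta> (snd p) \<in> Z" "fst p \<in> S" if "p \<in> set qb" for p
    using that \<beta> by (simp_all add: evL_central qb_mem)
  have "\<theta> \<alpha> \<beta> = \<theta> \<alpha> (list_sum C' (map (\<lambda>p. lact C' (evL \<beta> (snd p)) (fst p)) qb))"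
    using End_eq_comb[OF C(2) \<beta>] by simp
  also have "\<dots> = list_sum G (map (\<lambda>p. \<theta> \<alpha> (lact C' (evL \<beta> (snd p)) (fst p))) qb)"
    using \<theta>D \<alpha> c C End_bimod_act_closed[OF C(2)]
    by (intro C'.hom_imp_list_sum G.is_group) (auto simp: End_bimodD(1)[OF C(2)])
  also have "\<dots> = list_sum G (map (\<lambda>p. \<theta> (ract C \<alpha> (evL \<beta> (snd p))) (fst p)) qb)"
    using \<theta>D(4) \<alpha> c by (intro list_sum_cong) simp
  also have "\<dots> = list_sum G (map (\<lambda>p. \<theta> (\<lambda>x\<in>carrier A. \<alpha> x \<otimes> evL \<beta> (snd p)) (fst p)) qb)"
    using \<alpha> c by (intro list_sum_cong) (simp add: End_bimodD(5)[OF C(1)])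
  finally show ?thesis .
qed

text \<open>After \<open>balanced_expand\<close> the second arguments are the fixed
  \<open>fst p\<close>, and the first ones add up to \<open>W zs p\<close>. The value of
  \<open>W zs p\<close> at \<open>x\<close> is obtained by applying
  \<open>y \<otimes> y' \<mapsto> (\<Sum> \<alpha>(x) \<beta>(y)) y'\<close> to
  \<open>snd p\<close>, so it depends only on the bilinear map of the list.\<close>

lemma balanced_determined:
  assumes C: "End_bimod C" "End_bimod C'" and G: "comm_group G" and \<theta>: "balanced Z C C' G \<theta>"
    and xs: "set xs \<subseteq> S \<times> S" and ys: "set ys \<subseteq> S \<times> S"
    and eq: "\<And>x y. x \<in> carrier A \<Longrightarrow> y \<in> carrier A \<Longrightarrow>
      asum (\<lambda>z. fst z x \<otimes> snd z y) xs = asum (\<lambda>z. fst z x \<otimes> snd z y) ys"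
  shows "list_sum G (map (\<lambda>z. \<theta> (fst z) (snd z)) xs) = list_sum G (map (\<lambda>z. \<theta> (fst z) (snd z)) ys)"
proof -
  interpret G: comm_group G by fact
  interpret C: comm_group C using C(1) by (rule End_bimod_comm_group)
  note \<theta>D = balancedD[OF \<theta>, unfolded End_bimodD(1)[OF C(1)] End_bimodD(1)[OF C(2)]]
  define f where "f z p = (\<lambda>x\<in>carrier A. fst z x \<otimes> evL (snd z) (snd p))"
    for z :: "('a \<Rightarrow> 'a) \<times> ('a \<Rightarrow> 'a)" and p :: "('a \<Rightarrow> 'a) \<times> ('a \<times> 'a \<Rightarrow>\<^sub>0 int) set"
  define W where "W zs p = list_sum C (map (\<lambda>z. f z p) zs)" for zs p
  have fc: "f z p \<in> S" if "set zs \<subseteq> S \<times> S" "z \<in> set zs" "p \<in> set qb" for zs z p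
    unfolding f_def using that by (intro scale_closed(2) evL_central qb_mem(2)) auto
  have sum: "list_sum G (map (\<lambda>z. \<theta> (fst z) (snd z)) zs) = list_sum G (map (\<lambda>p. \<theta> (W zs p) (fst p)) qb)"
    if zs: "set zs \<subseteq> S \<times> S" for zs
  proof -
    have "list_sum G (map (\<lambda>z. \<theta> (fst z) (snd z)) zs) =
        list_sum G (map (\<lambda>z. list_sum G (map (\<lambda>p. \<theta> (f z p) (fst p)) qb)) zs)"
      unfolding f_def using zs by (intro list_sum_cong balanced_expand[OF C G \<theta>]) auto
    also have "\<dots> = list_sum G (map (\<lambda>p. list_sum G (map (\<lambda>z. \<theta> (f z p) (fst p)) zs)) qb)"
      using fc[OF zs] qb_mem by (intro G.list_sum_swap \<theta>D(1)) auto
    also have "\<dots> = list_sum G (map (\<lambda>p. \<theta> (W zs p) (fst p)) qb)"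
    proof (rule list_sum_cong)
      fix p assume p: "p \<in> set qb"
      show "list_sum G (map (\<lambda>z. \<theta> (f z p) (fst p)) zs) = \<theta> (W zs p) (fst p)"
        unfolding W_def using fc[OF zs] qb_mem(1)[OF p] p \<theta>D
        by (intro C.hom_imp_list_sum[symmetric, where h = "\<lambda>\<alpha>. \<theta> \<alpha> (fst p)"] G.is_group)
          (auto simp: End_bimodD(1)[OF C(1)])
    qed
    finally show ?thesis .
  qed
  have "W xs p = W ys p" if p: "p \<in> set qb" for p
  proof (rule End_eqI)
    have W: "W zs p \<in> S" "W zs p x = ev (\<lambda>y y'. asum (\<lambda>z. fst z x \<otimes> snd z y) zs \<otimes> y') (snd p)"
      if zs: "set zs \<subseteq> S \<times> S" and x: "x \<in> carrier A" for zs x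
    proof -
      show "W zs p \<in> S" unfolding W_def End_bimod_list_sum[OF C(1)]
        using fc[OF zs _ p] by (rule End_list_sum_closed)
      have zs': "fst z \<in> S" "snd z \<in> S" if "z \<in> set zs" for z using zs that by auto
      have "W zs p x = asum (\<lambda>z. f z p x) zs"
        unfolding W_def End_bimod_list_sum[OF C(1)] using fc[OF zs _ p] x by (rule End_list_sum)
      also have "\<dots> = asum (\<lambda>z. ev (\<lambda>y y'. fst z x \<otimes> (snd z y \<otimes> y')) (snd p)) zs"
      proof (rule list_sum_cong)
        fix z assume z: "z \<in> set zs"
        then show "f z p x = ev (\<lambda>y y'. fst z x \<otimes> (snd z y \<otimes> y')) (snd p)"
          unfolding f_def using x zs' qb_mem(3)[OF p]
          by (simp, intro ev_comp bal_L) (auto simp: EndD r_distr)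
      qed
      also have "\<dots> = ev (\<lambda>y y'. asum (\<lambda>z. fst z x \<otimes> (snd z y \<otimes> y')) zs) (snd p)"
        using x zs' qb_mem(3)[OF p]
        by (intro ev_sum(2)[symmetric] balI) (auto simp: EndD r_distr l_distr m_assoc)
      also have "\<dots> = ev (\<lambda>y y'. asum (\<lambda>z. fst z x \<otimes> snd z y) zs \<otimes> y') (snd p)"
        using x zs' qb_mem(3)[OF p]
        by (intro ev_cong ev_sum(1) balI) (auto simp: EndD r_distr l_distr m_assoc asum_l_distr intro!: list_sum_cong)
      finally show "W zs p x = \<dots>" .
    qed
    show "W xs p \<in> S" "W ys p \<in> S" using W(1) xs ys by blast+
    fix x assume x: "x \<in> carrier A"
    \<comment> \<open>\<open>ev_sum\<close> provides this with \<open>y'\<close> inside the sum;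
      \<open>balanced\<close> tests arguments in \<open>carrier A\<close> only, where both forms
      agree.\<close>
    have "bal (\<lambda>y y'. asum (\<lambda>z. fst z x \<otimes> snd z y) xs \<otimes> y')"
    proof -
      have xs': "fst z \<in> S" "snd z \<in> S" if "z \<in> set xs" for z using xs that by auto
      then have "bal (\<lambda>y y'. asum (\<lambda>z. fst z x \<otimes> (snd z y \<otimes> y')) xs)"
        using x qb_mem(3)[OF p]
        by (intro ev_sum(1)[where t = "snd p"] balI) (auto simp: EndD r_distr l_distr m_assoc)
      moreover have "asum (\<lambda>z. fst z x \<otimes> (snd z y \<otimes> y')) xs = asum (\<lambda>z. fst z x \<otimes> snd z y) xs \<otimes> y'"
        if "y \<in> carrier A" "y' \<in> carrier A" for y y'
        using that x xs' by (auto simp: EndD m_assoc asum_l_distr intro!: list_sum_cong)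
      ultimately show ?thesis by (simp add: balanced_def)
    qed
    then show "W xs p x = W ys p x"
      unfolding W(2)[OF xs x] W(2)[OF ys x]
      using eq x qb_mem(3)[OF p] by (intro ev_cong) simp_all
  qed
  then have "list_sum G (map (\<lambda>p. \<theta> (W xs p) (fst p)) qb) = list_sum G (map (\<lambda>p. \<theta> (W ys p) (fst p)) qb)"
    by (intro list_sum_cong) simp
  then show ?thesis by (simp add: sum xs ys)
qed

text \<open>Expanding the third factor moves its coefficients into the second, as recorded in
  \<open>g\<close>. For each \<open>p\<close> there remains a balanced map of two arguments, to
  which \<open>balanced_determined\<close> applies.\<close>

lemma balanced3_determined:
  assumes C: "End_bimod M" "End_bimod N" "End_bimod P" and G: "comm_group G"
    and \<theta>: "balanced3 Z Z M N P G \<theta>"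
    and xs: "set xs \<subseteq> S \<times> S \<times> S" and ys: "set ys \<subseteq> S \<times> S \<times> S"
    and eq: "\<And>u v w. u \<in> carrier A \<Longrightarrow> v \<in> carrier A \<Longrightarrow> w \<in> carrier A \<Longrightarrow>
      asum (\<lambda>(x, y, z). x u \<otimes> y v \<otimes> z w) xs = asum (\<lambda>(x, y, z). x u \<otimes> y v \<otimes> z w) ys"
  shows "list_sum G (map (\<lambda>(x, y, z). \<theta> x y z) xs) = list_sum G (map (\<lambda>(x, y, z). \<theta> x y z) ys)"
proof -
  interpret G: comm_group G by fact
  have \<theta>1: "balanced Z M N G (\<lambda>x y. \<theta> x y z)" if "z \<in> S" for z
    using \<theta> that by (simp add: balanced3_def End_bimodD(1)[OF C(3)])
  have \<theta>2: "balanced Z N P G (\<lambda>y z. \<theta> x y z)" if "x \<in> S" for x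
    using \<theta> that by (simp add: balanced3_def End_bimodD(1)[OF C(1)])
  define g where "g p z = (fst z, \<lambda>v\<in>carrier A. fst (snd z) v \<otimes> evL (snd (snd z)) (snd p))"
    for z :: "('a \<Rightarrow> 'a) \<times> ('a \<Rightarrow> 'a) \<times> ('a \<Rightarrow> 'a)" and p :: "('a \<Rightarrow> 'a) \<times> ('a \<times> 'a \<Rightarrow>\<^sub>0 int) set"
  have gc: "fst (g p z) \<in> S" "snd (g p z) \<in> S"
    if "set zs \<subseteq> S \<times> S \<times> S" "z \<in> set zs" "p \<in> set qb" for zs z p
    unfolding g_def using that by (auto intro!: scale_closed(2) evL_central qb_mem(2))
  have sum: "list_sum G (map (\<lambda>(x, y, z). \<theta> x y z) zs) =
      list_sum G (map (\<lambda>p. list_sum G (map (\<lambda>w. \<theta> (fst w) (snd w) (fst p)) (map (g p) zs))) qb)"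
    if zs: "set zs \<subseteq> S \<times> S \<times> S" for zs
  proof -
    have "list_sum G (map (\<lambda>(x, y, z). \<theta> x y z) zs) =
        list_sum G (map (\<lambda>z. list_sum G (map (\<lambda>p. \<theta> (fst (g p z)) (snd (g p z)) (fst p)) qb)) zs)"
    proof (rule list_sum_cong)
      fix z assume z: "z \<in> set zs"
      then have "fst z \<in> S" "fst (snd z) \<in> S" "snd (snd z) \<in> S" using zs by auto
      from balanced_expand[OF C(2,3) G \<theta>2[OF this(1)] this(2,3)]
      show "(case z of (x, y, z) \<Rightarrow> \<theta> x y z) =
          list_sum G (map (\<lambda>p. \<theta> (fst (g p z)) (snd (g p z)) (fst p)) qb)"
        by (simp add: g_def case_prod_beta)
    qed
    also have "\<dots> = list_sum G (map (\<lambda>p. list_sum G (map (\<lambda>z. \<theta> (fst (g p z)) (snd (g p z)) (fst p)) zs)) qb)"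
      using gc[OF zs] qb_mem(1) balancedD(1)[OF \<theta>1, unfolded End_bimodD(1)[OF C(1)] End_bimodD(1)[OF C(2)]]
      by (intro G.list_sum_swap) blast
    finally show ?thesis by (simp add: comp_def)
  qed
  have "list_sum G (map (\<lambda>w. \<theta> (fst w) (snd w) (fst p)) (map (g p) xs)) =
      list_sum G (map (\<lambda>w. \<theta> (fst w) (snd w) (fst p)) (map (g p) ys))" if p: "p \<in> set qb" for p
  proof (rule balanced_determined[OF C(1,2) G \<theta>1[OF qb_mem(1)[OF p]]])
    show "set (map (g p) xs) \<subseteq> S \<times> S" "set (map (g p) ys) \<subseteq> S \<times> S"
      using gc[OF xs _ p] gc[OF ys _ p] by (simp_all add: image_subset_iff mem_Times_iff)
    fix u v assume uv: "u \<in> carrier A" "v \<in> carrier A"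
    have *: "bal (\<lambda>w w'. asum (\<lambda>(x, y, z). x u \<otimes> y v \<otimes> z w) zs \<otimes> w')"
      "asum (\<lambda>z. fst z u \<otimes> snd z v) (map (g p) zs) =
        ev (\<lambda>w w'. asum (\<lambda>(x, y, z). x u \<otimes> y v \<otimes> z w) zs \<otimes> w') (snd p)"
      if zs: "set zs \<subseteq> S \<times> S \<times> S" for zs
    proof -
      let ?\<phi> = "\<lambda>z w w'. (fst z u \<otimes> fst (snd z) v) \<otimes> (snd (snd z) w \<otimes> w')"
      have zs': "fst z \<in> S" "fst (snd z) \<in> S" "snd (snd z) \<in> S" if "z \<in> set zs" for z
        using zs that by auto
      have b: "bal (?\<phi> z)" if "z \<in> set zs" for z
        using uv zs'[OF that] by (intro balI) (auto simp: EndD r_distr l_distr m_assoc)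
      note s = ev_sum[of zs ?\<phi>, OF b qb_mem(3)[OF p]]
      have eq: "asum (\<lambda>z. ?\<phi> z w w') zs = asum (\<lambda>(x, y, z). x u \<otimes> y v \<otimes> z w) zs \<otimes> w'"
        if "w \<in> carrier A" "w' \<in> carrier A" for w w'
        using that uv zs' by (subst asum_l_distr) (auto simp: EndD m_assoc intro!: list_sum_cong)
      show "bal (\<lambda>w w'. asum (\<lambda>(x, y, z). x u \<otimes> y v \<otimes> z w) zs \<otimes> w')"
        using s(1) eq by (simp add: balanced_def)
      have "asum (\<lambda>z. fst z u \<otimes> snd z v) (map (g p) zs) = asum (\<lambda>z. ev (?\<phi> z) (snd p)) zs"
        unfolding map_map comp_def
      proof (rule list_sum_cong)
        fix z assume z: "z \<in> set zs"
        have c: "evL (snd (snd z)) (snd p) \<in> carrier A"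
          using zs'(3)[OF z] qb_mem(2)[OF p] by (simp add: evL_central)
        have "fst (g p z) u \<otimes> snd (g p z) v = (fst z u \<otimes> fst (snd z) v) \<otimes> evL (snd (snd z)) (snd p)"
          using uv zs'[OF z] c by (simp add: g_def EndD m_assoc)
        also have "\<dots> = ev (?\<phi> z) (snd p)"
          using uv zs'[OF z] qb_mem(3)[OF p] by (intro ev_comp bal_L) (auto simp: EndD r_distr)
        finally show "fst (g p z) u \<otimes> snd (g p z) v = ev (?\<phi> z) (snd p)" .
      qed
      also have "\<dots> = ev (\<lambda>w w'. asum (\<lambda>z. ?\<phi> z w w') zs) (snd p)" using s(2) by simp
      also have "\<dots> = ev (\<lambda>w w'. asum (\<lambda>(x, y, z). x u \<otimes> y v \<otimes> z w) zs \<otimes> w') (snd p)"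
        using s(1) qb_mem(3)[OF p] eq by (rule ev_cong)
      finally show "asum (\<lambda>z. fst z u \<otimes> snd z v) (map (g p) zs) = \<dots>" .
    qed
    show "asum (\<lambda>z. fst z u \<otimes> snd z v) (map (g p) xs) = asum (\<lambda>z. fst z u \<otimes> snd z v) (map (g p) ys)"
      unfolding *(2)[OF xs] *(2)[OF ys]
      using eq uv qb_mem(3)[OF p] by (intro ev_cong *(1)[OF xs]) simp_all
  qed
  then show ?thesis unfolding sum[OF xs] sum[OF ys] by (intro list_sum_cong)
qed

text \<open>\<open>balanced_determined\<close> for the map to pure tensors. It expresses injectivity
  of \<open>S \<otimes>\<^sub>R S \<rightarrow> Hom(A \<otimes>\<^sub>B A, A)\<close>.\<close>

lemma End_tensor_eqI:
  assumes C: "End_bimod C" "End_bimod C'"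
    and xs: "set xs \<subseteq> S \<times> S" and ys: "set ys \<subseteq> S \<times> S"
    and eq: "\<And>x y. x \<in> carrier A \<Longrightarrow> y \<in> carrier A \<Longrightarrow>
      asum (\<lambda>z. fst z x \<otimes> snd z y) xs = asum (\<lambda>z. fst z x \<otimes> snd z y) ys"
  shows "tensor_sum Z C C' xs = tensor_sum Z C C' ys"
proof -
  interpret CC: tensor_pair Z C C' using C by (rule End_bimod_tensor_pair)
  note cc = End_bimodD(1)[OF C(1)] End_bimodD(1)[OF C(2)]
  show ?thesis
    using balanced_determined[OF C CC.comm_group_TG CC.pure_balanced xs ys eq]
      CC.ts_list_sum[of xs] CC.ts_list_sum[of ys] xs ys
    by (simp add: cc case_prod_unfold)
qed

text \<open>The property of representing \<open>\<Delta>(\<alpha>)\<close>, tested on values and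
  without reference to a bimodule record. \<open>End_comult_eq\<close> and
  \<open>sweedler_repr\<close> pass between it and tensors over any
  \<open>End_bimod\<close>.\<close>

definition repr where
  "repr ws \<alpha> \<longleftrightarrow> set ws \<subseteq> S \<times> S \<and>
    (\<forall>x\<in>carrier A. \<forall>y\<in>carrier A. asum (\<lambda>z. fst z x \<otimes> snd z y) ws = \<alpha> (x \<otimes> y))"

lemma reprI:
  assumes "\<And>z. z \<in> set ws \<Longrightarrow> fst z \<in> S" "\<And>z. z \<in> set ws \<Longrightarrow> snd z \<in> S"
    "\<And>x y. x \<in> carrier A \<Longrightarrow> y \<in> carrier A \<Longrightarrow> asum (\<lambda>z. fst z x \<otimes> snd z y) ws = \<alpha> (x \<otimes> y)"
  shows "repr ws \<alpha>"
  using assms by (auto simp: repr_def)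

lemma reprD:
  assumes "repr ws \<alpha>"
  shows "z \<in> set ws \<Longrightarrow> fst z \<in> S" "z \<in> set ws \<Longrightarrow> snd z \<in> S"
    "x \<in> carrier A \<Longrightarrow> y \<in> carrier A \<Longrightarrow> asum (\<lambda>z. fst z x \<otimes> snd z y) ws = \<alpha> (x \<otimes> y)"
    "set ws \<subseteq> S \<times> S"
  using assms by (auto simp: repr_def)

definition comult_list where
  "comult_list \<alpha> = map (\<lambda>(\<beta>, t). (\<lambda>x\<in>carrier A. ev (\<lambda>y z. \<alpha> (x \<otimes> y) \<otimes> z) t, \<beta>)) qb"

lemma bal_shift: "\<alpha> \<in> S \<Longrightarrow> x \<in> carrier A \<Longrightarrow> bal (\<lambda>y z. \<alpha> (x \<otimes> y) \<otimes> z)"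
  by (intro balI; simp add: EndD l_distr r_distr m_assoc[symmetric])

text \<open>Right linearity is the point that uses \<open>t\<close> in \<open>T\<close>: a factor
  \<open>b\<close> next to \<open>x\<close> becomes the left action on \<open>t\<close>, crosses
  over to the right action, and leaves behind \<open>z\<close>.\<close>

lemma comult_comp_closed:
  assumes \<alpha>: "\<alpha> \<in> S" and t: "t \<in> T_set A B"
  shows "(\<lambda>x\<in>carrier A. ev (\<lambda>y z. \<alpha> (x \<otimes> y) \<otimes> z) t) \<in> S"
proof (rule EndI)
  note tc = T_setD(1)[OF t]
  fix x assume x: "x \<in> carrier A"
  show "ev (\<lambda>y z. \<alpha> (x \<otimes> y) \<otimes> z) t \<in> carrier A"
    using bal_shift[OF \<alpha> x] tc by (rule ev_closed)
  show "ev (\<lambda>y z. \<alpha> ((x \<oplus> x') \<otimes> y) \<otimes> z) t = ev (\<lambda>y z. \<alpha> (x \<otimes> y) \<otimes> z) t \<oplus> ev (\<lambda>y z. \<alpha> (x' \<otimes> y) \<otimes> z) t"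
    if x': "x' \<in> carrier A" for x'
  proof -
    \<comment> \<open>Multiplying the argument of \<alpha> by \<open>c\<close> is the left action on
      \<open>t\<close>, so additivity in \<open>x\<close> reduces to that of the action.\<close>
    have sh: "evL \<alpha> (lact TS c t) = ev (\<lambda>y z. \<alpha> (c \<otimes> y) \<otimes> z) t" if "c \<in> carrier A" for c
      using ev_lact(2)[OF bal_L[OF \<alpha>] that tc] .
    have "lact TS (x \<oplus> x') t = lact TS x t \<otimes>\<^bsub>TT\<^esub> lact TS x' t"
      using tensor_add_lact[of x x' t] x x' tc by (simp add: tensor_square_def)
    then have "evL \<alpha> (lact TS (x \<oplus> x') t) = evL \<alpha> (lact TS x t) \<oplus> evL \<alpha> (lact TS x' t)"
      using hom_mult[OF lift_hom[OF comm_group_add bal_L[OF \<alpha>]]] x x' tc by (simp add: lact_closed_TS)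
    then show ?thesis using sh x x' by simp
  qed
  fix b assume b: "b \<in> B"
  show "ev (\<lambda>y z. \<alpha> (b \<otimes> x \<otimes> y) \<otimes> z) t = b \<otimes> ev (\<lambda>y z. \<alpha> (x \<otimes> y) \<otimes> z) t"
  proof -
    have "ev (\<lambda>y z. \<alpha> (b \<otimes> x \<otimes> y) \<otimes> z) t = ev (\<lambda>y z. b \<otimes> (\<alpha> (x \<otimes> y) \<otimes> z)) t"
      using \<alpha> x b tc by (intro ev_cong bal_shift) (auto simp: EndD m_assoc)
    also have "\<dots> = b \<otimes> ev (\<lambda>y z. \<alpha> (x \<otimes> y) \<otimes> z) t"
      using \<alpha> x b tc by (intro ev_comp[symmetric] bal_shift) (auto simp: r_distr)
    finally show ?thesis .
  qed
  show "ev (\<lambda>y z. \<alpha> (x \<otimes> b \<otimes> y) \<otimes> z) t = ev (\<lambda>y z. \<alpha> (x \<otimes> y) \<otimes> z) t \<otimes> b"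
  proof -
    have bA: "b \<in> carrier A" using b by simp
    have "ev (\<lambda>y z. \<alpha> (x \<otimes> b \<otimes> y) \<otimes> z) t = ev (\<lambda>y z. \<alpha> (x \<otimes> (b \<otimes> y)) \<otimes> z) t"
      using \<alpha> x b tc by (intro ev_cong bal_shift) (auto simp: m_assoc)
    also have "\<dots> = ev (\<lambda>y z. \<alpha> (x \<otimes> y) \<otimes> z) (lact TS b t)"
      using ev_lact(2)[OF bal_shift[OF \<alpha> x] bA tc] by simp
    also have "\<dots> = ev (\<lambda>y z. \<alpha> (x \<otimes> y) \<otimes> z) (ract TS t b)"
      using T_setD(2)[OF t b] by simp
    also have "\<dots> = ev (\<lambda>y z. \<alpha> (x \<otimes> y) \<otimes> (z \<otimes> b)) t"
      using ev_ract(2)[OF bal_shift[OF \<alpha> x] bA tc] .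
    also have "\<dots> = ev (\<lambda>y z. \<alpha> (x \<otimes> y) \<otimes> z \<otimes> b) t"
      using ev_ract(1)[OF bal_shift[OF \<alpha> x] bA tc] tc \<alpha> x b
      by (intro ev_cong) (auto simp: EndD m_assoc)
    also have "\<dots> = ev (\<lambda>y z. \<alpha> (x \<otimes> y) \<otimes> z) t \<otimes> b"
      using \<alpha> x b tc by (intro ev_comp[symmetric] bal_shift) (auto simp: l_distr)
    finally show ?thesis .
  qed
qed

text \<open>\<open>ev_qb\<close> for the map \<open>y \<otimes> z \<mapsto> \<alpha>(x y) z\<close>,
  evaluated at \<open>y \<otimes> 1\<close>.\<close>

lemma repr_comult_list:
  assumes \<alpha>: "\<alpha> \<in> S"
  shows "repr (comult_list \<alpha>) \<alpha>"
proof (rule reprI)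
  fix z assume "z \<in> set (comult_list \<alpha>)"
  then show "fst z \<in> S" "snd z \<in> S"
    using \<alpha> comult_comp_closed qb_mem by (auto simp: comult_list_def)
next
  fix x y assume xy: "x \<in> carrier A" "y \<in> carrier A"
  have "asum (\<lambda>z. fst z x \<otimes> snd z y) (comult_list \<alpha>) =
      asum (\<lambda>p. ev (\<lambda>y z. \<alpha> (x \<otimes> y) \<otimes> z) (snd p) \<otimes> fst p y) qb"
    using xy by (simp add: comult_list_def comp_def case_prod_unfold)
  also have "\<dots> = \<alpha> (x \<otimes> y) \<otimes> \<one>"
    using xy \<alpha> by (intro ev_qb[OF bal_shift[OF \<alpha> xy(1)] xy(2), symmetric]) (simp add: EndD m_assoc)
  finally show "asum (\<lambda>z. fst z x \<otimes> snd z y) (comult_list \<alpha>) = \<alpha> (x \<otimes> y)"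
    using xy \<alpha> by (simp add: EndD)
qed

lemma lambda_map_apply [simp]: "x \<in> carrier A \<Longrightarrow> lambda_map A r x = r \<otimes> x"
  and rho_map_apply [simp]: "x \<in> carrier A \<Longrightarrow> rho_map A r x = x \<otimes> r"
  by (simp_all add: lambda_map_def rho_map_def)

lemma lambda_map_closed [simp]: "r \<in> Z \<Longrightarrow> lambda_map A r \<in> S"
  and rho_map_closed [simp]: "r \<in> Z \<Longrightarrow> rho_map A r \<in> S"
proof -
  assume r: "r \<in> Z"
  have "lambda_map A r = (\<lambda>x\<in>carrier A. r \<otimes> \<one>\<^bsub>E\<^esub> x)" "rho_map A r = (\<lambda>x\<in>carrier A. \<one>\<^bsub>E\<^esub> x \<otimes> r)"
    by (auto simp: lambda_map_def rho_map_def)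
  then show "lambda_map A r \<in> S" "rho_map A r \<in> S"
    using scale_closed[OF r, of "\<one>\<^bsub>E\<^esub>"] by simp_all
qed

abbreviation CL where "CL \<equiv> left_bimod E (lambda_map A) (rho_map A)"
abbreviation CR where "CR \<equiv> right_bimod E (rho_map A) (lambda_map A)"

lemma End_bimod_left: "End_bimod CL"
  unfolding End_bimod_def left_bimod_def mk_bimod_def
  by (auto intro!: End_eqI scale_closed simp: EndD)

text \<open>On this side \<open>R\<close> multiplies the argument of an endomorphism. As
  \<open>R \<subseteq> B\<close>, linearity moves it outside, and the actions agree with those of
  the left structure; this makes a single coproduct serve both.\<close>

lemma End_bimod_right: "End_bimod CR"
  unfolding End_bimod_def right_bimod_def mk_bimod_def
  by (auto intro!: End_eqI scale_closed simp: EndD)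

lemma End_bimod_mixed: "End_bimod M \<Longrightarrow> End_bimod N \<Longrightarrow> End_bimod (M\<lparr>ract := ract N\<rparr>)"
  by (simp add: End_bimod_def)

lemma tensor_sum_End_bimod:
  "End_bimod C \<Longrightarrow> End_bimod C' \<Longrightarrow> tensor_sum Z C C = tensor_sum Z C' C'"
  by (intro tensor_sum_cong) (simp_all add: End_bimodD)

text \<open>\<open>End_comult\<close> is defined over the left structure, but every
  \<open>End_bimod\<close> has the same tensor square, and \<open>End_tensor_eqI\<close> compares
  lists by their values.\<close>

lemma End_comult_eq:
  assumes C: "End_bimod C" and \<alpha>: "\<alpha> \<in> S" and ws: "repr ws \<alpha>"
  shows "End_comult A B \<alpha> = tensor_sum Z C C ws"
proof -
  have "End_comult A B \<alpha> = tensor_sum Z CL CL (comult_list \<alpha>)"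
    by (simp add: End_comult_def comult_list_def qb_def[symmetric] Let_def)
  also have "\<dots> = tensor_sum Z C C (comult_list \<alpha>)"
    using tensor_sum_End_bimod[OF End_bimod_left C] by simp
  also have "\<dots> = tensor_sum Z C C ws"
    using reprD[OF repr_comult_list[OF \<alpha>]] reprD[OF ws] by (intro End_tensor_eqI C) simp_all
  finally show ?thesis .
qed

text \<open>Converse to \<open>End_comult_eq\<close>: evaluation
  \<open>\<alpha> \<otimes> \<beta> \<mapsto> \<alpha>(x) \<beta>(y)\<close> is balanced over
  \<open>R\<close>, hence the same for all lists representing one tensor. It handles every choice of
  Sweedler representatives.\<close>

lemma sweedler_repr:
  assumes C: "End_bimod C" and \<delta>: "sweedler Z C (End_comult A B) \<delta>" and \<alpha>: "\<alpha> \<in> S"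
  shows "repr (\<delta> \<alpha>) \<alpha>"
proof (rule reprI)
  interpret CC: tensor_pair Z C C using C C by (rule End_bimod_tensor_pair)
  have \<delta>\<alpha>: "set (\<delta> \<alpha>) \<subseteq> S \<times> S" "tensor_sum Z C C (\<delta> \<alpha>) = End_comult A B \<alpha>"
    using \<delta> \<alpha> by (auto simp: sweedler_def represents_def End_bimodD(1)[OF C])
  then show "z \<in> set (\<delta> \<alpha>) \<Longrightarrow> fst z \<in> S" "z \<in> set (\<delta> \<alpha>) \<Longrightarrow> snd z \<in> S" for z
    by auto
  fix x y assume xy: "x \<in> carrier A" "y \<in> carrier A"
  have eq: "CC.ts (\<delta> \<alpha>) = CC.ts (comult_list \<alpha>)"
    using \<delta>\<alpha>(2) End_comult_eq[OF C \<alpha> repr_comult_list[OF \<alpha>]] by simp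
  have bal: "balanced Z C C (add_monoid A) (\<lambda>\<alpha> \<beta>. \<alpha> x \<otimes> \<beta> y)"
    using xy by (intro balancedI) (simp_all add: End_bimodD[OF C] EndD l_distr r_distr m_assoc)
  have "asum (\<lambda>(\<alpha>, \<beta>). \<alpha> x \<otimes> \<beta> y) (\<delta> \<alpha>) = asum (\<lambda>(\<alpha>, \<beta>). \<alpha> x \<otimes> \<beta> y) (comult_list \<alpha>)"
    using \<delta>\<alpha>(1) reprD(4)[OF repr_comult_list[OF \<alpha>]]
    by (intro CC.ts_universal[OF comm_group_add bal _ _ eq]) (simp_all add: End_bimodD(1)[OF C])
  then show "asum (\<lambda>z. fst z x \<otimes> snd z y) (\<delta> \<alpha>) = \<alpha> (x \<otimes> y)"
    using reprD(3)[OF repr_comult_list[OF \<alpha>] xy] by (simp add: case_prod_unfold)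
qed

end

section \<open>The base algebra, its opposite, and their bimodules\<close>

lemma opp_simps [simp]:
  "carrier (opp A) = carrier A" "add (opp A) = add A" "\<zero>\<^bsub>opp A\<^esub> = \<zero>\<^bsub>A\<^esub>" "\<one>\<^bsub>opp A\<^esub> = \<one>\<^bsub>A\<^esub>"
  "smult (opp A) = smult A" "x \<otimes>\<^bsub>opp A\<^esub> y = y \<otimes>\<^bsub>A\<^esub> x"
  by (simp_all add: opp_def)

lemma assoc_algebra_opp:
  assumes "assoc_algebra K A"
  shows "assoc_algebra K (opp A)"
proof -
  interpret assoc_algebra K A by fact
  have ag: "abelian_group (opp A)"
  proof (rule abelian_groupI)
    show "\<exists>y\<in>carrier (opp A). y \<oplus>\<^bsub>opp A\<^esub> x = \<zero>\<^bsub>opp A\<^esub>" if "x \<in> carrier (opp A)" for x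
      using that by (intro bexI[of _ "\<ominus>\<^bsub>A\<^esub> x"]) (auto simp: M.l_neg)
  qed (auto simp: M.a_assoc intro: M.a_comm)
  have "ring (opp A)"
    by (rule ringI[OF ag]) (auto intro!: monoidI simp: m_assoc l_distr r_distr)
  moreover have "module K (opp A)"
    by (rule moduleI[OF R.is_cring ag]) (auto simp: smult_l_distr smult_r_distr smult_assoc1)
  ultimately show ?thesis
    by (intro assoc_algebra.intro assoc_algebra_axioms.intro) (auto simp: smult_mult_left smult_mult_right)
qed

context irreducible
begin

abbreviation ZA where "ZA \<equiv> centralizer_alg A B"

lemma centralizer_alg_simps [simp]:
  "carrier ZA = Z" "add ZA = add A" "\<zero>\<^bsub>ZA\<^esub> = \<zero>" "\<one>\<^bsub>ZA\<^esub> = \<one>" "monoid.mult ZA = monoid.mult A"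
  "smult ZA = smult A"
  by (simp_all add: centralizer_alg_def)

lemma ZI: "a \<in> carrier A \<Longrightarrow> (\<And>b. b \<in> B \<Longrightarrow> b \<otimes> a = a \<otimes> b) \<Longrightarrow> a \<in> Z"
  unfolding centralizer_def by blast

lemma subring_centralizer: "subring Z A"
proof (rule subringI)
  show "Z \<subseteq> carrier A" by auto
  show "\<one> \<in> Z" by (rule ZI) simp_all
  show "\<ominus> x \<in> Z" if "x \<in> Z" for x
    using that Z_B_comm[OF that] by (intro ZI) (simp_all add: r_minus l_minus)
  show "x \<oplus> y \<in> Z" if "x \<in> Z" "y \<in> Z" for x y
    using that Z_B_comm[OF that(1)] Z_B_comm[OF that(2)] by (intro ZI) (simp_all add: r_distr l_distr)
  show "x \<otimes> y \<in> Z" if "x \<in> Z" "y \<in> Z" for x y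
  proof -
    have "b \<otimes> (x \<otimes> y) = x \<otimes> y \<otimes> b" if b: "b \<in> B" for b
    proof -
      have "b \<otimes> (x \<otimes> y) = x \<otimes> b \<otimes> y"
        using Z_B_comm[OF \<open>x \<in> Z\<close> b] b \<open>x \<in> Z\<close> \<open>y \<in> Z\<close> by (simp add: m_assoc[symmetric])
      also have "\<dots> = x \<otimes> y \<otimes> b"
        using Z_B_comm[OF \<open>y \<in> Z\<close> b] b \<open>x \<in> Z\<close> \<open>y \<in> Z\<close> by (simp add: m_assoc)
      finally show ?thesis .
    qed
    then show ?thesis using that by (intro ZI) simp_all
  qed
qed

lemma ZA_assoc_algebra: "assoc_algebra K ZA"
proof -
  interpret Z: ring ZA
    unfolding centralizer_alg_def using subring_centralizer by (rule subring_is_ring)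
  have smult: "k \<odot>\<^bsub>A\<^esub> r \<in> Z" if "k \<in> carrier K" "r \<in> Z" for k r
    using that Z_B_comm[OF that(2)] by (intro ZI) (simp_all add: smult_mult_left smult_mult_right)
  have "module K ZA"
    by (rule moduleI[OF R.is_cring Z.abelian_group_axioms])
      (auto simp: smult smult_l_distr smult_r_distr smult_assoc1)
  then show ?thesis
    by (intro assoc_algebra.intro assoc_algebra_axioms.intro Z.ring_axioms)
      (auto simp: smult_mult_left smult_mult_right)
qed

lemma Z_ops_closed [simp]:
  "\<one> \<in> Z" "r \<in> Z \<Longrightarrow> s \<in> Z \<Longrightarrow> r \<otimes> s \<in> Z" "r \<in> Z \<Longrightarrow> s \<in> Z \<Longrightarrow> r \<oplus> s \<in> Z"
  using subringE[OF subring_centralizer] by auto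

lemma counit_closed: "\<alpha> \<in> S \<Longrightarrow> \<alpha> \<one> \<in> Z"
proof -
  assume \<alpha>: "\<alpha> \<in> S"
  have "b \<otimes> \<alpha> \<one> = \<alpha> \<one> \<otimes> b" if "b \<in> B" for b
    using End_l[OF \<alpha> that, of \<one>] End_r[OF \<alpha> that, of \<one>] that by simp
  then show ?thesis using \<alpha> by (intro ZI) (simp_all add: End_closed)
qed

text \<open>\<open>Q\<close> stands for \<open>centralizer_alg A B\<close> or its opposite; since
  \<open>R\<close> is commutative, both satisfy \<open>Q_mult\<close>.\<close>

lemma End_bimod_bimodule:
  assumes C: "End_bimod C" and Q: "ring Q" "carrier Q = Z" "add Q = add A" "\<one>\<^bsub>Q\<^esub> = \<one>"
    and Q_mult: "\<And>r s. r \<in> Z \<Longrightarrow> s \<in> Z \<Longrightarrow> r \<otimes>\<^bsub>Q\<^esub> s = r \<otimes> s"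
  shows "bimodule Q Q C"
proof (intro bimodule.intro bimodule_axioms.intro Q(1) End_bimod_comm_group C;
    unfold Q(2) End_bimodD(1)[OF C])
  note act = End_bimod_act_closed[OF C]
  have l: "lact C r \<alpha> x = r \<otimes> \<alpha> x" and r: "ract C \<alpha> r x = \<alpha> x \<otimes> r"
    if "r \<in> Z" "\<alpha> \<in> S" "x \<in> carrier A" for r \<alpha> x
    using that by (simp_all add: End_bimodD[OF C])
  note D = End_bimodD(2)[OF C] Q(3,4) Q_mult l r act
  show "lact C r \<alpha> \<in> S" if "r \<in> Z" "\<alpha> \<in> S" for r \<alpha>
    using that by (simp add: act)
  show "ract C \<alpha> r \<in> S" if "\<alpha> \<in> S" "r \<in> Z" for r \<alpha>
    using that by (simp add: act)
  show "lact C r (\<alpha> \<otimes>\<^bsub>C\<^esub> \<beta>) = lact C r \<alpha> \<otimes>\<^bsub>C\<^esub> lact C r \<beta>" if "r \<in> Z" "\<alpha> \<in> S" "\<beta> \<in> S" for r \<alpha> \<beta>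
    using that by (intro End_eqI; simp add: D End_closed r_distr l_distr m_assoc)
  show "ract C (\<alpha> \<otimes>\<^bsub>C\<^esub> \<beta>) r = ract C \<alpha> r \<otimes>\<^bsub>C\<^esub> ract C \<beta> r" if "\<alpha> \<in> S" "\<beta> \<in> S" "r \<in> Z" for r \<alpha> \<beta>
    using that by (intro End_eqI; simp add: D End_closed r_distr l_distr m_assoc)
  show "lact C (r \<oplus>\<^bsub>Q\<^esub> s) \<alpha> = lact C r \<alpha> \<otimes>\<^bsub>C\<^esub> lact C s \<alpha>" if "r \<in> Z" "s \<in> Z" "\<alpha> \<in> S" for r s \<alpha>
    using that by (intro End_eqI; simp add: D End_closed r_distr l_distr m_assoc)
  show "ract C \<alpha> (r \<oplus>\<^bsub>Q\<^esub> s) = ract C \<alpha> r \<otimes>\<^bsub>C\<^esub> ract C \<alpha> s" if "\<alpha> \<in> S" "r \<in> Z" "s \<in> Z" for r s \<alpha>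
    using that by (intro End_eqI; simp add: D End_closed r_distr l_distr m_assoc)
  show "lact C (r \<otimes>\<^bsub>Q\<^esub> s) \<alpha> = lact C r (lact C s \<alpha>)" if "r \<in> Z" "s \<in> Z" "\<alpha> \<in> S" for r s \<alpha>
    using that by (intro End_eqI; simp add: D End_closed r_distr l_distr m_assoc)
  show "ract C \<alpha> (r \<otimes>\<^bsub>Q\<^esub> s) = ract C (ract C \<alpha> r) s" if "\<alpha> \<in> S" "r \<in> Z" "s \<in> Z" for r s \<alpha>
    using that by (intro End_eqI; simp add: D End_closed r_distr l_distr m_assoc)
  show "lact C \<one>\<^bsub>Q\<^esub> \<alpha> = \<alpha>" if "\<alpha> \<in> S" for \<alpha>
    using that by (intro End_eqI; simp add: D End_closed r_distr l_distr m_assoc)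
  show "ract C \<alpha> \<one>\<^bsub>Q\<^esub> = \<alpha>" if "\<alpha> \<in> S" for \<alpha>
    using that by (intro End_eqI; simp add: D End_closed r_distr l_distr m_assoc)
  show "ract C (lact C r \<alpha>) s = lact C r (ract C \<alpha> s)" if "r \<in> Z" "\<alpha> \<in> S" "s \<in> Z" for r s \<alpha>
    using that by (intro End_eqI; simp add: D End_closed r_distr l_distr m_assoc)
qed

lemma in_set_concat_map: "t \<in> set (concat (map f xs)) \<longleftrightarrow> (\<exists>p\<in>set xs. t \<in> set (f p))"
  by auto

text \<open>Evaluated at \<open>u\<close>, \<open>v\<close>, \<open>w\<close>, both sides become
  \<open>a(u v w)\<close>, by associativity in \<open>A\<close>. Three records and four families of
  representatives are kept separate so that ordinary and both mixed coassociativity laws are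
  instances.\<close>

lemma coassoc_End:
  assumes C: "End_bimod M" "End_bimod N" "End_bimod P"
    and \<delta>: "\<And>\<alpha>. \<alpha> \<in> S \<Longrightarrow> repr (\<delta>1 \<alpha>) \<alpha>" "\<And>\<alpha>. \<alpha> \<in> S \<Longrightarrow> repr (\<delta>2 \<alpha>) \<alpha>"
      "\<And>\<alpha>. \<alpha> \<in> S \<Longrightarrow> repr (\<delta>3 \<alpha>) \<alpha>" "\<And>\<alpha>. \<alpha> \<in> S \<Longrightarrow> repr (\<delta>4 \<alpha>) \<alpha>"
    and a: "a \<in> S"
  shows "tensor3_sum Z Z M N P [(x, y, z). (u, z) \<leftarrow> \<delta>1 a, (x, y) \<leftarrow> \<delta>2 u] =
    tensor3_sum Z Z M N P [(x, y, z). (x, v) \<leftarrow> \<delta>3 a, (y, z) \<leftarrow> \<delta>4 v]"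
proof -
  interpret T3: tensor_triple Z Z M N P using C by (rule End_bimod_tensor_triple)
  define xs where "xs = concat (map (\<lambda>p. map (\<lambda>q. (fst q, snd q, snd p)) (\<delta>2 (fst p))) (\<delta>1 a))"
  define ys where "ys = concat (map (\<lambda>p. map (\<lambda>q. (fst p, fst q, snd q)) (\<delta>4 (snd p))) (\<delta>3 a))"
  note d1 = reprD(1,2)[OF \<delta>(1)] and d2 = reprD(1,2)[OF \<delta>(2)]
    and d3 = reprD(1,2)[OF \<delta>(3)] and d4 = reprD(1,2)[OF \<delta>(4)]
  have xs: "set xs \<subseteq> S \<times> S \<times> S"
  proof
    fix t assume "t \<in> set xs"
    then obtain p q where "p \<in> set (\<delta>1 a)" "q \<in> set (\<delta>2 (fst p))" "t = (fst q, snd q, snd p)"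
      unfolding xs_def in_set_concat_map set_map by blast
    moreover from this have p: "fst p \<in> S" "snd p \<in> S" by (auto intro: d1[OF a])
    moreover from calculation have "fst q \<in> S" "snd q \<in> S" by (auto intro: d2[OF p(1)])
    ultimately show "t \<in> S \<times> S \<times> S" by (simp add: mem_Times_iff)
  qed
  have ys: "set ys \<subseteq> S \<times> S \<times> S"
  proof
    fix t assume "t \<in> set ys"
    then obtain p q where "p \<in> set (\<delta>3 a)" "q \<in> set (\<delta>4 (snd p))" "t = (fst p, fst q, snd q)"
      unfolding ys_def in_set_concat_map set_map by blast
    moreover from this have p: "fst p \<in> S" "snd p \<in> S" by (auto intro: d3[OF a])
    moreover from calculation have "fst q \<in> S" "snd q \<in> S" by (auto intro: d4[OF p(2)])
    ultimately show "t \<in> S \<times> S \<times> S" by (simp add: mem_Times_iff)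
  qed
  have "asum (\<lambda>(x, y, z). x u \<otimes> y v \<otimes> z w) xs = asum (\<lambda>(x, y, z). x u \<otimes> y v \<otimes> z w) ys"
    if uvw: "u \<in> carrier A" "v \<in> carrier A" "w \<in> carrier A" for u v w
  proof -
    have "asum (\<lambda>(x, y, z). x u \<otimes> y v \<otimes> z w) xs =
        asum (\<lambda>p. asum (\<lambda>q. fst q u \<otimes> snd q v \<otimes> snd p w) (\<delta>2 (fst p))) (\<delta>1 a)"
    proof -
      have "(\<lambda>(x, y, z). x u \<otimes> y v \<otimes> z w) t \<in> carrier A" if "t \<in> set xs" for t
      proof -
        have "t \<in> S \<times> S \<times> S" using xs \<open>t \<in> set xs\<close> by (rule subsetD)
        then show ?thesis using uvw by (auto simp: End_closed)
      qed
      then have "asum (\<lambda>(x, y, z). x u \<otimes> y v \<otimes> z w) xs = asum (\<lambda>p. asum (\<lambda>(x, y, z). x u \<otimes> y v \<otimes> z w)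
          (map (\<lambda>q. (fst q, snd q, snd p)) (\<delta>2 (fst p)))) (\<delta>1 a)"
        unfolding xs_def by (rule add.list_sum_map_concat)
      then show ?thesis by (simp add: comp_def case_prod_unfold)
    qed
    also have "\<dots> = asum (\<lambda>p. fst p (u \<otimes> v) \<otimes> snd p w) (\<delta>1 a)"
    proof (rule list_sum_cong)
      fix p assume p: "p \<in> set (\<delta>1 a)"
      then have E: "fst p \<in> S" "snd p \<in> S" using p by (auto intro: d1[OF a])
      have "asum (\<lambda>q. fst q u \<otimes> snd q v \<otimes> snd p w) (\<delta>2 (fst p)) =
          asum (\<lambda>q. fst q u \<otimes> snd q v) (\<delta>2 (fst p)) \<otimes> snd p w"
        using d2[OF E(1)] E uvw by (intro asum_l_distr[symmetric]) (auto simp: EndD)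
      then show "asum (\<lambda>q. fst q u \<otimes> snd q v \<otimes> snd p w) (\<delta>2 (fst p)) = fst p (u \<otimes> v) \<otimes> snd p w"
        using reprD(3)[OF \<delta>(2)[OF E(1)]] uvw by simp
    qed
    also have "\<dots> = a (u \<otimes> v \<otimes> w)" using reprD(3)[OF \<delta>(1)[OF a]] uvw by simp
    also have "\<dots> = asum (\<lambda>p. fst p u \<otimes> snd p (v \<otimes> w)) (\<delta>3 a)"
      using reprD(3)[OF \<delta>(3)[OF a]] uvw by (simp add: m_assoc)
    also have "\<dots> = asum (\<lambda>p. asum (\<lambda>q. fst p u \<otimes> fst q v \<otimes> snd q w) (\<delta>4 (snd p))) (\<delta>3 a)"
    proof (rule list_sum_cong)
      fix p assume p: "p \<in> set (\<delta>3 a)"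
      then have E: "fst p \<in> S" "snd p \<in> S" using p by (auto intro: d3[OF a])
      have "asum (\<lambda>q. fst p u \<otimes> fst q v \<otimes> snd q w) (\<delta>4 (snd p)) =
          asum (\<lambda>q. fst p u \<otimes> (fst q v \<otimes> snd q w)) (\<delta>4 (snd p))"
        using d4[OF E(2)] E uvw by (intro list_sum_cong) (auto simp: EndD m_assoc)
      also have "\<dots> = fst p u \<otimes> asum (\<lambda>q. fst q v \<otimes> snd q w) (\<delta>4 (snd p))"
        using d4[OF E(2)] E uvw by (intro asum_r_distr[symmetric]) (auto simp: EndD)
      finally show "fst p u \<otimes> snd p (v \<otimes> w) = asum (\<lambda>q. fst p u \<otimes> fst q v \<otimes> snd q w) (\<delta>4 (snd p))"
        using reprD(3)[OF \<delta>(4)[OF E(2)]] uvw by simp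
    qed
    also have "\<dots> = asum (\<lambda>(x, y, z). x u \<otimes> y v \<otimes> z w) ys"
    proof -
      have "(\<lambda>(x, y, z). x u \<otimes> y v \<otimes> z w) t \<in> carrier A" if "t \<in> set ys" for t
      proof -
        have "t \<in> S \<times> S \<times> S" using ys \<open>t \<in> set ys\<close> by (rule subsetD)
        then show ?thesis using uvw by (auto simp: End_closed)
      qed
      then have "asum (\<lambda>(x, y, z). x u \<otimes> y v \<otimes> z w) ys = asum (\<lambda>p. asum (\<lambda>(x, y, z). x u \<otimes> y v \<otimes> z w)
          (map (\<lambda>q. (fst p, fst q, snd q)) (\<delta>4 (snd p)))) (\<delta>3 a)"
        unfolding ys_def by (rule add.list_sum_map_concat)
      then show ?thesis by (simp add: comp_def case_prod_unfold)
    qed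
    finally show ?thesis .
  qed
  from balanced3_determined[OF C T3.T.Q.comm_group_axioms T3.pure_balanced3 xs ys this]
  have "T3.ts3 xs = T3.ts3 ys"
    using T3.ts3_list_sum[of xs] T3.ts3_list_sum[of ys] xs ys C by (simp add: End_bimodD(1))
  then show ?thesis by (simp add: xs_def ys_def case_prod_unfold)
qed

lemma asum_append:
  assumes "\<And>z. z \<in> set xs \<Longrightarrow> f z \<in> carrier A" "\<And>z. z \<in> set ys \<Longrightarrow> f z \<in> carrier A"
  shows "asum f (xs @ ys) = asum f xs \<oplus> asum f ys"
  using assms add.list_sum_append[of "map f xs" "map f ys"] by (simp add: image_subset_iff)

lemma repr_mem:
  assumes "repr ws \<alpha>"
  shows "z \<in> set ws \<Longrightarrow> fst z \<in> S" "z \<in> set ws \<Longrightarrow> snd z \<in> S"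
    "(x, y) \<in> set ws \<Longrightarrow> x \<in> S" "(x, y) \<in> set ws \<Longrightarrow> y \<in> S"
  using reprD(4)[OF assms] by auto

text \<open>For linearity of the coproduct an explicit list is built from \<open>comult_list\<close>
  and checked with \<open>repr\<close>. The counit laws are the cases \<open>\<alpha>(1 w)\<close>
  and \<open>\<alpha>(w 1)\<close> of the same description.\<close>

lemma coring_End:
  assumes C: "End_bimod C" and Q: "ring Q" "carrier Q = Z" "add Q = add A" "\<one>\<^bsub>Q\<^esub> = \<one>"
    and Q_mult: "\<And>r s. r \<in> Z \<Longrightarrow> s \<in> Z \<Longrightarrow> r \<otimes>\<^bsub>Q\<^esub> s = r \<otimes> s"
  shows "coring Q C (End_comult A B) (End_counit A)"
proof -
  interpret Q: bimodule Q Q C using assms by (rule End_bimod_bimodule)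
  interpret T: tensor_bimodule Q Q Q C C by unfold_locales
  note CE = End_bimodD(1)[OF C]
  note act = End_bimodD(4,5)[OF C]
  have wsC: "set ws \<subseteq> carrier C \<times> carrier C" if "repr ws \<alpha>" for ws \<alpha>
    using reprD(4)[OF that] by (simp add: CE)
  have \<Delta>: "End_comult A B \<alpha> = tensor_sum Z C C (comult_list \<alpha>)" if "\<alpha> \<in> S" for \<alpha>
    using that by (intro End_comult_eq C repr_comult_list)
  note rc = repr_comult_list
  show ?thesis
  proof (intro coring.intro coring_axioms.intro Q.bimodule_axioms; unfold Q(2) CE)
    show "End_comult A B \<in> bimod_hom Z Z C (tensor Z C C)"
      unfolding bimod_hom_def
    proof (intro CollectI conjI homI ballI; unfold CE tensor_carrier tensor_mult)
      fix \<alpha> assume \<alpha>: "\<alpha> \<in> S"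
      show "End_comult A B \<alpha> \<in> carrier (tensor_group Z C C)"
        using T.ts_closed[OF wsC[OF rc[OF \<alpha>]]] by (simp add: \<Delta>[OF \<alpha>] Q(2))
      show "End_comult A B (\<alpha> \<otimes>\<^bsub>C\<^esub> \<beta>) =
          End_comult A B \<alpha> \<otimes>\<^bsub>tensor_group Z C C\<^esub> End_comult A B \<beta>" if \<beta>: "\<beta> \<in> S" for \<beta>
      proof -
        have "repr (comult_list \<alpha> @ comult_list \<beta>) (\<alpha> \<oplus>\<^bsub>E\<^esub> \<beta>)"
        proof (rule reprI)
          fix x y assume xy: "x \<in> carrier A" "y \<in> carrier A"
          have "asum (\<lambda>z. fst z x \<otimes> snd z y) (comult_list \<alpha> @ comult_list \<beta>) =
              asum (\<lambda>z. fst z x \<otimes> snd z y) (comult_list \<alpha>) \<oplus> asum (\<lambda>z. fst z x \<otimes> snd z y) (comult_list \<beta>)"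
            using repr_mem[OF rc[OF \<alpha>]] repr_mem[OF rc[OF \<beta>]] xy
            by (intro asum_append) (simp_all add: End_closed)
          then show "asum (\<lambda>z. fst z x \<otimes> snd z y) (comult_list \<alpha> @ comult_list \<beta>) = (\<alpha> \<oplus>\<^bsub>E\<^esub> \<beta>) (x \<otimes> y)"
            using xy reprD(3)[OF rc[OF \<alpha>]] reprD(3)[OF rc[OF \<beta>]] by simp
        qed (use repr_mem[OF rc[OF \<alpha>]] repr_mem[OF rc[OF \<beta>]] in auto)
        from End_comult_eq[OF C _ this] show ?thesis
          using \<alpha> \<beta> T.ts_append[OF wsC[OF rc[OF \<alpha>]] wsC[OF rc[OF \<beta>]]]
          by (simp add: End_bimodD(2)[OF C] \<Delta> Q(2))
      qed
      fix r assume r: "r \<in> Z"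
      show "End_comult A B (lact C r \<alpha>) = lact (tensor Z C C) r (End_comult A B \<alpha>)"
      proof -
        let ?ws = "map (\<lambda>(x, y). (lact C r x, y)) (comult_list \<alpha>)"
        have "repr ?ws (lact C r \<alpha>)"
        proof (rule reprI)
          fix x y assume xy: "x \<in> carrier A" "y \<in> carrier A"
          have "asum (\<lambda>z. fst z x \<otimes> snd z y) ?ws = asum (\<lambda>z. r \<otimes> (fst z x \<otimes> snd z y)) (comult_list \<alpha>)"
            unfolding map_map comp_def using xy r repr_mem[OF rc[OF \<alpha>]]
            by (intro list_sum_cong) (simp add: case_prod_unfold act EndD m_assoc)
          also have "\<dots> = r \<otimes> asum (\<lambda>z. fst z x \<otimes> snd z y) (comult_list \<alpha>)"
            using xy r repr_mem[OF rc[OF \<alpha>]] by (intro asum_r_distr[symmetric]) (auto simp: EndD)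
          finally show "asum (\<lambda>z. fst z x \<otimes> snd z y) ?ws = lact C r \<alpha> (x \<otimes> y)"
            using xy r \<alpha> reprD(3)[OF rc[OF \<alpha>]] by (simp add: act)
        qed (use r repr_mem[OF rc[OF \<alpha>]] End_bimod_act_closed[OF C] in auto)
        from End_comult_eq[OF C _ this] show ?thesis
          using T.lact_ts[OF _ wsC[OF rc[OF \<alpha>]], of r] r \<alpha> End_bimod_act_closed[OF C]
          by (simp add: \<Delta> Q(2))
      qed
      show "End_comult A B (ract C \<alpha> r) = ract (tensor Z C C) (End_comult A B \<alpha>) r"
      proof -
        let ?ws = "map (\<lambda>(x, y). (x, ract C y r)) (comult_list \<alpha>)"
        have "repr ?ws (ract C \<alpha> r)"
        proof (rule reprI)
          fix x y assume xy: "x \<in> carrier A" "y \<in> carrier A"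
          have "asum (\<lambda>z. fst z x \<otimes> snd z y) ?ws = asum (\<lambda>z. (fst z x \<otimes> snd z y) \<otimes> r) (comult_list \<alpha>)"
            unfolding map_map comp_def using xy r repr_mem[OF rc[OF \<alpha>]]
            by (intro list_sum_cong) (simp add: case_prod_unfold act EndD m_assoc)
          also have "\<dots> = asum (\<lambda>z. fst z x \<otimes> snd z y) (comult_list \<alpha>) \<otimes> r"
            using xy r repr_mem[OF rc[OF \<alpha>]] by (intro asum_l_distr[symmetric]) (auto simp: EndD)
          finally show "asum (\<lambda>z. fst z x \<otimes> snd z y) ?ws = ract C \<alpha> r (x \<otimes> y)"
            using xy r \<alpha> reprD(3)[OF rc[OF \<alpha>]] by (simp add: act)
        qed (use r repr_mem[OF rc[OF \<alpha>]] End_bimod_act_closed[OF C] in auto)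
        from End_comult_eq[OF C _ this] show ?thesis
          using T.ract_ts[OF _ wsC[OF rc[OF \<alpha>]], of r] r \<alpha> End_bimod_act_closed[OF C]
          by (simp add: \<Delta> Q(2))
      qed
    qed
    show "End_counit A \<in> bimod_hom Z Z C (reg_bimod Q)"
      using Q_mult
      by (auto simp: bimod_hom_def hom_def End_counit_def CE End_bimodD(2)[OF C] Q(2,3) act counit_closed)
    fix \<delta> \<alpha> assume \<delta>: "sweedler Z C (End_comult A B) \<delta>" and \<alpha>: "\<alpha> \<in> S"
    note rd = sweedler_repr[OF C \<delta>]
    show "tensor3_sum Z Z C C C [(x, y, z). (u, z) \<leftarrow> \<delta> \<alpha>, (x, y) \<leftarrow> \<delta> u] =
        tensor3_sum Z Z C C C [(x, y, z). (x, v) \<leftarrow> \<delta> \<alpha>, (y, z) \<leftarrow> \<delta> v]"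
      using C C C rd rd rd rd \<alpha> by (rule coassoc_End)
    note d = repr_mem[OF rd[OF \<alpha>]]
    have c: "lact C (End_counit A (fst z)) (snd z) \<in> S" "ract C (fst z) (End_counit A (snd z)) \<in> S"
      if "z \<in> set (\<delta> \<alpha>)" for z
      using d(1,2)[OF that] by (auto intro!: End_bimod_act_closed C counit_closed simp: End_counit_def)
    show "list_sum C [lact C (End_counit A x) y. (x, y) \<leftarrow> \<delta> \<alpha>] = \<alpha>"
    proof (rule End_eqI)
      fix w assume w: "w \<in> carrier A"
      have "list_sum C [lact C (End_counit A x) y. (x, y) \<leftarrow> \<delta> \<alpha>] w =
          asum (\<lambda>z. lact C (End_counit A (fst z)) (snd z) w) (\<delta> \<alpha>)"
        using c w by (simp add: End_bimod_list_sum[OF C] End_list_sum case_prod_unfold)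
      also have "\<dots> = asum (\<lambda>z. fst z \<one> \<otimes> snd z w) (\<delta> \<alpha>)"
        using d w by (intro list_sum_cong) (simp add: act End_counit_def counit_closed)
      finally show "list_sum C [lact C (End_counit A x) y. (x, y) \<leftarrow> \<delta> \<alpha>] w = \<alpha> w"
        using reprD(3)[OF rd[OF \<alpha>], of \<one> w] w by simp
    qed (use c \<alpha> in \<open>auto simp: End_bimod_list_sum[OF C] case_prod_unfold intro!: End_list_sum_closed\<close>)
    show "list_sum C [ract C x (End_counit A y). (x, y) \<leftarrow> \<delta> \<alpha>] = \<alpha>"
    proof (rule End_eqI)
      fix w assume w: "w \<in> carrier A"
      have "list_sum C [ract C x (End_counit A y). (x, y) \<leftarrow> \<delta> \<alpha>] w =
          asum (\<lambda>z. ract C (fst z) (End_counit A (snd z)) w) (\<delta> \<alpha>)"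
        using c w by (simp add: End_bimod_list_sum[OF C] End_list_sum case_prod_unfold)
      also have "\<dots> = asum (\<lambda>z. fst z w \<otimes> snd z \<one>) (\<delta> \<alpha>)"
        using d w by (intro list_sum_cong) (simp add: act End_counit_def counit_closed)
      finally show "list_sum C [ract C x (End_counit A y). (x, y) \<leftarrow> \<delta> \<alpha>] w = \<alpha> w"
        using reprD(3)[OF rd[OF \<alpha>], of w \<one>] w by simp
    qed (use c \<alpha> in \<open>auto simp: End_bimod_list_sum[OF C] case_prod_unfold intro!: End_list_sum_closed\<close>)
  qed
qed

text \<open>Summing over \<open>xs\<close> leaves
  \<open>\<alpha>(\<beta>\<^sub>1(x) \<beta>\<^sub>2(y))\<close> for each entry of
  \<open>ys\<close>; additivity of \<alpha> takes the remaining sum inside, where it is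
  \<open>\<beta>(x y)\<close>.\<close>

lemma repr_compose:
  assumes \<alpha>: "\<alpha> \<in> S" "repr xs \<alpha>" and \<beta>: "\<beta> \<in> S" "repr ys \<beta>"
  shows "repr [(x \<otimes>\<^bsub>E\<^esub> x', y \<otimes>\<^bsub>E\<^esub> y'). (x, y) \<leftarrow> xs, (x', y') \<leftarrow> ys] (\<alpha> \<otimes>\<^bsub>E\<^esub> \<beta>)"
    (is "repr ?ws _")
proof (rule reprI)
  note d = repr_mem[OF \<alpha>(2)] repr_mem[OF \<beta>(2)]
  show wsE: "fst z \<in> S" "snd z \<in> S" if "z \<in> set ?ws" for z
  proof -
    obtain p q where "p \<in> set xs" "q \<in> set ys" "z = (fst p \<otimes>\<^bsub>E\<^esub> fst q, snd p \<otimes>\<^bsub>E\<^esub> snd q)"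
      using \<open>z \<in> set ?ws\<close> by (auto simp: case_prod_unfold)
    then show "fst z \<in> S" "snd z \<in> S" using d by simp_all
  qed
  fix x y assume xy: "x \<in> carrier A" "y \<in> carrier A"
  have "asum (\<lambda>z. fst z x \<otimes> snd z y) ?ws =
      asum (\<lambda>p. asum (\<lambda>q. fst p (fst q x) \<otimes> snd p (snd q y)) ys) xs"
  proof -
    have "fst z x \<otimes> snd z y \<in> carrier A" if "z \<in> set ?ws" for z
      using wsE[OF that] xy by (simp add: EndD)
    then have "asum (\<lambda>z. fst z x \<otimes> snd z y) ?ws = asum (\<lambda>p. asum (\<lambda>z. fst z x \<otimes> snd z y)
        (case p of (x, y) \<Rightarrow> [(x \<otimes>\<^bsub>E\<^esub> x', y \<otimes>\<^bsub>E\<^esub> y'). (x', y') \<leftarrow> ys])) xs"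
      by (rule add.list_sum_map_concat)
    then show ?thesis using xy by (simp add: comp_def case_prod_unfold)
  qed
  also have "\<dots> = asum (\<lambda>q. asum (\<lambda>p. fst p (fst q x) \<otimes> snd p (snd q y)) xs) ys"
    using xy d by (intro add.list_sum_swap) (simp add: EndD)
  also have "\<dots> = asum (\<lambda>q. \<alpha> (fst q x \<otimes> snd q y)) ys"
    using xy d reprD(3)[OF \<alpha>(2)] by (intro list_sum_cong) (simp add: EndD)
  also have "\<dots> = \<alpha> (asum (\<lambda>q. fst q x \<otimes> snd q y) ys)"
    using xy d \<alpha>(1) by (intro End_asum[symmetric]) (auto simp: EndD)
  finally show "asum (\<lambda>z. fst z x \<otimes> snd z y) ?ws = (\<alpha> \<otimes>\<^bsub>E\<^esub> \<beta>) (x \<otimes> y)"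
    using reprD(3)[OF \<beta>(2)] xy by simp
qed

lemma repr_one: "repr [(\<one>\<^bsub>E\<^esub>, \<one>\<^bsub>E\<^esub>)] \<one>\<^bsub>E\<^esub>"
  by (rule reprI) auto

lemma smult_Z_closed: "k \<in> carrier K \<Longrightarrow> r \<in> Z \<Longrightarrow> k \<odot>\<^bsub>A\<^esub> r \<in> Z"
proof -
  interpret ZA: assoc_algebra K ZA by (rule ZA_assoc_algebra)
  show "k \<in> carrier K \<Longrightarrow> r \<in> Z \<Longrightarrow> k \<odot>\<^bsub>A\<^esub> r \<in> Z" using ZA.smult_closed by simp
qed

lemma lambda_alg_hom: "lambda_map A \<in> alg_hom K ZA E" "lambda_map A \<in> alg_hom K (opp ZA) (opp E)"
  and rho_alg_hom: "rho_map A \<in> alg_hom K ZA (opp E)" "rho_map A \<in> alg_hom K (opp ZA) E"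
  unfolding alg_hom_def ring_hom_def
  by (auto intro!: End_eqI simp: smult_Z_closed l_distr r_distr m_assoc smult_mult_left smult_mult_right)

lemma lambda_rho_commute: "r \<in> Z \<Longrightarrow> s \<in> Z \<Longrightarrow>
    lambda_map A r \<otimes>\<^bsub>E\<^esub> rho_map A s = rho_map A s \<otimes>\<^bsub>E\<^esub> lambda_map A r"
  by (rule End_eqI) (auto simp: m_assoc)

lemma left_bialgebroid_End:
  "left_bialgebroid K E ZA (lambda_map A) (rho_map A) (End_comult A B) (End_counit A)"
proof (intro left_bialgebroid.intro left_bialgebroid_axioms.intro E.assoc_algebra_axioms ZA_assoc_algebra)
  interpret ZA: assoc_algebra K ZA by (rule ZA_assoc_algebra)
  show "coring ZA CL (End_comult A B) (End_counit A)"
    by (rule coring_End[OF End_bimod_left ZA.ring_axioms]) simp_all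
  show "lambda_map A \<in> alg_hom K ZA E" "rho_map A \<in> alg_hom K ZA (opp E)"
    by (rule lambda_alg_hom rho_alg_hom)+
  show "End_comult A B \<one>\<^bsub>E\<^esub> = tensor_sum (carrier ZA) CL CL [(\<one>\<^bsub>E\<^esub>, \<one>\<^bsub>E\<^esub>)]"
    using End_comult_eq[OF End_bimod_left _ repr_one] by simp
  show "End_counit A \<one>\<^bsub>E\<^esub> = \<one>\<^bsub>ZA\<^esub>" by (simp add: End_counit_def)
  fix a b assume a: "a \<in> S" and b: "b \<in> S"
  show "End_counit A (a \<otimes>\<^bsub>E\<^esub> b) = End_counit A (a \<otimes>\<^bsub>E\<^esub> lambda_map A (End_counit A b))"
    "End_counit A (a \<otimes>\<^bsub>E\<^esub> b) = End_counit A (a \<otimes>\<^bsub>E\<^esub> rho_map A (End_counit A b))"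
    using a b counit_closed[OF b] by (simp_all add: End_counit_def)
  fix \<delta> assume "sweedler (carrier ZA) CL (End_comult A B) \<delta>"
  then have rd: "repr (\<delta> \<alpha>) \<alpha>" if "\<alpha> \<in> S" for \<alpha>
    using sweedler_repr[OF End_bimod_left] that by simp
  show "End_comult A B (a \<otimes>\<^bsub>E\<^esub> b) = tensor_sum (carrier ZA) CL CL
      [(x \<otimes>\<^bsub>E\<^esub> x', y \<otimes>\<^bsub>E\<^esub> y'). (x, y) \<leftarrow> \<delta> a, (x', y') \<leftarrow> \<delta> b]"
    using End_comult_eq[OF End_bimod_left _ repr_compose[OF a rd[OF a] b rd[OF b]]] a b by simp
  fix r assume r: "r \<in> carrier ZA"
  note d = repr_mem[OF rd[OF a]]
  \<comment> \<open>As bilinear maps both sides are \<open>a(x r y)\<close>, with \<open>r\<close>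
    attached to \<open>x\<close> or to \<open>y\<close>.\<close>
  have "tensor_sum Z CL CL [(x \<otimes>\<^bsub>E\<^esub> rho_map A r, y). (x, y) \<leftarrow> \<delta> a] =
      tensor_sum Z CL CL [(x, y \<otimes>\<^bsub>E\<^esub> lambda_map A r). (x, y) \<leftarrow> \<delta> a]"
  proof (rule End_tensor_eqI[OF End_bimod_left End_bimod_left])
    fix x y assume xy: "x \<in> carrier A" "y \<in> carrier A"
    have "asum (\<lambda>z. fst z x \<otimes> snd z y) [(x \<otimes>\<^bsub>E\<^esub> rho_map A r, y). (x, y) \<leftarrow> \<delta> a] =
        asum (\<lambda>z. fst z (x \<otimes> r) \<otimes> snd z y) (\<delta> a)"
      using xy by (simp add: comp_def case_prod_unfold)
    also have "\<dots> = asum (\<lambda>z. fst z x \<otimes> snd z (r \<otimes> y)) (\<delta> a)"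
      using xy r reprD(3)[OF rd[OF a]] by (simp add: m_assoc)
    also have "\<dots> = asum (\<lambda>z. fst z x \<otimes> snd z y) [(x, y \<otimes>\<^bsub>E\<^esub> lambda_map A r). (x, y) \<leftarrow> \<delta> a]"
      using xy by (simp add: comp_def case_prod_unfold)
    finally show "asum (\<lambda>z. fst z x \<otimes> snd z y) [(x \<otimes>\<^bsub>E\<^esub> rho_map A r, y). (x, y) \<leftarrow> \<delta> a] =
        asum (\<lambda>z. fst z x \<otimes> snd z y) [(x, y \<otimes>\<^bsub>E\<^esub> lambda_map A r). (x, y) \<leftarrow> \<delta> a]" .
  qed (use d r in auto)
  then show "tensor_sum (carrier ZA) CL CL [(x \<otimes>\<^bsub>E\<^esub> rho_map A r, y). (x, y) \<leftarrow> \<delta> a] =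
      tensor_sum (carrier ZA) CL CL [(x, y \<otimes>\<^bsub>E\<^esub> lambda_map A r). (x, y) \<leftarrow> \<delta> a]" by simp
qed (simp add: lambda_rho_commute)

lemma right_bialgebroid_End:
  "right_bialgebroid K E (opp ZA) (rho_map A) (lambda_map A) (End_comult A B) (End_counit A)"
proof (intro right_bialgebroid.intro right_bialgebroid_axioms.intro E.assoc_algebra_axioms
    assoc_algebra_opp ZA_assoc_algebra)
  interpret ZA: assoc_algebra K "opp ZA" by (intro assoc_algebra_opp ZA_assoc_algebra)
  show "coring (opp ZA) CR (End_comult A B) (End_counit A)"
    by (rule coring_End[OF End_bimod_right ZA.ring_axioms]) (simp_all add: Z_comm)
  show "rho_map A \<in> alg_hom K (opp ZA) E" "lambda_map A \<in> alg_hom K (opp ZA) (opp E)"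
    by (rule lambda_alg_hom rho_alg_hom)+
  show "End_comult A B \<one>\<^bsub>E\<^esub> = tensor_sum (carrier (opp ZA)) CR CR [(\<one>\<^bsub>E\<^esub>, \<one>\<^bsub>E\<^esub>)]"
    using End_comult_eq[OF End_bimod_right _ repr_one] by simp
  show "End_counit A \<one>\<^bsub>E\<^esub> = \<one>\<^bsub>opp ZA\<^esub>" by (simp add: End_counit_def)
  fix a b assume a: "a \<in> S" and b: "b \<in> S"
  \<comment> \<open>\<open>b(1)\<close> lies in \<open>R \<subseteq> B\<close>, so it passes out of
    \<open>a\<close>; commutativity of \<open>R\<close> then gives both the source and the target
    form of the counit axiom.\<close>
  have "a (b \<one> \<otimes> \<one>) = b \<one> \<otimes> a \<one>" "a \<one> \<otimes> b \<one> = b \<one> \<otimes> a \<one>"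
    using End_l[OF a, of "b \<one>" \<one>] counit_closed[OF a] counit_closed[OF b] Z_comm by simp_all
  then show "End_counit A (a \<otimes>\<^bsub>E\<^esub> b) = End_counit A (rho_map A (End_counit A a) \<otimes>\<^bsub>E\<^esub> b)"
    "End_counit A (a \<otimes>\<^bsub>E\<^esub> b) = End_counit A (lambda_map A (End_counit A a) \<otimes>\<^bsub>E\<^esub> b)"
    using a b counit_closed[OF b] by (simp_all add: End_counit_def EndD)
  fix \<delta> assume "sweedler (carrier (opp ZA)) CR (End_comult A B) \<delta>"
  then have rd: "repr (\<delta> \<alpha>) \<alpha>" if "\<alpha> \<in> S" for \<alpha>
    using sweedler_repr[OF End_bimod_right] that by simp
  show "End_comult A B (a \<otimes>\<^bsub>E\<^esub> b) = tensor_sum (carrier (opp ZA)) CR CR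
      [(x \<otimes>\<^bsub>E\<^esub> x', y \<otimes>\<^bsub>E\<^esub> y'). (x, y) \<leftarrow> \<delta> a, (x', y') \<leftarrow> \<delta> b]"
    using End_comult_eq[OF End_bimod_right _ repr_compose[OF a rd[OF a] b rd[OF b]]] a b by simp
  fix r assume r: "r \<in> carrier (opp ZA)"
  note d = repr_mem[OF rd[OF a]]
  have "tensor_sum Z CR CR [(rho_map A r \<otimes>\<^bsub>E\<^esub> x, y). (x, y) \<leftarrow> \<delta> a] =
      tensor_sum Z CR CR [(x, lambda_map A r \<otimes>\<^bsub>E\<^esub> y). (x, y) \<leftarrow> \<delta> a]"
  proof (rule End_tensor_eqI[OF End_bimod_right End_bimod_right])
    fix x y assume xy: "x \<in> carrier A" "y \<in> carrier A"
    have "asum (\<lambda>z. fst z x \<otimes> snd z y) [(rho_map A r \<otimes>\<^bsub>E\<^esub> x, y). (x, y) \<leftarrow> \<delta> a] =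
        asum (\<lambda>z. fst z x \<otimes> r \<otimes> snd z y) (\<delta> a)"
      unfolding map_map comp_def
      using xy d by (intro list_sum_cong) (simp add: case_prod_unfold EndD)
    also have "\<dots> = asum (\<lambda>z. fst z x \<otimes> snd z y) [(x, lambda_map A r \<otimes>\<^bsub>E\<^esub> y). (x, y) \<leftarrow> \<delta> a]"
      unfolding map_map comp_def
      using xy d r by (intro list_sum_cong) (simp add: case_prod_unfold EndD m_assoc)
    finally show "asum (\<lambda>z. fst z x \<otimes> snd z y) [(rho_map A r \<otimes>\<^bsub>E\<^esub> x, y). (x, y) \<leftarrow> \<delta> a] =
        asum (\<lambda>z. fst z x \<otimes> snd z y) [(x, lambda_map A r \<otimes>\<^bsub>E\<^esub> y). (x, y) \<leftarrow> \<delta> a]" .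
  qed (use d r in auto)
  then show "tensor_sum (carrier (opp ZA)) CR CR [(rho_map A r \<otimes>\<^bsub>E\<^esub> x, y). (x, y) \<leftarrow> \<delta> a] =
      tensor_sum (carrier (opp ZA)) CR CR [(x, lambda_map A r \<otimes>\<^bsub>E\<^esub> y). (x, y) \<leftarrow> \<delta> a]" by simp
qed (simp add: lambda_rho_commute)

end

section \<open>The Hopf algebroid\<close>

context irreducible
begin

text \<open>\<open>f \<otimes> g\<close> is well defined over \<open>B\<close> and commutes with the
  outer actions of \<open>B\<close>, hence preserves \<open>T\<close>. The image is described by its
  effect on \<open>ev\<close>, which allows \<open>evR_antipode\<close> to be used with one factor
  of \<open>t\<close> already transformed.\<close>

lemma T_act:
  assumes f: "f \<in> S" and g: "g \<in> S" and t: "t \<in> T_set A B"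
  obtains t' where "t' \<in> T_set A B" "\<And>\<phi>. bal \<phi> \<Longrightarrow> ev \<phi> t' = ev (\<lambda>x y. \<phi> (f x) (g y)) t"
proof -
  define \<psi> where "\<psi> x y = pt (f x) (g y)" for x y
  define lft where "lft = tensor_lift B (reg_bimod A) (reg_bimod A) TT \<psi>"
  define h where "h = (\<lambda>(x, y). (f x, g y))"
  have \<psi>: "balanced B (reg_bimod A) (reg_bimod A) TT \<psi>"
    unfolding \<psi>_def using f g
    by (intro balancedI) (simp_all add: EndD pt_closed pt_balanced)
  have hc: "h z \<in> carrier A \<times> carrier A" if "z \<in> carrier A \<times> carrier A" for z
    using that f g by (auto simp: h_def End_closed)
  have hs: "set (map h xs) \<subseteq> carrier A \<times> carrier A" if "set xs \<subseteq> carrier A \<times> carrier A" for xs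
    using that hc by (simp only: set_map image_subset_iff) blast
  have lft: "lft (ts xs) = ts (map h xs)" if xs: "set xs \<subseteq> carrier A \<times> carrier A" for xs
  proof -
    have "lft (ts xs) = list_sum TT (map (\<lambda>(x, y). \<psi> x y) xs)"
      unfolding lft_def using xs by (intro lift_ts comm_group_TG \<psi>) simp
    also have "\<dots> = list_sum TT (map (\<lambda>p. ts [h p]) xs)"
      by (rule list_sum_cong) (simp add: \<psi>_def h_def case_prod_unfold)
    also have "\<dots> = ts (map h xs)"
      using xs hc by (intro ts_map[symmetric]) auto
    finally show ?thesis .
  qed
  obtain xs where xs: "set xs \<subseteq> carrier A \<times> carrier A" "t = ts xs"
    using T_setD(1)[OF t] by (rule ex_rep_A)
  have "lft t \<in> T_set A B"
    unfolding T_set_def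
  proof (intro CollectI conjI ballI)
    show "lft t \<in> carrier TS"
      unfolding lft_def using hom_in_carrier[OF lift_hom[OF comm_group_TG \<psi>] T_setD(1)[OF t]] by simp
    fix b assume b: "b \<in> B"
    have l: "set (map (\<lambda>(x, y). (b \<otimes> x, y)) xs) \<subseteq> carrier A \<times> carrier A"
      and r: "set (map (\<lambda>(x, y). (x, y \<otimes> b)) xs) \<subseteq> carrier A \<times> carrier A"
      using xs b by auto
    have "lact TS b (lft t) = ts (map h (map (\<lambda>(x, y). (b \<otimes> x, y)) xs))"
      unfolding xs(2) lft[OF xs(1)] lact_rep[OF B_closed[OF b] hs[OF xs(1)]] map_map comp_def
      using xs(1) b f by (intro arg_cong[of _ _ ts] map_cong) (auto simp: h_def End_l)
    also have "\<dots> = lft (lact TS b t)"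
      unfolding xs(2) lact_rep[OF B_closed[OF b] xs(1)] using lft[OF l] by simp
    also have "\<dots> = lft (ract TS t b)" using T_setD(2)[OF t b] by simp
    also have "\<dots> = ts (map h (map (\<lambda>(x, y). (x, y \<otimes> b)) xs))"
      unfolding xs(2) ract_rep[OF B_closed[OF b] xs(1)] using lft[OF r] by simp
    also have "\<dots> = ract TS (lft t) b"
      unfolding xs(2) lft[OF xs(1)] ract_rep[OF B_closed[OF b] hs[OF xs(1)]] map_map comp_def
      using xs(1) b g by (intro arg_cong[of _ _ ts] map_cong) (auto simp: h_def End_r)
    finally show "lact TS b (lft t) = ract TS (lft t) b" .
  qed
  moreover have "ev \<phi> (lft t) = ev (\<lambda>x y. \<phi> (f x) (g y)) t" if \<phi>: "bal \<phi>" for \<phi>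
  proof -
    have "bal (\<lambda>x y. \<phi> (f x) (g y))"
      using balD[OF \<phi>] f g by (intro balI) (simp_all add: EndD)
    then show ?thesis
      unfolding xs(2) lft[OF xs(1)] using xs(1) hs[OF xs(1)] \<phi>
      by (simp add: ev_rep) (auto simp: comp_def h_def intro!: list_sum_cong)
  qed
  ultimately show thesis by (rule that)
qed

lemma ev_add_fun:
  assumes "bal \<phi>" "bal \<psi>" "t \<in> carrier TT"
  shows "ev (\<lambda>x y. \<phi> x y \<oplus> \<psi> x y) t = ev \<phi> t \<oplus> ev \<psi> t"
proof -
  obtain xs where xs: "set xs \<subseteq> carrier A \<times> carrier A" "t = ts xs"
    using assms(3) by (rule ex_rep_A)
  have xs': "fst z \<in> carrier A" "snd z \<in> carrier A" if "z \<in> set xs" for z using xs(1) that by auto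
  note D = balD[OF assms(1)] balD[OF assms(2)]
  have "bal (\<lambda>x y. \<phi> x y \<oplus> \<psi> x y)"
    using D by (intro balI) (simp_all add: M.a_assoc M.a_comm M.a_lcomm)
  then show ?thesis
    using xs xs' assms D(1,5) by (simp add: ev_rep case_prod_unfold asum_add)
qed

text \<open>The defining condition as a test: with it, algebraic properties of the antipode become
  identities between pairings.\<close>

lemma antipode_eqI:
  assumes "\<alpha> \<in> S" "\<beta> \<in> S" "\<And>t. t \<in> T_set A B \<Longrightarrow> evL \<alpha> t = evR \<beta> t"
  shows "antipode \<alpha> = \<beta>"
  using assms by (intro End_eq_evR antipode_closed) (simp_all add: evR_antipode)

text \<open>Two applications of the condition: \<open>\<alpha>(\<beta>(t\<^sup>1)) t\<^sup>2 =
  \<beta>(t\<^sup>1) \<tau>(\<alpha>)(t\<^sup>2)\<close> at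
  \<open>t1 = \<beta>(t\<^sup>1) \<otimes> t\<^sup>2\<close>, and \<open>\<beta>(t\<^sup>1)
  \<tau>(\<alpha>)(t\<^sup>2) = t\<^sup>1 \<tau>(\<beta>)(\<tau>(\<alpha>)(t\<^sup>2))\<close> at
  \<open>t2 = t\<^sup>1 \<otimes> \<tau>(\<alpha>)(t\<^sup>2)\<close>. The reversal of order comes
  from peeling off the outer map first.\<close>

lemma antipode_mult:
  assumes \<alpha>: "\<alpha> \<in> S" and \<beta>: "\<beta> \<in> S"
  shows "antipode (\<alpha> \<otimes>\<^bsub>E\<^esub> \<beta>) = antipode \<beta> \<otimes>\<^bsub>E\<^esub> antipode \<alpha>"
proof (rule antipode_eqI)
  fix t assume t: "t \<in> T_set A B"
  note tc = T_setD(1)[OF t]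
  have one: "\<one>\<^bsub>E\<^esub> \<in> S" by simp
  note a = antipode_closed[OF \<alpha>] antipode_closed[OF \<beta>]
  obtain t1 where t1: "t1 \<in> T_set A B" "\<And>\<phi>. bal \<phi> \<Longrightarrow> ev \<phi> t1 = ev (\<lambda>x y. \<phi> (\<beta> x) (\<one>\<^bsub>E\<^esub> y)) t"
    using \<beta> one t by (rule T_act) blast
  obtain t2 where t2: "t2 \<in> T_set A B" "\<And>\<phi>. bal \<phi> \<Longrightarrow> ev \<phi> t2 = ev (\<lambda>x y. \<phi> (\<one>\<^bsub>E\<^esub> x) (antipode \<alpha> y)) t"
    using one a(1) t by (rule T_act) blast
  have b: "bal (\<lambda>x y. \<beta> x \<otimes> antipode \<alpha> y)"
    using a \<beta> by (intro balI) (simp_all add: EndD l_distr r_distr m_assoc)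
  have "evL (\<alpha> \<otimes>\<^bsub>E\<^esub> \<beta>) t = ev (\<lambda>x y. \<alpha> (\<beta> x) \<otimes> \<one>\<^bsub>E\<^esub> y) t"
    using \<alpha> \<beta> tc by (intro ev_cong bal_L) simp_all
  also have "\<dots> = evL \<alpha> t1" using t1(2)[OF bal_L[OF \<alpha>]] by simp
  also have "\<dots> = evR (antipode \<alpha>) t1" using evR_antipode[OF \<alpha> t1(1)] by simp
  also have "\<dots> = ev (\<lambda>x y. \<beta> x \<otimes> antipode \<alpha> (\<one>\<^bsub>E\<^esub> y)) t" using t1(2)[OF bal_R[OF a(1)]] .
  also have "\<dots> = ev (\<lambda>x y. \<beta> x \<otimes> antipode \<alpha> y) t"
    using b tc by (intro ev_cong[symmetric]) simp_all
  also have "\<dots> = ev (\<lambda>x y. \<beta> (\<one>\<^bsub>E\<^esub> x) \<otimes> antipode \<alpha> y) t"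
    using b tc by (intro ev_cong) simp_all
  also have "\<dots> = evL \<beta> t2" using t2(2)[OF bal_L[OF \<beta>]] by simp
  also have "\<dots> = evR (antipode \<beta>) t2" using evR_antipode[OF \<beta> t2(1)] by simp
  also have "\<dots> = ev (\<lambda>x y. \<one>\<^bsub>E\<^esub> x \<otimes> antipode \<beta> (antipode \<alpha> y)) t" using t2(2)[OF bal_R[OF a(2)]] .
  also have "\<dots> = evR (antipode \<beta> \<otimes>\<^bsub>E\<^esub> antipode \<alpha>) t"
    using a tc by (intro ev_cong[symmetric] bal_R) simp_all
  finally show "evL (\<alpha> \<otimes>\<^bsub>E\<^esub> \<beta>) t = evR (antipode \<beta> \<otimes>\<^bsub>E\<^esub> antipode \<alpha>) t" .
qed (use \<alpha> \<beta> antipode_closed in auto)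

lemma antipode_one: "antipode \<one>\<^bsub>E\<^esub> = \<one>\<^bsub>E\<^esub>"
proof (rule antipode_eqI)
  fix t assume "t \<in> T_set A B"
  then show "evL \<one>\<^bsub>E\<^esub> t = evR \<one>\<^bsub>E\<^esub> t"
    by (intro ev_cong bal_L T_setD) simp_all
qed auto

lemma antipode_add:
  assumes \<alpha>: "\<alpha> \<in> S" and \<beta>: "\<beta> \<in> S"
  shows "antipode (\<alpha> \<oplus>\<^bsub>E\<^esub> \<beta>) = antipode \<alpha> \<oplus>\<^bsub>E\<^esub> antipode \<beta>"
proof (rule antipode_eqI)
  fix t assume t: "t \<in> T_set A B"
  note tc = T_setD(1)[OF t] and a = antipode_closed[OF \<alpha>] antipode_closed[OF \<beta>]
  have "evL (\<alpha> \<oplus>\<^bsub>E\<^esub> \<beta>) t = ev (\<lambda>x y. \<alpha> x \<otimes> y \<oplus> \<beta> x \<otimes> y) t"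
    using \<alpha> \<beta> tc by (intro ev_cong bal_L) (simp_all add: End_closed l_distr)
  also have "\<dots> = evL \<alpha> t \<oplus> evL \<beta> t"
    using \<alpha> \<beta> tc by (intro ev_add_fun bal_L)
  also have "\<dots> = evR (antipode \<alpha>) t \<oplus> evR (antipode \<beta>) t"
    using \<alpha> \<beta> t by (simp add: evR_antipode)
  also have "\<dots> = ev (\<lambda>x y. x \<otimes> antipode \<alpha> y \<oplus> x \<otimes> antipode \<beta> y) t"
    using a tc by (intro ev_add_fun[symmetric] bal_R)
  also have "\<dots> = evR (antipode \<alpha> \<oplus>\<^bsub>E\<^esub> antipode \<beta>) t"
    using a tc by (intro ev_cong[symmetric] bal_R) (simp_all add: End_closed r_distr)
  finally show "evL (\<alpha> \<oplus>\<^bsub>E\<^esub> \<beta>) t = evR (antipode \<alpha> \<oplus>\<^bsub>E\<^esub> antipode \<beta>) t" .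
qed (use \<alpha> \<beta> antipode_closed in auto)

lemma antipode_smult:
  assumes k: "k \<in> carrier K" and \<alpha>: "\<alpha> \<in> S"
  shows "antipode (k \<odot>\<^bsub>E\<^esub> \<alpha>) = k \<odot>\<^bsub>E\<^esub> antipode \<alpha>"
proof (rule antipode_eqI)
  fix t assume t: "t \<in> T_set A B"
  note tc = T_setD(1)[OF t] and a = antipode_closed[OF \<alpha>]
  have "evL (k \<odot>\<^bsub>E\<^esub> \<alpha>) t = ev (\<lambda>x y. k \<odot>\<^bsub>A\<^esub> (\<alpha> x \<otimes> y)) t"
    using \<alpha> k tc by (intro ev_cong bal_L) (simp_all add: End_closed smult_mult_left)
  also have "\<dots> = k \<odot>\<^bsub>A\<^esub> evL \<alpha> t"
    using k tc by (intro ev_comp[symmetric] bal_L \<alpha>) (auto simp: smult_r_distr)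
  also have "\<dots> = k \<odot>\<^bsub>A\<^esub> evR (antipode \<alpha>) t"
    using \<alpha> t by (simp add: evR_antipode)
  also have "\<dots> = ev (\<lambda>x y. k \<odot>\<^bsub>A\<^esub> (x \<otimes> antipode \<alpha> y)) t"
    using k tc by (intro ev_comp bal_R a) (auto simp: smult_r_distr)
  also have "\<dots> = evR (k \<odot>\<^bsub>E\<^esub> antipode \<alpha>) t"
    using a k tc by (intro ev_cong[symmetric] bal_R) (simp_all add: End_closed smult_mult_right)
  finally show "evL (k \<odot>\<^bsub>E\<^esub> \<alpha>) t = evR (k \<odot>\<^bsub>E\<^esub> antipode \<alpha>) t" .
qed (use \<alpha> k antipode_closed in auto)

lemma bal_mult: "bal (\<lambda>x y. x \<otimes> y)"
  by (intro balI) (simp_all add: l_distr r_distr m_assoc)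

lemma ev_mult_central: "t \<in> T_set A B \<Longrightarrow> ev (\<lambda>x y. x \<otimes> y) t \<in> Z"
  by (rule ev_T_central[OF bal_mult]) (simp_all add: m_assoc)

lemma evR_rho:
  assumes "r \<in> Z" "t \<in> T_set A B"
  shows "evR (rho_map A r) t = ev (\<lambda>x y. x \<otimes> y) t \<otimes> r"
proof -
  note tc = T_setD(1)[OF assms(2)]
  have "evR (rho_map A r) t = ev (\<lambda>x y. (x \<otimes> y) \<otimes> r) t"
    using assms(1) tc by (intro ev_cong bal_R) (simp_all add: m_assoc)
  also have "\<dots> = ev (\<lambda>x y. x \<otimes> y) t \<otimes> r"
    using assms(1) tc bal_mult by (intro ev_comp[symmetric]) (auto simp: l_distr)
  finally show ?thesis .
qed

text \<open>Commutativity of \<open>R\<close> enters here: \<open>t\<^sup>1 t\<^sup>2\<close> lies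
  in \<open>R\<close>, so \<open>r t\<^sup>1 t\<^sup>2 = t\<^sup>1 t\<^sup>2 r\<close>.\<close>

lemma antipode_lambda:
  assumes r: "r \<in> Z"
  shows "antipode (lambda_map A r) = rho_map A r"
proof (rule antipode_eqI)
  fix t assume t: "t \<in> T_set A B"
  note tc = T_setD(1)[OF t]
  have "evL (lambda_map A r) t = ev (\<lambda>x y. r \<otimes> (x \<otimes> y)) t"
    using r tc by (intro ev_cong bal_L) (simp_all add: m_assoc)
  also have "\<dots> = r \<otimes> ev (\<lambda>x y. x \<otimes> y) t"
    using r tc bal_mult by (intro ev_comp[symmetric]) (auto simp: r_distr)
  also have "\<dots> = evR (rho_map A r) t"
    using evR_rho[OF r t] Z_comm[OF r ev_mult_central[OF t]] by simp
  finally show "evL (lambda_map A r) t = evR (rho_map A r) t" .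
qed (use r in auto)

text \<open>This direction is associativity,
  \<open>(t\<^sup>1 r) t\<^sup>2 = t\<^sup>1 (r t\<^sup>2)\<close>.\<close>

lemma antipode_rho:
  assumes r: "r \<in> Z"
  shows "antipode (rho_map A r) = lambda_map A r"
proof (rule antipode_eqI)
  fix t assume "t \<in> T_set A B"
  then show "evL (rho_map A r) t = evR (lambda_map A r) t"
    using r by (intro ev_cong bal_L T_setD) (simp_all add: m_assoc)
qed (use r in auto)

text \<open>Injectivity is nondegeneracy of \<open>evL\<close>; surjectivity is
  \<open>ex_evL_eq_evR\<close>.\<close>

lemma antipode_bij: "bij_betw antipode S S"
proof (rule bij_betw_imageI)
  show "inj_on antipode S"
  proof (rule inj_onI)
    fix \<alpha> \<beta> assume *: "\<alpha> \<in> S" "\<beta> \<in> S" "antipode \<alpha> = antipode \<beta>"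
    show "\<alpha> = \<beta>"
      using * evR_antipode[of \<alpha>] evR_antipode[of \<beta>] by (intro End_eq_evL) simp_all
  qed
  show "antipode ` S = S"
  proof
    show "S \<subseteq> antipode ` S"
    proof
      fix \<beta> assume \<beta>: "\<beta> \<in> S"
      then obtain \<alpha> where "\<alpha> \<in> S" "\<forall>t\<in>T_set A B. evL \<alpha> t = evR \<beta> t"
        using ex_evL_eq_evR by blast
      then have "antipode \<alpha> = \<beta>" using \<beta> by (intro antipode_eqI) auto
      then show "\<beta> \<in> antipode ` S" using \<open>\<alpha> \<in> S\<close> by blast
    qed
  qed (auto intro: antipode_closed)
qed

text \<open>Here \<open>1 \<otimes> a = \<Sum>\<^sub>j \<gamma>\<^sub>j(a) u\<^sub>j\<close> gives
  \<open>\<Sum> \<alpha>\<^sub>1(\<gamma>\<^sub>j(a) \<alpha>\<^sub>2(u\<^sub>j\<^sup>1) u\<^sub>j\<^sup>2) = \<Sum> \<alpha>(\<gamma>\<^sub>j(a) u\<^sub>j\<^sup>1) u\<^sub>j\<^sup>2 = \<alpha>(1) a\<close>.\<close>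

lemma antipode_right:
  assumes \<alpha>: "\<alpha> \<in> S" and ws: "repr ws \<alpha>"
  shows "list_sum (add_monoid E) [x \<otimes>\<^bsub>E\<^esub> antipode y. (x, y) \<leftarrow> ws] = lambda_map A (\<alpha> \<one>)"
proof (rule End_eqI)
  note w = reprD(1,2)[OF ws]
  have c: "fst z \<otimes>\<^bsub>E\<^esub> antipode (snd z) \<in> S" if "z \<in> set ws" for z
    using w[OF that] antipode_closed by simp
  then show "list_sum (add_monoid E) [x \<otimes>\<^bsub>E\<^esub> antipode y. (x, y) \<leftarrow> ws] \<in> S"
    by (simp add: case_prod_unfold End_list_sum_closed)
  show "lambda_map A (\<alpha> \<one>) \<in> S" using counit_closed[OF \<alpha>] by simp
  fix a assume a: "a \<in> carrier A"
  have ga: "fst p a \<in> carrier A" if "p \<in> set pb" for p using a pb_mem(1)[OF that] by (simp add: End_closed)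
  have e: "evL (snd z) (snd p) \<in> Z" if "z \<in> set ws" "p \<in> set pb" for z p
    using that w pb_mem by (intro evL_central) auto
  have "list_sum (add_monoid E) [x \<otimes>\<^bsub>E\<^esub> antipode y. (x, y) \<leftarrow> ws] a =
      asum (\<lambda>z. fst z (antipode (snd z) a)) ws"
    using c a by (simp add: case_prod_unfold End_list_sum)
  also have "\<dots> = asum (\<lambda>z. asum (\<lambda>p. fst z (fst p a) \<otimes> evL (snd z) (snd p)) pb) ws"
  proof (rule list_sum_cong)
    fix z assume z: "z \<in> set ws"
    have "fst z (antipode (snd z) a) = fst z (asum (\<lambda>p. fst p a \<otimes> evL (snd z) (snd p)) pb)"
      using a by (simp add: antipode_def)
    also have "\<dots> = asum (\<lambda>p. fst z (fst p a \<otimes> evL (snd z) (snd p))) pb"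
      using w[OF z] ga e[OF z] by (intro End_asum) simp_all
    \<comment> \<open>The coefficients \<open>evL (snd z) (snd p)\<close> lie in
      \<open>R \<subseteq> B\<close>, so right \<open>B\<close>-linearity of \<open>fst z\<close>
      lets them out.\<close>
    also have "\<dots> = asum (\<lambda>p. fst z (fst p a) \<otimes> evL (snd z) (snd p)) pb"
      using w[OF z] ga e[OF z] by (intro list_sum_cong End_r) simp_all
    finally show "fst z (antipode (snd z) a) = asum (\<lambda>p. fst z (fst p a) \<otimes> evL (snd z) (snd p)) pb" .
  qed
  also have "\<dots> = asum (\<lambda>p. asum (\<lambda>z. fst z (fst p a) \<otimes> evL (snd z) (snd p)) ws) pb"
    using w ga e by (intro add.list_sum_swap) (simp add: End_closed)
  also have "\<dots> = asum (\<lambda>p. evL \<alpha> (lact TS (fst p a) (snd p))) pb"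
  proof (rule list_sum_cong)
    fix p assume p: "p \<in> set pb"
    note tc = pb_mem(3)[OF p] and g = ga[OF p]
    let ?\<phi> = "\<lambda>z x y. fst z (fst p a) \<otimes> (snd z x \<otimes> y)"
    have b: "bal (?\<phi> z)" if "z \<in> set ws" for z
      using w[OF that] g by (intro balI) (simp_all add: EndD l_distr r_distr m_assoc)
    note s = ev_sum[of ws ?\<phi>, OF b tc]
    have "asum (\<lambda>z. fst z (fst p a) \<otimes> evL (snd z) (snd p)) ws = asum (\<lambda>z. ev (?\<phi> z) (snd p)) ws"
      using w g tc by (intro list_sum_cong ev_comp bal_L) (auto simp: End_closed r_distr)
    also have "\<dots> = ev (\<lambda>x y. asum (\<lambda>z. ?\<phi> z x y) ws) (snd p)" using s(2) by simp
    also have "\<dots> = ev (\<lambda>x y. \<alpha> (fst p a \<otimes> x) \<otimes> y) (snd p)"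
    proof (rule ev_cong[OF s(1) tc])
      fix x y assume xy: "x \<in> carrier A" "y \<in> carrier A"
      have "asum (\<lambda>z. ?\<phi> z x y) ws = asum (\<lambda>z. (fst z (fst p a) \<otimes> snd z x) \<otimes> y) ws"
        using w g xy by (intro list_sum_cong) (simp add: End_closed m_assoc)
      also have "\<dots> = asum (\<lambda>z. fst z (fst p a) \<otimes> snd z x) ws \<otimes> y"
        using w g xy by (intro asum_l_distr[symmetric]) (simp_all add: End_closed)
      finally show "asum (\<lambda>z. ?\<phi> z x y) ws = \<alpha> (fst p a \<otimes> x) \<otimes> y"
        using reprD(3)[OF ws g xy(1)] by simp
    qed
    also have "\<dots> = evL \<alpha> (lact TS (fst p a) (snd p))"
      using ev_lact(2)[OF bal_L[OF \<alpha>] g tc] by simp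
    finally show "asum (\<lambda>z. fst z (fst p a) \<otimes> evL (snd z) (snd p)) ws =
        evL \<alpha> (lact TS (fst p a) (snd p))" .
  qed
  \<comment> \<open>The inserted unit gives the sum the shape of the right quasibasis expansion of
    \<open>1 \<otimes> a\<close>.\<close>
  also have "\<dots> = asum (\<lambda>p. evL \<alpha> (lact TS (\<one> \<otimes> fst p a) (snd p))) pb"
    using ga by (intro list_sum_cong) simp
  also have "\<dots> = evL \<alpha> (pt \<one> a)"
    using ga a by (simp add: pt_pb ev_list_sum[OF bal_L[OF \<alpha>]] lact_closed_TS pb_mem)
  also have "\<dots> = \<alpha> \<one> \<otimes> a" using ev_pt[OF bal_L[OF \<alpha>]] a by simp
  finally show "list_sum (add_monoid E) [x \<otimes>\<^bsub>E\<^esub> antipode y. (x, y) \<leftarrow> ws] a = lambda_map A (\<alpha> \<one>) a"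
    using a by simp
qed

text \<open>Here \<open>\<Sum> t\<^sup>1 \<tau>(\<alpha>\<^sub>1)(\<alpha>\<^sub>2(t\<^sup>2)) = \<Sum> \<alpha>\<^sub>1(t\<^sup>1) \<alpha>\<^sub>2(t\<^sup>2) = \<alpha>(t\<^sup>1 t\<^sup>2) = t\<^sup>1 t\<^sup>2 \<alpha>(1)\<close>,
  because \<open>t\<^sup>1 \<otimes> \<alpha>\<^sub>2(t\<^sup>2)\<close> lies in \<open>T\<close> and \<open>t\<^sup>1 t\<^sup>2\<close> in \<open>R \<subseteq> B\<close>.\<close>

lemma antipode_left:
  assumes \<alpha>: "\<alpha> \<in> S" and ws: "repr ws \<alpha>"
  shows "list_sum (add_monoid E) [antipode x \<otimes>\<^bsub>E\<^esub> y. (x, y) \<leftarrow> ws] = rho_map A (\<alpha> \<one>)"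
proof (rule End_eq_evR)
  note w = reprD(1,2)[OF ws]
  have c: "antipode (fst z) \<otimes>\<^bsub>E\<^esub> snd z \<in> S" if "z \<in> set ws" for z
    using w[OF that] antipode_closed by simp
  let ?l = "list_sum (add_monoid E) [antipode x \<otimes>\<^bsub>E\<^esub> y. (x, y) \<leftarrow> ws]"
  show l: "?l \<in> S" using c by (simp add: case_prod_unfold End_list_sum_closed)
  show r: "rho_map A (\<alpha> \<one>) \<in> S" using counit_closed[OF \<alpha>] by simp
  fix t assume t: "t \<in> T_set A B"
  note tc = T_setD(1)[OF t]
  let ?\<phi> = "\<lambda>z x y. x \<otimes> antipode (fst z) (snd z y)"
  have b: "bal (?\<phi> z)" if "z \<in> set ws" for z
    using w[OF that] antipode_closed[OF w(1)[OF that]]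
    by (intro balI) (simp_all add: EndD l_distr r_distr m_assoc)
  note s = ev_sum[of ws ?\<phi>, OF b tc]
  have b': "bal (\<lambda>x y. fst z x \<otimes> snd z y)" if "z \<in> set ws" for z
    using w[OF that] by (intro balI) (simp_all add: EndD l_distr r_distr m_assoc)
  note s' = ev_sum[of ws "\<lambda>z x y. fst z x \<otimes> snd z y", OF b' tc]
  have "evR ?l t = ev (\<lambda>x y. asum (\<lambda>z. ?\<phi> z x y) ws) t"
  proof (rule ev_cong[OF bal_R[OF l] tc])
    fix x y assume xy: "x \<in> carrier A" "y \<in> carrier A"
    have "?l y = asum (\<lambda>z. antipode (fst z) (snd z y)) ws"
      using c xy by (simp add: case_prod_unfold End_list_sum)
    then show "x \<otimes> ?l y = asum (\<lambda>z. ?\<phi> z x y) ws"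
      using xy w antipode_closed by (simp add: asum_r_distr End_closed)
  qed
  also have "\<dots> = asum (\<lambda>z. ev (?\<phi> z) t) ws" by (rule s(2))
  also have "\<dots> = asum (\<lambda>z. ev (\<lambda>x y. fst z x \<otimes> snd z y) t) ws"
  proof (rule list_sum_cong)
    fix z assume z: "z \<in> set ws"
    note z = w[OF z] b[OF z] b'[OF z]
    have one: "\<one>\<^bsub>E\<^esub> \<in> S" by simp
    obtain t' where t': "t' \<in> T_set A B" "\<And>\<phi>. bal \<phi> \<Longrightarrow> ev \<phi> t' = ev (\<lambda>x y. \<phi> (\<one>\<^bsub>E\<^esub> x) (snd z y)) t"
      using one z(2) t by (rule T_act) blast
    have "ev (?\<phi> z) t = ev (\<lambda>x y. \<one>\<^bsub>E\<^esub> x \<otimes> antipode (fst z) (snd z y)) t"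
      using z(3) tc by (intro ev_cong) simp_all
    also have "\<dots> = evR (antipode (fst z)) t'"
      using t'(2)[OF bal_R[OF antipode_closed[OF z(1)]]] by simp
    also have "\<dots> = evL (fst z) t'" using z(1) t'(1) by (rule evR_antipode)
    also have "\<dots> = ev (\<lambda>x y. fst z (\<one>\<^bsub>E\<^esub> x) \<otimes> snd z y) t"
      using t'(2)[OF bal_L[OF z(1)]] .
    also have "\<dots> = ev (\<lambda>x y. fst z x \<otimes> snd z y) t"
      using z(4) tc by (intro ev_cong[symmetric]) simp_all
    finally show "ev (?\<phi> z) t = ev (\<lambda>x y. fst z x \<otimes> snd z y) t" .
  qed
  also have "\<dots> = ev (\<lambda>x y. asum (\<lambda>z. fst z x \<otimes> snd z y) ws) t" using s'(2) by simp
  also have "\<dots> = ev (\<lambda>x y. \<alpha> (x \<otimes> y)) t"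
    using reprD(3)[OF ws] by (intro ev_cong[OF s'(1) tc])
  also have "\<dots> = \<alpha> (ev (\<lambda>x y. x \<otimes> y) t)"
    using \<alpha> tc bal_mult by (intro ev_comp[symmetric]) (auto simp: EndD)
  also have "\<dots> = ev (\<lambda>x y. x \<otimes> y) t \<otimes> \<alpha> \<one>"
    using End_l[OF \<alpha>, of "ev (\<lambda>x y. x \<otimes> y) t" \<one>] ev_mult_central[OF t] by simp
  also have "\<dots> = evR (rho_map A (\<alpha> \<one>)) t"
    using evR_rho[OF counit_closed[OF \<alpha>] t] by simp
  finally show "evR ?l t = evR (rho_map A (\<alpha> \<one>)) t" .
qed

lemma hopf_algebroid_End:
  assumes \<tau>: "\<tau> \<in> S \<rightarrow> S" "antipode_condition A B \<tau>"
  shows "hopf_algebroid K E ZA (lambda_map A) (rho_map A) (End_comult A B) (End_counit A)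
    (rho_map A) (lambda_map A) (End_comult A B) (End_counit A) \<tau>"
\<comment> \<open>\<open>refl\<close> settles the image conditions: \<open>sR\<close> and
  \<open>tL\<close> are both \<open>rho_map A\<close>, and \<open>tR\<close> and \<open>sL\<close>
  are both \<open>lambda_map A\<close>.\<close>
proof (intro hopf_algebroid.intro hopf_algebroid_axioms.intro left_bialgebroid_End right_bialgebroid_End refl)
  \<comment> \<open>The given \<tau> may differ from \<open>antipode\<close> outside
    \<open>S\<close>, so it is replaced only at elements of \<open>S\<close>.\<close>
  have \<tau>E: "\<tau> \<alpha> = antipode \<alpha>" if "\<alpha> \<in> S" for \<alpha>
    using that \<tau> antipode_condition_iff[OF \<tau>(1)]
    by (intro antipode_eqI[symmetric]) auto
  note cl = antipode_closed
  show "\<tau> \<in> alg_hom K E (opp E)"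
    unfolding alg_hom_def ring_hom_def
    by (auto simp: \<tau>E cl antipode_mult antipode_add antipode_one antipode_smult)
  show "bij_betw \<tau> S S"
    using antipode_bij by (simp add: \<tau>E cong: bij_betw_cong)
  show "\<tau> (a \<otimes>\<^bsub>E\<^esub> lambda_map A r) = rho_map A r \<otimes>\<^bsub>E\<^esub> \<tau> a"
    "\<tau> (rho_map A r \<otimes>\<^bsub>E\<^esub> a) = \<tau> a \<otimes>\<^bsub>E\<^esub> lambda_map A r"
    if "a \<in> S" "r \<in> carrier ZA" for a r
    using that by (simp_all add: \<tau>E antipode_mult antipode_lambda antipode_rho)
  note rL = sweedler_repr[OF End_bimod_left] and rR = sweedler_repr[OF End_bimod_right]
  show "list_sum (add_monoid E) [x \<otimes>\<^bsub>E\<^esub> \<tau> y. (x, y) \<leftarrow> \<delta> a] = lambda_map A (End_counit A a)"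
    if "sweedler (carrier ZA) CR (End_comult A B) \<delta>" "a \<in> S" for \<delta> a
  proof -
    have ws: "repr (\<delta> a) a" using that by (intro rR) simp_all
    have "list_sum (add_monoid E) [x \<otimes>\<^bsub>E\<^esub> \<tau> y. (x, y) \<leftarrow> \<delta> a] =
        list_sum (add_monoid E) [x \<otimes>\<^bsub>E\<^esub> antipode y. (x, y) \<leftarrow> \<delta> a]"
      using repr_mem[OF ws] by (intro list_sum_cong) (auto simp: \<tau>E)
    then show ?thesis using antipode_right[OF that(2) ws] by (simp add: End_counit_def)
  qed
  show "list_sum (add_monoid E) [\<tau> x \<otimes>\<^bsub>E\<^esub> y. (x, y) \<leftarrow> \<delta> a] = rho_map A (End_counit A a)"
    if "sweedler (carrier ZA) CL (End_comult A B) \<delta>" "a \<in> S" for \<delta> a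
  proof -
    have ws: "repr (\<delta> a) a" using that by (intro rL) simp_all
    have "list_sum (add_monoid E) [\<tau> x \<otimes>\<^bsub>E\<^esub> y. (x, y) \<leftarrow> \<delta> a] =
        list_sum (add_monoid E) [antipode x \<otimes>\<^bsub>E\<^esub> y. (x, y) \<leftarrow> \<delta> a]"
      using repr_mem[OF ws] by (intro list_sum_cong) (auto simp: \<tau>E)
    then show ?thesis using antipode_left[OF that(2) ws] by (simp add: End_counit_def)
  qed
  fix \<delta>L \<delta>R a
  assume "sweedler (carrier ZA) CL (End_comult A B) \<delta>L"
    and "sweedler (carrier ZA) CR (End_comult A B) \<delta>R" and a: "a \<in> S"
  then have \<delta>: "repr (\<delta>L \<alpha>) \<alpha>" "repr (\<delta>R \<alpha>) \<alpha>" if "\<alpha> \<in> S" for \<alpha>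
    using that rL rR by simp_all
  note CC = End_bimod_left End_bimod_right
  show "let MR = CR; ML = CL; N = MR\<lparr>ract := ract ML\<rparr> in
      tensor3_sum (carrier ZA) (carrier ZA) MR N ML [(x, y, z). (x, v) \<leftarrow> \<delta>R a, (y, z) \<leftarrow> \<delta>L v] =
      tensor3_sum (carrier ZA) (carrier ZA) MR N ML [(x, y, z). (u, z) \<leftarrow> \<delta>L a, (x, y) \<leftarrow> \<delta>R u]"
    unfolding Let_def centralizer_alg_simps
    \<comment> \<open>The lists are supplied in the order outer and inner on the left-nested side,
      then outer and inner on the right-nested side: \<open>\<delta>L\<close>,
      \<open>\<delta>R\<close>, \<open>\<delta>R\<close>, \<open>\<delta>L\<close>.\<close>
    by (rule coassoc_End[OF CC(2) End_bimod_mixed[OF CC(2,1)] CC(1) \<delta>(1) \<delta>(2) \<delta>(2) \<delta>(1) a, symmetric])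
  show "let MR = CR; ML = CL; N = ML\<lparr>ract := ract MR\<rparr> in
      tensor3_sum (carrier ZA) (carrier ZA) ML N MR [(x, y, z). (x, v) \<leftarrow> \<delta>L a, (y, z) \<leftarrow> \<delta>R v] =
      tensor3_sum (carrier ZA) (carrier ZA) ML N MR [(x, y, z). (u, z) \<leftarrow> \<delta>R a, (x, y) \<leftarrow> \<delta>L u]"
    unfolding Let_def centralizer_alg_simps
    by (rule coassoc_End[OF CC(1) End_bimod_mixed[OF CC(1,2)] CC(2) \<delta>(2) \<delta>(1) \<delta>(1) \<delta>(2) a, symmetric])
qed

end

lemma irreducible_if_irreducible_extension:
  assumes "irreducible_extension K A B"
  shows "irreducible K A B"
  using assms
  by (auto simp: irreducible_extension_def irreducible_def irreducible_axioms_def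
      extension_def extension_axioms_def)

text \<open>The first conjunct justifies speaking of the map determined by the condition. That
  \<tau> is an anti-automorphism is not assumed: it is part of what \<open>hopf_algebroid\<close>
  asserts.\<close>

theorem theorem4p1:
  fixes K :: "('k, 'm) ring_scheme"
    and A :: "('k, 'a, 'n) module_scheme"
    and B :: "'a set"
  assumes "irreducible_extension K A B"
  shows "(\<exists>!\<tau>. \<tau> \<in> carrier (End_alg A B) \<rightarrow>\<^sub>E carrier (End_alg A B) \<and> antipode_condition A B \<tau>) \<and>
    (\<forall>\<tau> \<in> carrier (End_alg A B) \<rightarrow> carrier (End_alg A B). antipode_condition A B \<tau> \<longrightarrow>
      (\<exists>sR tR \<Delta>R \<epsilon>R.
        hopf_algebroid K (End_alg A B) (centralizer_alg A B)
          (lambda_map A) (rho_map A) (End_comult A B) (End_counit A)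
          sR tR \<Delta>R \<epsilon>R \<tau>))"
proof -
  interpret irreducible K A B using assms by (rule irreducible_if_irreducible_extension)
  show ?thesis using antipode_unique hopf_algebroid_End by blast
qed

end
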